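(* Let $e_1,e_2,e_3$ be nonzero integers with $e_1+e_2+e_3=0$, $2\,\|\,e_1$, $2\,\|\,e_2$, $4\mid e_3$ (so $\gcd(e_1,e_2,e_3)=2$). Let $n=p_1\cdots p_k$ be an odd positive square-free integer coprime with $e_1e_2e_3$, whose prime factors are quadratic residues modulo each odd prime factor of $e_1e_2e_3$. Assume that - neither $E$ nor $E^{(n)}$ has a rational point of order $4$; - $e_2>0$ and $e_3<0$, or all $p_i\equiv 1\pmod 4$; - $\left(\frac{p^*}{q}\right)=1$ for all odd primes $p\mid n$, $q\mid e_2e_3$. If $\mathrm{Sel}_2(E/\mathbb{Q})\cong(\mathbb{Z}/2\mathbb{Z})^2$, then every class of $\mathrm{Sel}_2'(E^{(n)})$ has a unique representative $(d_1,d_2,d_3)$ with $d_i$ (possibly negative) divisors of $n$, $d_1>0$ and $d_3\equiv1\pmod 4$, and the map $(d_1,d_2,d_3)\mapsto\begin{pmatrix}\mathbf{x}\\ \mathbf{z}\end{pmatrix}$, where $\mathbf{x}=(v_{p_i}(d_1))_i^{\mathrm T}$, $\mathbf{z}=(v_{p_i}(d_3))_i^{\mathrm T}\in\mathbb{F}_2^k$, induces an isomorphism $$\mathrm{Sel}_2'(E^{(n)})\xrightarrow{\sim}\ker\begin{pmatrix}\mathbf{A}+\mathbf{D}_{e_2}&\mathbf{D}_{-e_2e_3}\\ \mathbf{D}_{-e_1e_2}&\mathbf{A}^{\mathrm T}+\mathbf{D}_{e_2}\end{pmatrix}.$$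
   Context: For a nonzero integer $m$, $E^{(m)}$ is $y^2=x(x-e_1m)(x+e_2m)$, $E=E^{(1)}$. For $\Lambda=(d_1,d_2,d_3)$ of nonzero square-free integers with $d_1d_2d_3$ a square, $D^{(m)}_\Lambda\subset\mathbb{P}^3$ is defined by $e_1mt^2+d_2u_2^2-d_3u_3^2=0$, $e_2mt^2+d_3u_3^2-d_1u_1^2=0$, $e_3mt^2+d_1u_1^2-d_2u_2^2=0$. $\mathrm{Sel}_2(E^{(m)}/\mathbb{Q})$ is identified with the group (componentwise multiplication) of $\Lambda\in(\mathbb{Q}^\times/\mathbb{Q}^{\times2})^3$ with $d_1d_2d_3\in\mathbb{Q}^{\times2}$ and $D^{(m)}_\Lambda(\mathbb{A}_{\mathbb{Q}})\ne\emptyset$; rational 2-torsion points correspond to $(1,1,1)$, $(-e_3m,-e_1e_3,e_1m)$, $(-e_2e_3,e_3m,-e_2m)$, $(e_2m,-e_1m,-e_1e_2)$. $\mathrm{Sel}_2'(E^{(m)})=\mathrm{Sel}_2(E^{(m)}/\mathbb{Q})/(E^{(m)}(\mathbb{Q})_{\rm tors}/2E^{(m)}(\mathbb{Q})_{\rm tors})$. $[\alpha,\beta]_v$ is the additive Hilbert symbol, $(\alpha,\beta)_v=(-1)^{[\alpha,\beta]_v}$. $\mathbf{A}=([p_j,-n]_{p_i})_{i,j}\in M_k(\mathbb{F}_2)$. For $u$ coprime to $n$, $\mathbf{D}_u=\mathrm{diag}([u/p_1],\dots,[u/p_k])$, with $[u/p]\in\mathbb{F}_2$ equal to $0$ if $u$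 is a quadratic residue mod $p$ and $1$ otherwise. For an odd integer $m$, $m^*=(-1)^{(m-1)/2}m\equiv1\pmod 4$. $2\,\|\,m$ means $2\mid m$, $4\nmid m$. *)

theory Defs
  imports "HOL-Number_Theory.Number_Theory" "HOL-Library.Z2" "HOL-Computational_Algebra.Squarefree" Complex_Main
begin

text \<open>Points of y^2 = x(x - e1 m)(x + e2 m) over Q; None is the point at infinity.\<close>

definition on_curve :: "int \<Rightarrow> int \<Rightarrow> int \<Rightarrow> (rat \<times> rat) option \<Rightarrow> bool" where
  "on_curve e1 e2 m P = (case P of None \<Rightarrow> True
     | Some (x, y) \<Rightarrow> y^2 = x * (x - of_int (e1*m)) * (x + of_int (e2*m)))"

text \<open>Chord-tangent addition on y^2 = x^3 + a x^2 + b x + c.\<close>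
definition wadd :: "rat \<Rightarrow> rat \<Rightarrow> rat \<Rightarrow> (rat \<times> rat) option \<Rightarrow> (rat \<times> rat) option \<Rightarrow> (rat \<times> rat) option" where
  "wadd a b c P Q = (case P of None \<Rightarrow> Q | Some (x1, y1) \<Rightarrow>
     (case Q of None \<Rightarrow> P | Some (x2, y2) \<Rightarrow>
       (if x1 = x2 \<and> y1 = - y2 then None
        else let l = (if x1 = x2 then (3*x1^2 + 2*a*x1 + b) / (2*y1) else (y2 - y1) / (x2 - x1));
                 x3 = l^2 - a - x1 - x2
             in Some (x3, - (l * (x3 - x1) + y1)))))"

definition curve_add :: "int \<Rightarrow> int \<Rightarrow> int \<Rightarrow> (rat \<times> rat) option \<Rightarrow> (rat \<times> rat) option \<Rightarrow> (rat \<times> rat) option" where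
  "curve_add e1 e2 m = wadd (of_int ((e2 - e1) * m)) (of_int (- e1 * e2 * m^2)) 0"

definition has_rat_point_order4 :: "int \<Rightarrow> int \<Rightarrow> int \<Rightarrow> bool" where
  "has_rat_point_order4 e1 e2 m = (\<exists>P. on_curve e1 e2 m P \<and>
      curve_add e1 e2 m P P \<noteq> None \<and>
      curve_add e1 e2 m (curve_add e1 e2 m P P) (curve_add e1 e2 m P P) = None)"

text \<open>Square-free representative of the class of a nonzero integer in Q^x/Q^x2.\<close>
definition sqf :: "int \<Rightarrow> int" where
  "sqf a = sgn a * (\<Prod>p\<in>{p\<in>prime_factors a. odd (multiplicity p a)}. p)"

definition trip_mul :: "int \<times> int \<times> int \<Rightarrow> int \<times> int \<times> int \<Rightarrow> int \<times> int \<times> int" where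
  "trip_mul L L' = (case L of (a1, a2, a3) \<Rightarrow> case L' of (b1, b2, b3) \<Rightarrow>
       (sqf (a1*b1), sqf (a2*b2), sqf (a3*b3)))"

definition sqf_trip :: "int \<Rightarrow> int \<Rightarrow> int \<Rightarrow> int \<times> int \<times> int" where
  "sqf_trip a b c = (sqf a, sqf b, sqf c)"

text \<open>The three quadrics defining D_Lambda^(m), with e3 = -e1-e2.\<close>
definition Deqs :: "int \<Rightarrow> int \<Rightarrow> int \<Rightarrow> int \<Rightarrow> int \<times> int \<times> int \<Rightarrow> 'a::comm_ring_1 \<Rightarrow> 'a \<Rightarrow> 'a \<Rightarrow> 'a \<Rightarrow> 'a list" where
  "Deqs e1 e2 e3 m L t u1 u2 u3 = (case L of (d1, d2, d3) \<Rightarrow>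
     [of_int (e1*m) * t^2 + of_int d2 * u2^2 - of_int d3 * u3^2,
      of_int (e2*m) * t^2 + of_int d3 * u3^2 - of_int d1 * u1^2,
      of_int (e3*m) * t^2 + of_int d1 * u1^2 - of_int d2 * u2^2])"

text \<open>D(Q_p) nonempty: for a projective variety this is equivalent (by compactness of
  Z_p-points) to having primitive integral solutions modulo every power of p.\<close>
definition loc_solv_p :: "int \<Rightarrow> int \<Rightarrow> int \<Rightarrow> int \<Rightarrow> int \<times> int \<times> int \<Rightarrow> int \<Rightarrow> bool" where
  "loc_solv_p e1 e2 e3 m L p = (\<forall>N::nat. \<exists>t u1 u2 u3 :: int.
      \<not> (p dvd t \<and> p dvd u1 \<and> p dvd u2 \<and> p dvd u3) \<and>
      (\<forall>f\<in>set (Deqs e1 e2 e3 m L t u1 u2 u3). [f = 0] (mod p^N)))"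

definition loc_solv_R :: "int \<Rightarrow> int \<Rightarrow> int \<Rightarrow> int \<Rightarrow> int \<times> int \<times> int \<Rightarrow> bool" where
  "loc_solv_R e1 e2 e3 m L = (\<exists>t u1 u2 u3 :: real.
      (t, u1, u2, u3) \<noteq> (0, 0, 0, 0) \<and> (\<forall>f\<in>set (Deqs e1 e2 e3 m L t u1 u2 u3). f = 0))"

definition Sel2 :: "int \<Rightarrow> int \<Rightarrow> int \<Rightarrow> int \<Rightarrow> (int \<times> int \<times> int) set" where
  "Sel2 e1 e2 e3 m = {(d1, d2, d3). d1 \<noteq> 0 \<and> d2 \<noteq> 0 \<and> d3 \<noteq> 0 \<and>
      squarefree d1 \<and> squarefree d2 \<and> squarefree d3 \<and>
      (\<exists>s::int. d1 * d2 * d3 = s^2) \<and>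
      loc_solv_R e1 e2 e3 m (d1, d2, d3) \<and>
      (\<forall>p::int. prime p \<longrightarrow> loc_solv_p e1 e2 e3 m (d1, d2, d3) p)}"

text \<open>Image of the rational 2-torsion of E^(m).\<close>
definition tors_img :: "int \<Rightarrow> int \<Rightarrow> int \<Rightarrow> int \<Rightarrow> (int \<times> int \<times> int) set" where
  "tors_img e1 e2 e3 m = {(1, 1, 1), sqf_trip (- e3*m) (- e1*e3) (e1*m),
      sqf_trip (- e2*e3) (e3*m) (- e2*m), sqf_trip (e2*m) (- e1*m) (- e1*e2)}"

definition sel_equiv :: "int \<Rightarrow> int \<Rightarrow> int \<Rightarrow> int \<Rightarrow> int \<times> int \<times> int \<Rightarrow> int \<times> int \<times> int \<Rightarrow> bool" where
  "sel_equiv e1 e2 e3 m L L' = (trip_mul L L' \<in> tors_img e1 e2 e3 m)"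

text \<open>Additive Hilbert symbol [a,b]_p in F_2: 0 iff a x^2 + b y^2 = z^2 has a nontrivial
  solution in Q_p (i.e. primitive solutions modulo every power of p).\<close>
definition hilb :: "int \<Rightarrow> int \<Rightarrow> int \<Rightarrow> bit" where
  "hilb a b p = (if (\<forall>N::nat. \<exists>x y z :: int. \<not> (p dvd x \<and> p dvd y \<and> p dvd z) \<and>
                    [a*x^2 + b*y^2 = z^2] (mod p^N)) then 0 else 1)"

definition qr_bit :: "int \<Rightarrow> int \<Rightarrow> bit" where
  "qr_bit u p = (if QuadRes p u then 0 else 1)"

text \<open>Vectors in F_2^k are indexed by the prime factors of n (zero elsewhere).
  Kernel of [[A + D_{e2}, D_{-e2e3}], [D_{-e1e2}, A^T + D_{e2}]], A_{p,q} = [q,-n]_p.\<close>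
definition sel_kernel :: "int \<Rightarrow> int \<Rightarrow> int \<Rightarrow> int \<Rightarrow> ((int \<Rightarrow> bit) \<times> (int \<Rightarrow> bit)) set" where
  "sel_kernel e1 e2 e3 n = {(x, z).
     (\<forall>q. q \<notin> prime_factors n \<longrightarrow> x q = 0 \<and> z q = 0) \<and>
     (\<forall>p\<in>prime_factors n.
        (\<Sum>q\<in>prime_factors n. hilb q (- n) p * x q) + qr_bit e2 p * x p
          + qr_bit (- e2*e3) p * z p = 0 \<and>
        qr_bit (- e1*e2) p * x p
          + (\<Sum>q\<in>prime_factors n. hilb p (- n) q * z q) + qr_bit e2 p * z p = 0)}"

definition sel_vec :: "int \<Rightarrow> int \<times> int \<times> int \<Rightarrow> (int \<Rightarrow> bit) \<times> (int \<Rightarrow> bit)" where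
  "sel_vec n L = (case L of (d1, d2, d3) \<Rightarrow>
     (\<lambda>q. if q \<in> prime_factors n then of_nat (multiplicity q d1) else 0,
      \<lambda>q. if q \<in> prime_factors n then of_nat (multiplicity q d3) else 0))"

definition vec_add :: "(int \<Rightarrow> bit) \<times> (int \<Rightarrow> bit) \<Rightarrow> (int \<Rightarrow> bit) \<times> (int \<Rightarrow> bit) \<Rightarrow> (int \<Rightarrow> bit) \<times> (int \<Rightarrow> bit)" where
  "vec_add v w = (\<lambda>q. fst v q + fst w q, \<lambda>q. snd v q + snd w q)"

definition sel_reps :: "int \<Rightarrow> int \<Rightarrow> int \<Rightarrow> int \<Rightarrow> (int \<times> int \<times> int) set" where
  "sel_reps e1 e2 e3 n = {(d1, d2, d3). (d1, d2, d3) \<in> Sel2 e1 e2 e3 n \<and>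
      d1 dvd n \<and> d2 dvd n \<and> d3 dvd n \<and> d1 > 0 \<and> d3 mod 4 = 1}"

end

theory Submission
  imports Defs
begin

text \<open>
  Local solubility of the covering of a triple \<open>(d\<^sub>1,d\<^sub>2,d\<^sub>3)\<close> is made explicit at every place. At a prime of
  good reduction every unit triple is soluble (a character sum); at \<open>p | n\<close> the soluble triples are the
  classes of the 2-torsion points, and this is what the rows of the matrix express, by quadratic reciprocity;
  at odd \<open>q | e\<^sub>1e\<^sub>2e\<^sub>3\<close> divisors of \<open>n\<close> are squares up to sign, so they do not affect solubility. The
  condition at 2 is forced by the others: an odd triple with \<open>d\<^sub>3 \<equiv> 1 (mod 4)\<close> that is soluble at all other places is soluble
  at 2, by the product formula for Hilbert symbols. Each Selmer class of the twist contains exactly one odd triple,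
  because the four torsion classes have distinct parity patterns; its part prime to \<open>n\<close> is an odd Selmer
  element of \<open>E\<close>, hence trivial since the Selmer group of \<open>E\<close> is the image of the torsion.
\<close>

section \<open>Legendre symbols and square roots modulo prime powers\<close>

text \<open>Signs are the obstacle. Normalising \<open>d3\<close> to 1 modulo 4 makes
  \<open>d2\<close> and \<open>d3\<close> negative whenever the positive divisor behind
  \<open>d3\<close> is 3 modulo 4, and then -1 must be harmless at every place. This happens only if
  some p | n is 3 modulo 4. For such p both p and -p are residues modulo each odd q |
  \<open>e2 * e3\<close>, so -1 is one too, and the sign hypothesis leaves
  \<open>e2 > 0 > e3\<close>, where real solubility is exactly \<open>d1 > 0\<close>. At an odd q
  dividing only \<open>e1\<close>, -1 may be a nonresidue; but there the roots 0 and
  \<open>e1 * m\<close> of the cubic collide modulo q, and solubility of the covering survives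
  negation of \<open>d2\<close> and \<open>d3\<close>. No p-adic numbers occur: solubility means
  congruences modulo all powers, with solutions primitive up to a bounded power of p. Accordingly
  \<open>hs\<close>, \<open>hs_inf\<close> and \<open>hs_2\<close> are closed formulas. At odd
  primes and the real place only the implication from solubility of the covering to symbol 1 is
  proved; the return from symbols to solubility is made only at 2, by a finite check modulo
  8.\<close>

lemma odd_prime_gt_2: "prime (p::int) \<Longrightarrow> odd p \<Longrightarrow> 2 < p"
  using prime_ge_2_int[of p] by (cases "p = 2") auto

lemma QuadRes_cong: "[a = b] (mod p) \<Longrightarrow> QuadRes p a = QuadRes p b"
  unfolding QuadRes_def by (meson cong_sym cong_trans)

lemma Legendre_cong: "[a = b] (mod p) \<Longrightarrow> Legendre a p = Legendre b p"
  unfolding Legendre_def cong_0_iff by (simp add: QuadRes_cong cong_dvd_iff)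

lemma Legendre_eq_0_iff: "Legendre a p = 0 \<longleftrightarrow> p dvd a"
  unfolding Legendre_def by (auto simp: cong_0_iff)

lemma Legendre_eq_1_iff: "\<not> p dvd a \<Longrightarrow> Legendre a p = 1 \<longleftrightarrow> QuadRes p a"
  unfolding Legendre_def by (auto simp: cong_0_iff)

lemma Legendre_values: "\<not> p dvd a \<Longrightarrow> Legendre a p = 1 \<or> Legendre a p = -1"
  unfolding Legendre_def by (auto simp: cong_0_iff)

lemma Legendre_ge: "-1 \<le> Legendre a p" and Legendre_le: "Legendre a p \<le> 1"
  unfolding Legendre_def by auto

lemma cong_small_imp_eq:
  fixes a b p :: int
  assumes "[a = b] (mod p)" "\<bar>a - b\<bar> < p" shows "a = b"
  using assms zdvd_not_zless[of "\<bar>a - b\<bar>" p] by (auto simp: cong_iff_dvd_diff)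

text \<open>Euler's criterion gives the identity modulo p; both sides lie in {-1, 0, 1}, so they
  differ by at most 2 < p and are equal.\<close>

lemma Legendre_mult:
  assumes "prime p" "odd p"
  shows "Legendre (a * b) p = Legendre a p * Legendre b p"
proof -
  define q where "q = nat p"
  have q: "prime q" "2 < q" "p = int q"
    using assms odd_prime_gt_2[OF assms] by (auto simp: q_def)
  let ?k = "(q - 1) div 2"
  have "[Legendre (a * b) p = (a * b) ^ ?k] (mod p)"
    using euler_criterion[OF q(1,2)] q(3) by blast
  moreover have "[Legendre a p * Legendre b p = a ^ ?k * b ^ ?k] (mod p)"
    using euler_criterion[OF q(1,2)] q(3) by (intro cong_mult) blast+
  ultimately have c: "[Legendre (a * b) p = Legendre a p * Legendre b p] (mod p)"
    by (metis cong_sym cong_trans power_mult_distrib)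
  have "\<bar>Legendre a p * Legendre b p\<bar> \<le> 1 * 1"
    unfolding abs_mult
    by (intro mult_mono) (use Legendre_ge[of a p] Legendre_le[of a p] Legendre_ge[of b p] Legendre_le[of b p] in auto)
  then show ?thesis
    using Legendre_ge[of "a*b" p] Legendre_le[of "a*b" p] odd_prime_gt_2[OF assms]
    by (intro cong_small_imp_eq[OF c]) linarith
qed

lemma Legendre_1: "prime p \<Longrightarrow> Legendre 1 p = 1"
  unfolding Legendre_def QuadRes_def by (auto simp: cong_0_iff intro: exI[of _ 1])

lemma Legendre_square: "\<not> p dvd a \<Longrightarrow> Legendre a p * Legendre a p = 1"
  using Legendre_values[of p a] by auto

lemma Legendre_square_arg: "prime p \<Longrightarrow> odd p \<Longrightarrow> \<not> p dvd a \<Longrightarrow> Legendre (a^2) p = 1"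
  by (simp add: power2_eq_square Legendre_mult Legendre_square)

section \<open>The characters modulo 4 and 8 and the reciprocity laws\<close>

lemma int_odd_mod4: "odd (a::int) \<Longrightarrow> a mod 4 = 1 \<or> a mod 4 = 3"
  by presburger

lemma int_odd_mod8: "odd (a::int) \<Longrightarrow> a mod 8 = 1 \<or> a mod 8 = 3 \<or> a mod 8 = 5 \<or> a mod 8 = 7"
  by presburger

text \<open>\<open>chi4\<close> and \<open>chi8\<close> generate the characters of the units modulo
  8. At odd primes they are the symbols of -1 and 2, and together they make up the Hilbert symbol at
  2.\<close>

definition chi4 :: "int \<Rightarrow> int" where
  "chi4 a = (if even a then 0 else if a mod 4 = 1 then 1 else -1)"

definition chi8 :: "int \<Rightarrow> int" where
  "chi8 a = (if even a then 0 else if a mod 8 = 1 \<or> a mod 8 = 7 then 1 else -1)"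

lemma chi4_mult: "chi4 (a * b) = chi4 a * chi4 b"
proof (cases "odd a \<and> odd b")
  case True
  then have "a mod 4 = 1 \<or> a mod 4 = 3" "b mod 4 = 1 \<or> b mod 4 = 3"
    using int_odd_mod4 by auto
  moreover have "(a * b) mod 4 = ((a mod 4) * (b mod 4)) mod 4" by (simp add: mod_mult_eq)
  ultimately show ?thesis using True unfolding chi4_def by auto
qed (auto simp: chi4_def)

lemma chi8_mult: "chi8 (a * b) = chi8 a * chi8 b"
proof (cases "odd a \<and> odd b")
  case True
  then have "a mod 8 = 1 \<or> a mod 8 = 3 \<or> a mod 8 = 5 \<or> a mod 8 = 7"
    "b mod 8 = 1 \<or> b mod 8 = 3 \<or> b mod 8 = 5 \<or> b mod 8 = 7"
    using int_odd_mod8 by auto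
  moreover have "(a * b) mod 8 = ((a mod 8) * (b mod 8)) mod 8" by (simp add: mod_mult_eq)
  ultimately show ?thesis using True unfolding chi8_def by (elim disjE) simp_all
qed (auto simp: chi8_def)

lemma Legendre_minus1:
  assumes "prime p" "odd p" shows "Legendre (-1) p = chi4 p"
proof -
  define q where "q = nat p"
  have q: "prime q" "2 < q" "p = int q"
    using assms odd_prime_gt_2[OF assms] by (auto simp: q_def)
  have "odd q" using assms q(3) by auto
  have c: "[Legendre (-1) p = (-1) ^ ((q - 1) div 2)] (mod p)"
    using euler_criterion[OF q(1,2)] q(3) by blast
  have e: "(-1) ^ ((q - 1) div 2) = chi4 p"
  proof (cases "q mod 4 = 1")
    case True
    then have "even ((q - 1) div 2)" using \<open>odd q\<close> by presburger
    moreover have "p mod 4 = 1" using True q(3) by presburger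
    ultimately show ?thesis using assms by (auto simp: chi4_def)
  next
    case False
    then have "odd ((q - 1) div 2)" using \<open>odd q\<close> by presburger
    moreover have "p mod 4 \<noteq> 1" using False q(3) by presburger
    ultimately show ?thesis using assms by (auto simp: chi4_def)
  qed
  have "\<bar>chi4 p\<bar> \<le> 1" by (auto simp: chi4_def)
  then show ?thesis
    using c Legendre_ge[of "-1" p] Legendre_le[of "-1" p] odd_prime_gt_2[OF assms]
    unfolding e by (intro cong_small_imp_eq[OF c[unfolded e]]) linarith
qed

text \<open>Gauss's lemma with multiplier 2: with h = (p - 1)/2, no doubling of 1, ..., h wraps
  around modulo p, so the exceptional set \<open>E\<close> consists of the doubles of x > h/2. The
  parity of \<open>h - h div 2\<close> depends only on p modulo 8.\<close>

lemma Legendre_2: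
  assumes "prime p" "odd p" shows "Legendre 2 p = chi8 p"
proof -
  define q where "q = nat p"
  have q: "prime q" "2 < q" "p = int q"
    using assms odd_prime_gt_2[OF assms] by (auto simp: q_def)
  have nd: "[2 \<noteq> 0] (mod int q)" using q(2) by (auto simp: cong_0_iff dest: zdvd_imp_le)
  interpret GAUSS q 2 by (rule GAUSS.intro[OF q(1,2) nd]) simp
  define h where "h = (p - 1) div 2"
  have ph: "p = 2 * h + 1" using assms unfolding h_def by presburger
  have A: "A = {0 <.. h}" unfolding A_def h_def q(3) ..
  have "C = (\<lambda>x. x * 2) ` A"
    unfolding C_def B_def image_image A
  proof (intro image_cong refl)
    fix x assume "x \<in> {0<..h}"
    then show "x * 2 mod int q = x * 2"
      using ph q(3) by (intro mod_pos_pos_trivial) auto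
  qed
  then have E': "E = (\<lambda>x. x * 2) ` {0 <.. h} \<inter> {h <..}"
    unfolding E_def A by (simp add: h_def q(3))
  have E: "E = (\<lambda>x. x * 2) ` {h div 2 <.. h}"
  proof (intro equalityI subsetI)
    fix y assume "y \<in> E"
    then obtain x where "y = x * 2" "0 < x" "x \<le> h" "h < y" unfolding E' by auto
    moreover from this have "h div 2 < x" by presburger
    ultimately show "y \<in> (\<lambda>x. x * 2) ` {h div 2 <.. h}" by auto
  next
    fix y assume "y \<in> (\<lambda>x. x * 2) ` {h div 2 <.. h}"
    then obtain x where x: "y = x * 2" "h div 2 < x" "x \<le> h" by auto
    then have "h < y" by presburger
    moreover have "0 < x" using x ph q by presburger
    ultimately show "y \<in> E" using x unfolding E' by auto
  qed
  have "card E = nat (h - h div 2)"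
    unfolding E by (subst card_image) (auto simp: inj_on_def)
  then have L: "Legendre 2 p = (-1) ^ nat (h - h div 2)" using gauss_lemma q(3) by simp
  have ev: "even (nat (h - h div 2)) \<longleftrightarrow> p mod 8 = 1 \<or> p mod 8 = 7"
  proof -
    have "0 \<le> h" using ph q by linarith
    then have "even (nat (h - h div 2)) \<longleftrightarrow> even (h - h div 2)" by (simp add: even_nat_iff)
    also have "\<dots> \<longleftrightarrow> p mod 8 = 1 \<or> p mod 8 = 7" unfolding ph by presburger
    finally show ?thesis .
  qed
  show ?thesis using ev assms(2) unfolding L chi8_def by (auto simp: uminus_power_if)
qed

lemma Legendre_reciprocity:
  assumes "prime p" "odd p" "prime q" "odd q" "p \<noteq> q"
  shows "Legendre p q * Legendre q p = (if chi4 p = -1 \<and> chi4 q = -1 then -1 else 1)"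
proof -
  have gt: "2 < p" "2 < q" using assms odd_prime_gt_2 by auto
  have L: "Legendre p q * Legendre q p = (-1) ^ nat ((p - 1) div 2 * ((q - 1) div 2))"
    using assms gt by (intro Quadratic_Reciprocity_int) auto
  have "even (nat ((p - 1) div 2 * ((q - 1) div 2))) \<longleftrightarrow> even ((p - 1) div 2 * ((q - 1) div 2))"
    using gt by (simp add: even_nat_iff)
  also have "\<dots> \<longleftrightarrow> even ((p - 1) div 2) \<or> even ((q - 1) div 2)" by simp
  also have "\<dots> \<longleftrightarrow> p mod 4 = 1 \<or> q mod 4 = 1"
  proof -
    have "even ((p - 1) div 2) \<longleftrightarrow> p mod 4 = 1" using assms(2) by presburger
    moreover have "even ((q - 1) div 2) \<longleftrightarrow> q mod 4 = 1" using assms(4) by presburger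
    ultimately show ?thesis by blast
  qed
  finally show ?thesis using assms unfolding L by (auto simp: chi4_def uminus_power_if)
qed

text \<open>Hensel lifting: with a = s^2 + p^N k, replacing s by s + p^N r repairs the next digit as
  soon as 2 s r is congruent to k modulo p, and 2 s is invertible because p is odd.\<close>

lemma square_root_mod_power:
  assumes "prime p" "odd p" "\<not> p dvd a" "QuadRes p a"
  shows "\<exists>s. [s^2 = a] (mod p ^ N) \<and> \<not> p dvd s"
proof (induction N)
  case 0
  have "\<not> p dvd 1" using assms(1) not_prime_unit by blast
  then show ?case by (intro exI[of _ 1]) auto
next
  case (Suc N)
  show ?case
  \<comment> \<open>Modulo p^0 the root carries no information, so the first real root comes from
    \<open>QuadRes\<close>. Only from N = 1 on is p^(2N) divisible by p^(N+1), as the lifting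
    requires.\<close>
  proof (cases "N = 0")
    case True
    obtain y where "[y^2 = a] (mod p)" using assms(4) unfolding QuadRes_def by blast
    moreover from this have "\<not> p dvd y"
      using assms(3) by (metis cong_dvd_iff dvd_power zero_less_numeral dvd_trans pos2)
    ultimately show ?thesis using True by auto
  next
    case False
    obtain s where s: "[s^2 = a] (mod p ^ N)" "\<not> p dvd s" using Suc.IH by blast
    then obtain k where k: "a = s^2 + p ^ N * k"
      unfolding cong_iff_lin by blast
    have "\<not> p dvd 2" using odd_prime_gt_2[OF assms(1,2)] zdvd_not_zless by fastforce
    then have "coprime (2 * s) p"
      using assms(1) s(2) by (metis coprime_commute prime_dvd_mult_iff prime_imp_coprime)
    then obtain r0 where "[2 * s * r0 = 1] (mod p)" using cong_solve_coprime_int by blast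
    then have "[2 * s * r0 * k = 1 * k] (mod p)" by (rule cong_scalar_right)
    then obtain j0 where "1 * k = 2 * s * r0 * k + p * j0" unfolding cong_iff_lin by blast
    then obtain r j where j: "k = 2 * s * r + p * j" by (metis mult.assoc mult_1)
    have "(s + p ^ N * r)^2 = s^2 + p ^ N * (2 * s * r) + p ^ N * p ^ N * r^2"
      by (simp add: power2_eq_square algebra_simps)
    also have "\<dots> = a - p ^ N * (p * j) + p ^ N * p ^ N * r^2"
      unfolding k j by (simp add: algebra_simps)
    also have "p ^ N = p * p ^ (N - 1)" using False by (simp add: power_eq_if)
    finally have "(s + p ^ N * r)^2 - a = p ^ Suc N * (p ^ (N - 1) * r^2 - j)" 
      using False by (simp add: power_eq_if algebra_simps)
    then have "[(s + p ^ N * r)^2 = a] (mod p ^ Suc N)"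
      by (metis cong_iff_dvd_diff dvd_triv_left)
    moreover have "\<not> p dvd s + p ^ N * r"
      using s(2) False by (meson dvd_add_left_iff dvd_mult2 dvd_power neq0_conv)
    ultimately show ?thesis by blast
  qed
qed

text \<open>The derivative 2 s costs a factor 2, so a root modulo 2^(N+3) is corrected by a multiple
  k of 2^(N+2). The remaining error contains k (s - 1), which is even because s is odd; the
  hypothesis modulo 8 supplies the root 1 to start from.\<close>

lemma square_root_mod_2_power:
  assumes "(a::int) mod 8 = 1"
  shows "\<exists>s. [s^2 = a] (mod 2 ^ N) \<and> odd s"
proof -
  have "\<exists>s. [s^2 = a] (mod 2 ^ (N + 3)) \<and> odd s" for N
  proof (induction N)
    case 0
    show ?case using assms by (intro exI[of _ 1]) (auto simp: cong_def)
  next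
    case (Suc N)
    then obtain s where s: "[s^2 = a] (mod 2 ^ (N + 3))" "odd s" by blast
    then obtain k where k: "a = s^2 + 2 ^ (N + 3) * k" unfolding cong_iff_lin by blast
    have "(s + 2 ^ (N + 2) * k)^2 - a = 2 ^ (N + 3) * (k * (s - 1)) + 2 ^ (N + 4) * (2 ^ N * k^2)"
      unfolding k by (simp add: power2_eq_square algebra_simps power_add)
    moreover obtain j where "s = 2 * j + 1" using s(2) by (elim oddE)
    then have "s - 1 = 2 * j" by simp
    ultimately have "(s + 2 ^ (N + 2) * k)^2 - a = 2 ^ (N + 3) * (k * (2 * j)) + 2 ^ (N + 4) * (2 ^ N * k^2)"
      by simp
    also have "\<dots> = 2 ^ (N + 4) * (k * j + 2 ^ N * k^2)"
      by (simp add: distrib_left power_add)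
    finally have "(s + 2 ^ (N + 2) * k)^2 - a = 2 ^ (Suc N + 3) * (k * j + 2 ^ N * k^2)"
      by (simp add: numeral_eq_Suc)
    then have "[(s + 2 ^ (N + 2) * k)^2 = a] (mod 2 ^ (Suc N + 3))"
      by (metis cong_iff_dvd_diff dvd_triv_left)
    moreover have "odd (s + 2 ^ (N + 2) * k)" using s(2) by simp
    ultimately show ?case by blast
  qed
  then obtain s where "[s^2 = a] (mod 2 ^ (N + 3))" "odd s" by blast
  then show ?thesis by (meson cong_dvd_modulus le_add1 le_imp_power_dvd)
qed

lemma unit_times_square_cong:
  assumes "prime p" "odd p" "\<not> p dvd a" "\<not> p dvd b" "QuadRes p (a * b)"
  shows "\<exists>s. [a * s^2 = b] (mod p ^ N) \<and> \<not> p dvd s"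
proof -
  \<comment> \<open>If c inverts a and r^2 = a b, then u = c r gives a u^2 = b. The exponent
    \<open>Suc N\<close> keeps p in the modulus when N = 0, so that p not dividing u can be read off
    from b.\<close>
  obtain r where r: "[r^2 = a * b] (mod p ^ Suc N)" "\<not> p dvd r"
    using square_root_mod_power[of p "a * b" "Suc N"] assms by (auto simp: prime_dvd_mult_iff)
  have "coprime a (p ^ Suc N)" using assms by (metis coprime_commute coprime_power_right_iff prime_imp_coprime)
  then obtain c where c: "[a * c = 1] (mod p ^ Suc N)" using cong_solve_coprime_int by blast
  have "[a * (c * r)^2 = (a * c) * c * r^2] (mod p ^ Suc N)"
    by (simp add: power2_eq_square ac_simps)
  also have "[(a * c) * c * r^2 = 1 * c * (a * b)] (mod p ^ Suc N)"
    using c r by (intro cong_mult) auto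
  also have "[1 * c * (a * b) = (a * c) * b] (mod p ^ Suc N)" by (simp add: ac_simps)
  also have "[(a * c) * b = 1 * b] (mod p ^ Suc N)" using c by (intro cong_mult) auto
  finally have eq: "[a * (c * r)^2 = b] (mod p ^ Suc N)" by simp
  have "\<not> p dvd c * r"
  proof
    assume "p dvd c * r"
    then have "p dvd a * (c * r)^2" by (simp add: power2_eq_square)
    moreover have "[a * (c * r)^2 = b] (mod p)" using eq by (rule cong_dvd_modulus) simp
    ultimately show False using assms(4) cong_dvd_iff by blast
  qed
  moreover have "[a * (c * r)^2 = b] (mod p ^ N)" using eq by (rule cong_dvd_modulus) simp
  ultimately show ?thesis by blast
qed

lemma unit_times_square_cong_2:
  assumes "(a * b) mod 8 = (1::int)"
  shows "\<exists>s. [a * s^2 = b] (mod 2 ^ N) \<and> odd s"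
proof -
  have "odd (a * b)" using assms by (metis dvd_mod_iff even_numeral odd_one dvd_mod_imp_dvd dvd_mod)
  then have o: "odd a" "odd b" by auto
  obtain r where r: "[r^2 = a * b] (mod 2 ^ N)" "odd r"
    using square_root_mod_2_power[OF assms] by blast
  have "coprime a (2 ^ Suc N)" using o by simp
  then obtain c where c': "[a * c = 1] (mod 2 ^ Suc N)" using cong_solve_coprime_int by blast
  then have "[a * c = 1] (mod 2)" by (rule cong_dvd_modulus) simp
  then have oc: "odd c" using cong_dvd_iff[of "a*c" 1 2] by auto
  have c: "[a * c = 1] (mod 2 ^ N)" using c' by (rule cong_dvd_modulus) simp
  have "[a * (c * r)^2 = (a * c) * c * r^2] (mod 2 ^ N)"
    by (simp add: power2_eq_square ac_simps)
  also have "[(a * c) * c * r^2 = 1 * c * (a * b)] (mod 2 ^ N)"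
    using c r by (intro cong_mult) auto
  also have "[1 * c * (a * b) = (a * c) * b] (mod 2 ^ N)" by (simp add: ac_simps)
  also have "[(a * c) * b = 1 * b] (mod 2 ^ N)" using c by (intro cong_mult) auto
  finally show ?thesis using oc r by (intro exI[of _ "c * r"]) auto
qed

section \<open>Hilbert symbols and the product formula\<close>

definition upart :: "int \<Rightarrow> int \<Rightarrow> int" where
  "upart p a = a div p ^ multiplicity p a"

lemma upart_decompose: "a = p ^ multiplicity p a * upart p a"
  unfolding upart_def using multiplicity_dvd[of p a] by simp

lemma upart_not_dvd: "prime p \<Longrightarrow> a \<noteq> 0 \<Longrightarrow> \<not> p dvd upart p a"
  unfolding upart_def by (rule multiplicity_decompose) (auto simp: not_prime_unit)

lemma upart_unit: "\<not> p dvd a \<Longrightarrow> upart p a = a"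
  unfolding upart_def by (simp add: not_dvd_imp_multiplicity_0)

lemma multiplicity_upart_eqI:
  assumes "prime p" "\<not> p dvd u"
  shows "multiplicity p (p ^ k * u) = k" "upart p (p ^ k * u) = u"
proof -
  have "p \<noteq> 0" using assms by auto
  show m: "multiplicity p (p ^ k * u) = k"
    using assms \<open>p \<noteq> 0\<close> by (intro multiplicity_eqI) (auto simp: power_Suc2 mult.commute[of _ p])
  show "upart p (p ^ k * u) = u"
    unfolding upart_def m using \<open>p \<noteq> 0\<close> by simp
qed

lemma multiplicity_mult_prime:
  "prime p \<Longrightarrow> a \<noteq> 0 \<Longrightarrow> b \<noteq> 0 \<Longrightarrow> multiplicity p (a * b) = multiplicity p a + multiplicity p (b::int)"
  by (rule prime_elem_multiplicity_mult_distrib) auto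

lemma upart_mult:
  assumes "prime p" "a \<noteq> 0" "b \<noteq> 0"
  shows "upart p (a * b) = upart p a * upart p b"
proof -
  have "a * b = p ^ (multiplicity p a + multiplicity p b) * (upart p a * upart p b)"
    using upart_decompose[of a p] upart_decompose[of b p]
    by (metis mult.assoc mult.left_commute power_add)
  moreover have "\<not> p dvd upart p a * upart p b"
    using assms by (simp add: prime_dvd_mult_iff upart_not_dvd)
  ultimately show ?thesis using multiplicity_upart_eqI(2)[OF assms(1)] by metis
qed

text \<open>Hilbert symbols with values \<open>1\<close> and \<open>-1\<close>: the tame symbol at an odd prime (multiplicities and
  unit parts give the exponents), then the symbols at the real place and at 2.\<close>

definition hs :: "int \<Rightarrow> int \<Rightarrow> int \<Rightarrow> int" where
  "hs p a b = Legendre (-1) p ^ (multiplicity p a * multiplicity p b) *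
     Legendre (upart p a) p ^ multiplicity p b * Legendre (upart p b) p ^ multiplicity p a"

definition sgnc :: "int \<Rightarrow> int \<Rightarrow> int" where
  "sgnc x y = (if x = -1 \<and> y = -1 then -1 else 1)"

definition hs_inf :: "int \<Rightarrow> int \<Rightarrow> int" where
  "hs_inf a b = sgnc (sgn a) (sgn b)"

definition hs_2 :: "int \<Rightarrow> int \<Rightarrow> int" where
  "hs_2 a b = sgnc (chi4 (upart 2 a)) (chi4 (upart 2 b)) *
     chi8 (upart 2 a) ^ multiplicity 2 b * chi8 (upart 2 b) ^ multiplicity 2 a"

lemma hs_sym: "hs p a b = hs p b a" by (simp add: hs_def ac_simps)
lemma hs_inf_sym: "hs_inf a b = hs_inf b a" by (auto simp: hs_inf_def sgnc_def)
lemma hs_2_sym: "hs_2 a b = hs_2 b a" by (simp add: hs_2_def sgnc_def ac_simps)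

lemma not_dvd_minus_1: "prime (p::int) \<Longrightarrow> \<not> p dvd -1"
  using not_prime_unit by auto

lemma hs_square:
  assumes "prime p" "odd p" "a \<noteq> 0" "b \<noteq> 0"
  shows "hs p a b * hs p a b = 1"
proof -
  have u: "x ^ k = 1 \<or> x ^ k = -1" if "x = 1 \<or> x = (-1::int)" for x and k :: nat
    using that by (cases "even k") auto
  have "Legendre (-1) p ^ (multiplicity p a * multiplicity p b) \<in> {1,-1}"
    "Legendre (upart p a) p ^ multiplicity p b \<in> {1,-1}"
    "Legendre (upart p b) p ^ multiplicity p a \<in> {1,-1}"
    using u Legendre_values upart_not_dvd not_dvd_minus_1 assms by simp_all
  then show ?thesis unfolding hs_def by auto
qed

lemma hs_mult_left:
  assumes "prime p" "odd p" "a \<noteq> 0" "a' \<noteq> 0" "b \<noteq> 0"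
  shows "hs p (a * a') b = hs p a b * hs p a' b"
  unfolding hs_def multiplicity_mult_prime[OF assms(1,3,4)] upart_mult[OF assms(1,3,4)] Legendre_mult[OF assms(1,2)]
  by (simp add: algebra_simps power_add power_mult_distrib)

lemma hs_mult_right:
  assumes "prime p" "odd p" "a \<noteq> 0" "a' \<noteq> 0" "b \<noteq> 0"
  shows "hs p b (a * a') = hs p b a * hs p b a'"
  using hs_mult_left[OF assms] by (simp add: hs_sym)

lemma sgnc_mult: "x \<in> {1,-1} \<Longrightarrow> x' \<in> {1,-1} \<Longrightarrow> y \<in> {1,-1} \<Longrightarrow> sgnc (x * x') y = sgnc x y * sgnc x' y"
  by (auto simp: sgnc_def)

lemma hs_inf_mult_left:
  "a \<noteq> 0 \<Longrightarrow> a' \<noteq> 0 \<Longrightarrow> b \<noteq> 0 \<Longrightarrow> hs_inf (a * a') b = hs_inf a b * hs_inf a' b"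
  unfolding hs_inf_def sgn_mult by (rule sgnc_mult) (auto simp: sgn_if)

lemma chi4_upart: "a \<noteq> 0 \<Longrightarrow> chi4 (upart 2 a) \<in> {1,-1}"
  using upart_not_dvd[of 2 a] by (auto simp: chi4_def)

lemma hs_2_mult_left:
  assumes "a \<noteq> 0" "a' \<noteq> 0" "b \<noteq> 0"
  shows "hs_2 (a * a') b = hs_2 a b * hs_2 a' b"
proof -
  have "prime (2::int)" by simp
  note m = multiplicity_mult_prime[OF this assms(1,2)] upart_mult[OF this assms(1,2)]
  show ?thesis
    unfolding hs_2_def m chi4_mult chi8_mult using chi4_upart assms
    by (simp add: sgnc_mult algebra_simps power_add power_mult_distrib)
qed

lemma hs_unit: "\<not> p dvd a \<Longrightarrow> \<not> p dvd b \<Longrightarrow> hs p a b = 1"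
  unfolding hs_def by (simp add: not_dvd_imp_multiplicity_0)

definition hprod :: "int set \<Rightarrow> int \<Rightarrow> int \<Rightarrow> int" where
  "hprod S a b = hs_inf a b * hs_2 a b * (\<Prod>p\<in>S. hs p a b)"

lemma hprod_sym: "hprod S a b = hprod S b a"
  unfolding hprod_def by (simp add: hs_inf_sym[of a] hs_2_sym[of a] hs_sym[of _ a])

lemma hprod_mult_left:
  assumes "\<And>p. p \<in> S \<Longrightarrow> prime p \<and> odd p" "a \<noteq> 0" "a' \<noteq> 0" "b \<noteq> 0"
  shows "hprod S (a * a') b = hprod S a b * hprod S a' b"
proof -
  have "(\<Prod>p\<in>S. hs p (a * a') b) = (\<Prod>p\<in>S. hs p a b * hs p a' b)"
    using assms by (intro prod.cong) (auto intro: hs_mult_left)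
  then show ?thesis
    unfolding hprod_def using hs_inf_mult_left hs_2_mult_left assms by (simp add: prod.distrib ac_simps)
qed

lemma hs_1_left: "prime p \<Longrightarrow> hs p 1 b = 1"
  unfolding hs_def by (simp add: upart_def Legendre_1)

lemma hprod_1_left:
  assumes "\<And>p. p \<in> S \<Longrightarrow> prime p \<and> odd p" shows "hprod S 1 b = 1"
proof -
  have "(\<Prod>p\<in>S. hs p 1 b) = 1" using assms hs_1_left by (intro prod.neutral) blast
  then show ?thesis unfolding hprod_def
    by (simp add: hs_inf_def hs_2_def sgnc_def upart_def chi4_def chi8_def)
qed

lemma prime_not_dvd_prime: "prime (p::int) \<Longrightarrow> prime q \<Longrightarrow> p \<noteq> q \<Longrightarrow> \<not> p dvd q"
  using primes_dvd_imp_eq by blast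

lemma multiplicity_upart_self:
  fixes p :: int assumes "prime p" shows "multiplicity p p = 1" "upart p p = 1"
  using multiplicity_upart_eqI[OF assms, of 1 1] assms not_prime_unit by auto

text \<open>On generators the product formula is quadratic reciprocity with its supplements: only
  the primes occurring in the pair contribute, the pairs (-1, q) and (2, q) are the supplementary
  laws, two distinct primes give the main law, and (q, q) again involves only the symbol of
  -1.\<close>

lemma hprod_prime_generators:
  assumes S: "finite S" "\<And>p. p \<in> S \<Longrightarrow> prime p \<and> odd p"
    and a: "a = -1 \<or> a = 2 \<or> a \<in> S" and b: "b = -1 \<or> b = 2 \<or> b \<in> S"
  shows "hprod S a b = 1"
proof -
  have m2: "multiplicity 2 q = 0" "upart 2 q = q" if "q \<in> S" for q
    using S(2)[OF that] by (auto intro: not_dvd_imp_multiplicity_0 upart_unit)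
  have m2': "multiplicity 2 (2::int) = 1" "upart 2 2 = 1" "multiplicity 2 (-1::int) = 0" "upart 2 (-1) = -1"
    using multiplicity_upart_self[of 2] by (auto intro: not_dvd_imp_multiplicity_0 upart_unit)
  have gt: "q > 2" if "q \<in> S" for q using S(2)[OF that] odd_prime_gt_2 by blast
  have nd: "\<not> p dvd 2" if "p \<in> S" for p using gt[OF that] zdvd_not_zless[of 2 p] by auto
  have nd1: "\<not> p dvd -1" if "p \<in> S" for p using S(2)[OF that] not_dvd_minus_1 by blast
  have nq: "\<not> p dvd q" if "p \<in> S" "q \<in> S" "p \<noteq> q" for p q
    using S(2)[OF that(1)] S(2)[OF that(2)] that(3) prime_not_dvd_prime by blast
  have zero: "(\<Prod>p\<in>S. hs p a b) = 1" if "a \<notin> S" "b \<notin> S"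
  proof (rule prod.neutral, rule ballI)
    fix p assume "p \<in> S"
    then show "hs p a b = 1" using that a b nd nd1 by (intro hs_unit) auto
  qed
  have one: "(\<Prod>p\<in>S. hs p a q) = hs q a q" if "a = -1 \<or> a = 2 \<or> a = q" "q \<in> S" for a q
  proof -
    have "(\<Prod>p\<in>S - {q}. hs p a q) = 1"
    proof (rule prod.neutral, rule ballI)
      fix p assume "p \<in> S - {q}"
      then show "hs p a q = 1" using that nd nd1 nq by (intro hs_unit) auto
    qed
    then show ?thesis using prod.remove[OF S(1) that(2), of "\<lambda>p. hs p a q"] by simp
  qed
  have two: "(\<Prod>p\<in>S. hs p a b) = hs a a b * hs b a b" if "a \<in> S" "b \<in> S" "a \<noteq> b"
  proof -
    have "(\<Prod>p\<in>S - {a} - {b}. hs p a b) = 1"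
    proof (rule prod.neutral, rule ballI)
      fix p assume "p \<in> S - {a} - {b}"
      then show "hs p a b = 1" using that nq by (intro hs_unit) auto
    qed
    then show ?thesis
      using prod.remove[OF S(1) that(1), of "\<lambda>p. hs p a b"]
        prod.remove[of "S - {a}" b "\<lambda>p. hs p a b"] S(1) that by simp
  qed
  have c4: "chi4 q = 1 \<or> chi4 q = -1" and c8: "chi8 q * chi8 q = 1" if "q \<in> S" for q
    using S(2)[OF that] by (auto simp: chi4_def chi8_def)
  have neg: "hprod S (-1) q = 1" if "q \<in> S" for q
  proof -
    have "hs q (-1) q = chi4 q"
      using S(2)[OF that] nd1[OF that] multiplicity_upart_self[of q]
      by (simp add: hs_def not_dvd_imp_multiplicity_0 upart_unit Legendre_minus1 del: dvd_minus_iff minus_dvd_iff)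
    moreover have "hs_inf (-1) q = 1" using gt[OF that] by (auto simp: hs_inf_def sgnc_def sgn_if)
    ultimately show ?thesis unfolding hprod_def using one[OF _ that, of "-1"] m2[OF that] m2' c4[OF that]
      by (auto simp: hs_2_def sgnc_def chi4_def)
  qed
  have two': "hprod S 2 q = 1" if "q \<in> S" for q
  proof -
    have "hs q 2 q = chi8 q"
      using S(2)[OF that] nd[OF that] multiplicity_upart_self[of q]
      by (simp add: hs_def not_dvd_imp_multiplicity_0 upart_unit Legendre_2)
    moreover have "hs_inf 2 q = 1" by (auto simp: hs_inf_def sgnc_def sgn_if)
    ultimately show ?thesis unfolding hprod_def using one[OF _ that, of 2] m2[OF that] m2' c8[OF that]
      by (simp add: hs_2_def sgnc_def chi4_def)
  qed
  have self: "hprod S q q = 1" if "q \<in> S" for q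
  proof -
    have "hs q q q = chi4 q"
      using S(2)[OF that] multiplicity_upart_self[of q]
      by (simp add: hs_def Legendre_minus1 Legendre_1)
    moreover have "hs_inf q q = 1" using gt[OF that] by (auto simp: hs_inf_def sgnc_def sgn_if)
    ultimately show ?thesis unfolding hprod_def using one[OF _ that, of q] m2[OF that] c4[OF that]
      by (auto simp: hs_2_def sgnc_def)
  qed
  have diff: "hprod S a b = 1" if "a \<in> S" "b \<in> S" "a \<noteq> b"
  proof -
    have ab: "prime a" "odd a" "prime b" "odd b" using S(2) that by auto
    have "hs a a b = Legendre b a" "hs b a b = Legendre a b"
      using ab nq[OF that] nq[of b a] that multiplicity_upart_self[of a] multiplicity_upart_self[of b]
      by (simp_all add: hs_def not_dvd_imp_multiplicity_0 upart_unit Legendre_1)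
    then have "(\<Prod>p\<in>S. hs p a b) = sgnc (chi4 a) (chi4 b)"
      using two[OF that] Legendre_reciprocity[OF ab that(3)] by (simp add: sgnc_def mult.commute)
    moreover have "hs_inf a b = 1" using gt[OF that(1)] by (auto simp: hs_inf_def sgnc_def sgn_if)
    ultimately show ?thesis unfolding hprod_def using m2[OF that(1)] m2[OF that(2)]
      by (auto simp: hs_2_def sgnc_def)
  qed
  have small: "hprod S a b = 1" if "a = -1 \<or> a = 2" "b = -1 \<or> b = 2"
  proof -
    have "a \<notin> S" "b \<notin> S" using that gt by fastforce+
    then have "(\<Prod>p\<in>S. hs p a b) = 1" by (rule zero)
    then show ?thesis using that
      by (elim disjE) (simp_all add: m2' hprod_def hs_inf_def hs_2_def sgnc_def chi4_def chi8_def)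
  qed
  consider "a = -1 \<or> a = 2" "b = -1 \<or> b = 2" | "a = -1 \<or> a = 2" "b \<in> S"
    | "a \<in> S" "b = -1 \<or> b = 2" | "a \<in> S" "b \<in> S" using a b by blast
  then show ?thesis
  proof cases
    case 1 then show ?thesis by (rule small)
  next
    case 2 then show ?thesis using neg two' by blast
  next
    case 3 then show ?thesis using neg two' hprod_sym[of S a b] by auto
  next
    case 4 then show ?thesis using self diff by (cases "a = b") auto
  qed
qed

text \<open>Both arguments are products of -1, 2 and primes of \<open>S\<close>. Bimultiplicativity
  allows an induction over the prime factors of one argument while the other is a generator, and the
  symmetry of \<open>hprod\<close> lets the same induction run over the other argument.\<close>

lemma hilbert_product_formula:
  assumes S: "finite S" "\<And>p. p \<in> S \<Longrightarrow> prime p \<and> odd p"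
    and "a \<noteq> 0" "b \<noteq> 0" "\<And>p. prime p \<Longrightarrow> odd p \<Longrightarrow> p dvd a * b \<Longrightarrow> p \<in> S"
  shows "hs_inf a b * hs_2 a b * (\<Prod>p\<in>S. hs p a b) = 1"
proof -
  have gen: "(\<forall>p. prime p \<and> odd p \<and> p dvd a \<longrightarrow> p \<in> S) \<Longrightarrow> a \<noteq> 0 \<Longrightarrow> hprod S a b = 1"
    if gb: "\<And>q. q = -1 \<or> q = 2 \<or> q \<in> S \<Longrightarrow> hprod S q b = 1" and "b \<noteq> 0" for a b
  proof (induction a rule: prime_divisors_induct)
    case (unit x)
    then have "x = 1 \<or> x = -1" by auto
    then show ?case using gb hprod_1_left S(2) by auto
  next
    case (factor p x)
    have "p = 2 \<or> p \<in> S" using factor.prems(1) factor.hyps(1)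
      by (metis dvd_triv_left prime_odd_int prime_ge_2_int le_neq_trans)
    then have "hprod S p b = 1" using gb by blast
    moreover have "hprod S x b = 1" using factor by auto
    moreover have "hprod S (p * x) b = hprod S p b * hprod S x b"
      using factor.prems(2) \<open>b \<noteq> 0\<close> S(2) by (intro hprod_mult_left) auto
    ultimately show ?case by simp
  qed auto
  have gb: "hprod S q b = 1" if "q = -1 \<or> q = 2 \<or> q \<in> S" for q
  proof -
    have "q \<noteq> 0" using that S(2) by fastforce
    moreover have "hprod S r q = 1" if "r = -1 \<or> r = 2 \<or> r \<in> S" for r
      using hprod_prime_generators[OF S that \<open>q = -1 \<or> q = 2 \<or> q \<in> S\<close>] by blast
    ultimately have "hprod S b q = 1" using gen[of q b] assms(4,5) by auto
    then show ?thesis using hprod_sym by simp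
  qed
  have "hprod S a b = 1" using gen[OF gb assms(4), of a] assms(3,5) by auto
  then show ?thesis unfolding hprod_def .
qed

text \<open>The tame symbol is locally constant: a change of \<open>A\<close> beyond its leading
  p-adic digit alters neither the valuation nor the unit part modulo p.\<close>

lemma hs_cong:
  assumes p: "prime p" and "A \<noteq> 0" "B \<noteq> 0" "p ^ Suc (multiplicity p A) dvd A - B"
  shows "hs p A X = hs p B X"
proof -
  let ?k = "multiplicity p A"
  have p0: "p ^ ?k \<noteq> 0" using p by auto
  obtain c where c: "A - B = p ^ Suc ?k * c" using assms(4) by auto
  have "B = A - p ^ Suc ?k * c" using c by simp
  also have "\<dots> = p ^ ?k * (upart p A - p * c)"
    using upart_decompose[of A p] by (simp add: algebra_simps)
  finally have B: "B = p ^ ?k * (upart p A - p * c)" .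
  have "\<not> p dvd upart p A - p * c"
    using upart_not_dvd[OF p assms(2)] by (metis dvd_diff_right_iff dvd_triv_left dvd_diff_left_iff)
  then have "multiplicity p B = ?k" "upart p B = upart p A - p * c"
    using multiplicity_upart_eqI[OF p] B by metis+
  moreover have "Legendre (upart p A - p * c) p = Legendre (upart p A) p"
    by (rule Legendre_cong) (simp add: cong_iff_dvd_diff)
  ultimately show ?thesis unfolding hs_def by simp
qed

text \<open>In the tame formula the two symbols of the unit part cancel, and (-1/p) is left with
  exponent k (k + 1), which is even.\<close>

lemma hs_neg_self:
  assumes "prime p" "odd p" "a \<noteq> 0"
  shows "hs p a (-a) = 1"
proof -
  let ?k = "multiplicity p a" and ?u = "upart p a"
  have nd: "\<not> p dvd ?u" "\<not> p dvd -1" using upart_not_dvd assms not_dvd_minus_1 by auto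
  have "-a = p ^ ?k * (- ?u)" using upart_decompose[of a p] by simp
  then have m: "multiplicity p (-a) = ?k" "upart p (-a) = (-1) * ?u"
    using multiplicity_upart_eqI[OF assms(1), of "- ?u"] nd(1) by (metis dvd_minus_iff mult_minus1)+
  have "hs p a (-a) = Legendre (-1) p ^ (?k * ?k) * Legendre (-1) p ^ ?k * (Legendre ?u p * Legendre ?u p) ^ ?k"
    unfolding hs_def m Legendre_mult[OF assms(1,2)] by (simp add: power_mult_distrib)
  also have "\<dots> = Legendre (-1) p ^ (?k * (?k + 1))"
    using Legendre_square[OF nd(1)] by (simp add: power_add)
  also have "\<dots> = 1"
  proof -
    have "even (?k * (?k + 1))" by simp
    then obtain j where "?k * (?k + 1) = 2 * j" by blast
    then show ?thesis using Legendre_square[OF nd(2)] by (metis power2_eq_square power_mult power_one)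
  qed
  finally show ?thesis .
qed

lemma hs_square_left:
  assumes "prime p" "odd p" "a \<noteq> 0" "b \<noteq> 0" "x \<noteq> 0"
  shows "hs p (a * x^2) b = hs p a b"
  using assms hs_square[of p x b] by (simp add: power2_eq_square hs_mult_left)

lemma hs_square_right:
  assumes "prime p" "odd p" "a \<noteq> 0" "b \<noteq> 0" "x \<noteq> 0"
  shows "hs p b (a * x^2) = hs p b a"
  using hs_square_left[OF assms] by (simp add: hs_sym)

text \<open>The Steinberg relation (x, 1 - x) = 1 for x = A/(A + B), cleared of denominators. If A
  and B differ in valuation, the dominant one has the leading digit of the sum. If the sum has
  higher valuation, A has the leading digit of -B. If all three valuations agree, both arguments
  have even valuation and every exponent in the symbol is even.\<close>

lemma hs_sum:
  assumes p: "prime p" "odd p" and nz: "A \<noteq> 0" "B \<noteq> 0" "A + B \<noteq> 0"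
  shows "hs p (A * (A + B)) (B * (A + B)) = 1"
proof -
  let ?C = "A + B"
  let ?a = "multiplicity p A" and ?b = "multiplicity p B" and ?c = "multiplicity p ?C"
  have le: "p ^ k dvd X" if "k \<le> multiplicity p X" for k X
    using that by (rule multiplicity_dvd')
  consider "?b < ?a" | "?a < ?b" | "?a = ?b" "?a < ?c" | "?a = ?b" "?c \<le> ?a" by linarith
  then show ?thesis
  proof cases
    case 1
    have "hs p B X = hs p ?C X" for X
      using nz le[of "Suc ?b" A] 1 by (intro hs_cong[OF p(1)]) auto
    then have "hs p (B * ?C) (A * ?C) = 1"
      using hs_mult_left[OF p nz(2,3), of "A * ?C"] hs_square[OF p nz(3), of "A * ?C"] nz by simp
    then show ?thesis by (simp add: hs_sym)
  next
    case 2
    have "hs p A X = hs p ?C X" for X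
      using nz le[of "Suc ?a" B] 2 by (intro hs_cong[OF p(1)]) auto
    then show ?thesis
      using hs_mult_left[OF p nz(1,3), of "B * ?C"] hs_square[OF p nz(3), of "B * ?C"] nz by simp
  next
    case 3
    have "hs p A X = hs p (-B) X" for X
      using nz le[of "Suc ?a" ?C] 3 by (intro hs_cong[OF p(1)]) auto
    then have "hs p (A * ?C) (B * ?C) = hs p (- B * ?C) (B * ?C)"
      using nz p by (simp add: hs_mult_left del: mult_minus_left)
    also have "\<dots> = 1" using hs_neg_self[OF p, of "B * ?C"] nz by (simp add: hs_sym)
    finally show ?thesis .
  next
    case 4
    have "p ^ ?a dvd ?C" using le[of ?a A] le[of ?a B] 4 by (intro dvd_add) auto
    then have "?c = ?a" using 4 nz p by (metis le_antisym multiplicity_geI not_prime_unit)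
    then have m: "multiplicity p (A * ?C) = 2 * ?a" "multiplicity p (B * ?C) = 2 * ?a"
      using multiplicity_mult_prime[OF p(1)] nz 4 by simp_all
    have nd: "\<not> p dvd upart p (A * ?C)" "\<not> p dvd upart p (B * ?C)" "\<not> p dvd -1"
      using upart_not_dvd[OF p(1)] nz not_dvd_minus_1[OF p(1)] by auto
    have ev: "x ^ (2 * j) = 1" if "x * x = 1" for x :: int and j
      using that by (simp add: power_mult power2_eq_square)
    show ?thesis unfolding hs_def m mult.assoc[of 2 ?a]
      using ev[OF Legendre_square[OF nd(1)]] ev[OF Legendre_square[OF nd(2)]] ev[OF Legendre_square[OF nd(3)]]
      by presburger
  qed
qed

lemma not_dvd_imp_multiplicity_less:
  assumes "prime (p::int)" "\<not> p ^ N dvd A" shows "Suc (multiplicity p A) \<le> N"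
  using assms by (metis multiplicity_dvd' not_less_eq_eq)

lemma dvd_square_bound:
  assumes p: "prime (p::int)" and "a \<noteq> 0" "p ^ N dvd a * x^2" "2 * k + multiplicity p a \<le> N"
  shows "p ^ k dvd x"
proof (cases "x = 0")
  case False
  have "N \<le> multiplicity p (a * x^2)"
    using assms False p not_prime_unit by (intro multiplicity_geI) auto
  also have "\<dots> = multiplicity p a + 2 * multiplicity p x"
    using False assms by (simp add: multiplicity_mult_prime power2_eq_square)
  finally show ?thesis using assms(4) by (intro multiplicity_dvd') linarith
qed auto

text \<open>The symbol sees only leading digits, so an approximate solution suffices. If one of a
  x^2, b y^2, z^2 vanishes modulo p^N, the other two agree up to sign and the symbol is that of (-b,
  b) or of a square; if none does, the sum lies in the class of z^2 and the Steinberg relation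
  applies. Primitivity is asked only up to p^k, because the conic extracted from a covering has a
  variable multiplied by \<open>d3\<close>.\<close>

lemma hs_eq_1_if_conic_solvable:
  assumes p: "prime p" "odd p" and nz: "a \<noteq> 0" "b \<noteq> 0"
    and sol: "\<And>N. \<exists>x y z. \<not> (p ^ k dvd x \<and> p ^ k dvd y \<and> p ^ k dvd z) \<and> [a * x^2 + b * y^2 = z^2] (mod p ^ N)"
  shows "hs p a b = 1"
proof -
  \<comment> \<open>Large enough that a term divisible by p^N has its variable divisible by p^k;
    hence the three terms do not all vanish modulo p^N.\<close>
  define N where "N = 2 * k + multiplicity p a + multiplicity p b"
  obtain x y z where xyz: "\<not> (p ^ k dvd x \<and> p ^ k dvd y \<and> p ^ k dvd z)"
    and c: "p ^ N dvd a * x^2 + b * y^2 - z^2"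
    using sol[of N] unfolding cong_iff_dvd_diff by blast
  let ?A = "a * x^2" and ?B = "b * y^2"
  have bx: "p ^ N dvd ?A \<Longrightarrow> p ^ k dvd x" by (erule dvd_square_bound[OF p(1) nz(1)]) (simp add: N_def)
  have by': "p ^ N dvd ?B \<Longrightarrow> p ^ k dvd y" by (erule dvd_square_bound[OF p(1) nz(2)]) (simp add: N_def)
  have bz: "p ^ N dvd z^2 \<Longrightarrow> p ^ k dvd z" using dvd_square_bound[OF p(1), of 1 N z k] by (simp add: N_def)
  have pw: "p ^ Suc (multiplicity p X) dvd Y" if "\<not> p ^ N dvd X" "p ^ N dvd Y" for X Y
    using that not_dvd_imp_multiplicity_less[OF p(1) that(1)] by (meson le_imp_power_dvd dvd_trans)
  consider "p ^ N dvd z^2" | "\<not> p ^ N dvd z^2" "p ^ N dvd ?A" | "\<not> p ^ N dvd z^2" "p ^ N dvd ?B"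
    | "\<not> p ^ N dvd z^2" "\<not> p ^ N dvd ?A" "\<not> p ^ N dvd ?B" by blast
  then show ?thesis
  proof cases
    case 1
    then have s: "p ^ N dvd ?A + ?B" using dvd_add[OF c 1] by simp
    have A: "\<not> p ^ N dvd ?A"
    proof
      assume "p ^ N dvd ?A"
      moreover from this have "p ^ N dvd ?B" using s by (simp add: dvd_add_right_iff)
      ultimately show False using xyz bx by' bz 1 by blast
    qed
    then have B: "\<not> p ^ N dvd ?B" using s dvd_add_left_iff by blast
    have nz': "x \<noteq> 0" "y \<noteq> 0" using A B by auto
    have "hs p ?A b = hs p ((- b) * y^2) b"
      using nz nz' pw[OF A s] by (intro hs_cong[OF p(1)]) auto
    then have "hs p a b = hs p (- b) b" 
      using hs_square_left[OF p nz nz'(1)] hs_square_left[OF p _ nz(2) nz'(2), of "- b"] nz by presburger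
    then show ?thesis using hs_neg_self[OF p nz(2)] by (simp add: hs_sym)
  next
    case 2
    have s: "p ^ N dvd z^2 - ?B" using c 2(2) by (metis add_diff_eq dvd_add_right_iff dvd_diff_commute)
    then have B: "\<not> p ^ N dvd ?B" using 2(1) dvd_diff_left_iff by blast
    have nz': "z \<noteq> 0" "y \<noteq> 0" using 2(1) B by auto
    have "hs p (1 * z^2) a = hs p ?B a"
      using nz nz' pw[OF 2(1) s] by (intro hs_cong[OF p(1)]) auto
    then have "hs p 1 a = hs p b a" 
      using hs_square_left[OF p _ nz(1) nz'(1), of 1] hs_square_left[OF p nz(2,1) nz'(2)] by presburger
    then show ?thesis using hs_1_left[OF p(1)] by (simp add: hs_sym)
  next
    case 3
    have s: "p ^ N dvd z^2 - ?A" using c 3(2) 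
      by (metis add_diff_eq add.commute dvd_add_right_iff dvd_diff_commute)
    then have A: "\<not> p ^ N dvd ?A" using 3(1) dvd_diff_left_iff by blast
    have nz': "z \<noteq> 0" "x \<noteq> 0" using 3(1) A by auto
    have "hs p (1 * z^2) b = hs p ?A b"
      using nz nz' pw[OF 3(1) s] by (intro hs_cong[OF p(1)]) auto
    then have "hs p 1 b = hs p a b" 
      using hs_square_left[OF p _ nz(2) nz'(1), of 1] hs_square_left[OF p nz nz'(2)] by presburger
    then show ?thesis using hs_1_left[OF p(1)] by simp
  next
    case 4
    have nz': "x \<noteq> 0" "y \<noteq> 0" "z \<noteq> 0" using 4 by auto
    have C: "?A + ?B \<noteq> 0" using c 4(1) by auto
    have "hs p (1 * z^2) X = hs p (?A + ?B) X" for X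
      using nz nz' C pw[OF 4(1), of "z^2 - (?A + ?B)"] c
      by (intro hs_cong[OF p(1)]) (auto simp: dvd_diff_commute)
    then have C1: "hs p (?A + ?B) X = 1" if "X \<noteq> 0" for X
      using hs_square_left[OF p one_neq_zero that nz'(3)] hs_1_left[OF p(1), of X] by metis
    have "1 = hs p (?A * (?A + ?B)) (?B * (?A + ?B))" using hs_sum[OF p _ _ C] nz nz' by simp
    also have "\<dots> = hs p ?A (?B * (?A + ?B)) * 1"
      using hs_mult_left[OF p _ C, of ?A "?B * (?A + ?B)"] C1[of "?B * (?A + ?B)"] nz nz' C by simp
    also have "\<dots> = hs p ?A ?B"
      using hs_mult_right[OF p _ C, of ?B ?A] C1[of ?A] nz nz' by (simp add: hs_sym)
    also have "\<dots> = hs p a b" using hs_square_left[OF p] hs_square_right[OF p] nz nz' by simp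
    finally show ?thesis by simp
  qed
qed

section \<open>Square-free triples and the coverings\<close>

lemma sqf_eq_squarefree_part:
  assumes "a \<noteq> 0" shows "sqf a = squarefree_part a"
proof -
  let ?P = "prime_factors a"
  have split: "(\<Prod>p\<in>?P. p ^ (multiplicity p a mod 2)) = (\<Prod>p\<in>{p\<in>?P. odd (multiplicity p a)}. p)"
    by (intro prod.mono_neutral_cong_right) (auto simp: odd_iff_mod_2_eq_one)
  have "square_part a ^ 2 = (\<Prod>p\<in>?P. p ^ (multiplicity p a div 2))^2"
    using assms by (simp add: square_part_nonzero)
  then have "(\<Prod>p\<in>{p\<in>?P. odd (multiplicity p a)}. p) * square_part a ^ 2
    = (\<Prod>p\<in>?P. p ^ (multiplicity p a mod 2) * (p ^ (multiplicity p a div 2))^2)"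
    by (simp only: split[symmetric] prod.distrib prod_power_distrib)
  also have "\<dots> = (\<Prod>p\<in>?P. p ^ multiplicity p a)"
    by (intro prod.cong refl) (simp add: power_add[symmetric] power_mult[symmetric])
  also have "\<dots> = \<bar>a\<bar>" using prod_prime_factors[OF assms] by simp
  finally have "sqf a * square_part a ^ 2 = sgn a * \<bar>a\<bar>"
    unfolding sqf_def by (simp add: mult.assoc)
  also have "\<dots> = squarefree_part a * square_part a ^ 2"
    using squarefree_decompose[of a] by (simp add: sgn_mult_abs)
  finally show ?thesis using assms by simp
qed

lemma squarefree_sqf: "a \<noteq> 0 \<Longrightarrow> squarefree (sqf a)"
  by (simp add: sqf_eq_squarefree_part squarefree_squarefree_part)

lemma sqf_decompose:
  assumes "a \<noteq> 0" obtains r where "a = sqf a * r^2" "r \<noteq> 0"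
  using squarefree_decompose[of a] assms that by (simp add: sqf_eq_squarefree_part)

lemma sqf_nonzero: "a \<noteq> 0 \<Longrightarrow> sqf a \<noteq> 0"
  by (simp add: sqf_eq_squarefree_part)

lemma squarefree_dvd_square:
  assumes "squarefree (d::int)" "d dvd s^2" shows "d dvd s"
proof (cases "s = 0")
  case False
  have "d \<noteq> 0" using assms(1) by auto
  show ?thesis
  proof (rule multiplicity_le_imp_dvd[OF \<open>d \<noteq> 0\<close>])
    fix p :: int assume p: "prime p"
    show "multiplicity p d \<le> multiplicity p s"
    proof (cases "p dvd d")
      case True
      then have "p dvd s" using assms(2) p by (meson dvd_trans prime_dvd_power)
      then have "multiplicity p s \<ge> 1" using False p
        by (intro multiplicity_geI) (auto simp: not_prime_unit)
      moreover have "multiplicity p d \<le> 1"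
        using assms(1) p squarefree_factorial_semiring''[OF \<open>d \<noteq> 0\<close>] by blast
      ultimately show ?thesis by linarith
    qed (simp add: not_dvd_imp_multiplicity_0)
  qed
qed auto

text \<open>Both numbers divide s, hence each other, so they agree up to sign; opposite signs would
  make the product negative.\<close>

lemma squarefree_eq_if_mult_square:
  assumes "squarefree (x::int)" "squarefree y" "x * y = s^2" shows "x = y"
proof -
  have nz: "x \<noteq> 0" "y \<noteq> 0" using assms by auto
  have "x dvd s" "y dvd s" using assms by (metis dvd_triv_left dvd_triv_right squarefree_dvd_square)+
  then obtain r r' where r: "s = x * r" "s = y * r'" unfolding dvd_def by blast
  have "y = x * r^2" using assms(3) r(1) nz by (simp add: power2_eq_square)
  moreover have "x = y * r'^2" using assms(3) r(2) nz by (simp add: power2_eq_square)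
  ultimately have "x dvd y" "y dvd x" by (metis dvd_triv_left)+
  then have "\<bar>x\<bar> = \<bar>y\<bar>" by (rule zdvd_antisym_abs)
  then have "x = y \<or> x = - y" by linarith
  moreover have "x \<noteq> - y"
  proof
    assume "x = - y"
    then have "x * y = - (y^2)" by (simp add: power2_eq_square)
    moreover have "0 < y^2" using nz by simp
    moreover have "0 \<le> s^2" by simp
    ultimately show False using assms(3) by linarith
  qed
  ultimately show ?thesis by blast
qed

lemma sqf_eqI:
  assumes "a \<noteq> 0" "squarefree x" "a = x * s^2" shows "sqf a = x"
proof -
  obtain r where r: "a = sqf a * r^2" "r \<noteq> 0" using sqf_decompose[OF assms(1)] .
  have "s^2 * (sqf a * x) = sqf a * a" using assms(3) by (simp add: ac_simps)
  also have "\<dots> = (sqf a * r)^2" using r(1) by (simp add: power2_eq_square ac_simps)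
  finally have eq: "s^2 * (sqf a * x) = (sqf a * r)^2" .
  then have "s dvd sqf a * r" by (metis dvd_triv_left pow_divides_pow_iff zero_less_numeral)
  then obtain w where "sqf a * r = s * w" by auto
  moreover have "s \<noteq> 0" using assms by auto
  ultimately have "sqf a * x = w^2" using eq by (simp add: power_mult_distrib)
  then show ?thesis using squarefree_eq_if_mult_square squarefree_sqf[OF assms(1)] assms(2) by blast
qed

lemma sqf_of_squarefree: "squarefree x \<Longrightarrow> sqf x = x"
  by (rule sqf_eqI[of _ _ 1]) auto

lemma sqf_mult_sqf_left:
  assumes "a \<noteq> 0" "b \<noteq> 0" shows "sqf (sqf a * b) = sqf (a * b)"
proof -
  obtain r where r: "a = sqf a * r^2" "r \<noteq> 0" using sqf_decompose[OF assms(1)] .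
  have nz: "sqf a * b \<noteq> 0" using assms sqf_nonzero by simp
  obtain r' where r': "sqf a * b = sqf (sqf a * b) * r'^2" "r' \<noteq> 0" using sqf_decompose[OF nz] .
  have "a * b = (sqf a * b) * r^2" using r(1) by (metis mult.assoc mult.commute)
  also have "\<dots> = sqf (sqf a * b) * (r' * r)^2" using r'(1) by (metis mult.assoc power_mult_distrib)
  finally show ?thesis using assms squarefree_sqf[OF nz] sqf_eqI by (metis mult_eq_0_iff)
qed

lemma sqf_eq_1_iff:
  assumes "squarefree x" "squarefree y" shows "sqf (x * y) = 1 \<longleftrightarrow> x = y"
proof
  have nz: "x * y \<noteq> 0" using assms by auto
  assume "sqf (x * y) = 1"
  then obtain r where "x * y = r^2" using sqf_decompose[OF nz] by (metis mult_1)
  then show "x = y" using assms squarefree_eq_if_mult_square by blast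
next
  assume "x = y"
  then show "sqf (x * y) = 1" using assms by (intro sqf_eqI[of _ _ x]) (auto simp: power2_eq_square)
qed

lemma sqf_mult_cancel:
  assumes "squarefree x" "b \<noteq> 0" shows "sqf (x * sqf (x * b)) = sqf b"
proof -
  have x: "x \<noteq> 0" using assms(1) by auto
  have "sqf (x * sqf (x * b)) = sqf (x * b * x)"
    using sqf_mult_sqf_left[of "x * b" x] x assms(2) by (simp add: mult.commute)
  also have "\<dots> = sqf b"
  proof -
    obtain r where r: "b = sqf b * r^2" using sqf_decompose[OF assms(2)] by blast
    have "x * b * x = sqf b * (x * r)^2" by (subst r) (simp add: power2_eq_square)
    then show ?thesis using x assms(2) squarefree_sqf by (intro sqf_eqI) auto
  qed
  finally show ?thesis .
qed

text \<open>A prime dividing one entry divides exactly two of them. The factors a, b, c collect the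
  primes by the entry that they avoid, \<open>d3\<close>, \<open>d2\<close> and \<open>d1\<close>
  respectively; a is positive, so b and c carry the signs.\<close>

lemma squarefree_triple_decompose:
  fixes d1 d2 d3 :: int
  assumes "squarefree d1" "squarefree d2" "squarefree d3" "d1 * d2 * d3 = s^2"
  obtains a b c where "d1 = a * b" "d2 = a * c" "d3 = b * c" "coprime a b" "coprime a c" "coprime b c"
proof -
  have nz: "d1 \<noteq> 0" "d2 \<noteq> 0" "d3 \<noteq> 0" using assms by auto
  define a where "a = gcd d1 d2"
  obtain b where b: "d1 = a * b" unfolding a_def by (metis dvdE gcd_dvd1)
  obtain c where c: "d2 = a * c" unfolding a_def by (metis dvdE gcd_dvd2)
  have a0: "a \<noteq> 0" using b nz by auto
  have bc: "coprime b c"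
  proof -
    have "gcd (a * b) (a * c) = \<bar>a\<bar> * gcd b c" by (simp add: gcd_mult_distrib_int abs_mult)
    then have "\<bar>a\<bar> * gcd b c = \<bar>a\<bar>" using a_def b c by (metis abs_gcd_int)
    then show ?thesis using a0 by (simp add: coprime_iff_gcd_eq_1)
  qed
  have sq: "coprime x y" if "squarefree (x * y)" for x y :: int
  proof (rule coprimeI)
    fix z assume "z dvd x" "z dvd y"
    then have "z^2 dvd x * y" by (simp add: mult_dvd_mono power2_eq_square)
    then show "is_unit z" using that squarefreeD by blast
  qed
  have ab: "coprime a b" using assms(1) b sq by simp
  have ac: "coprime a c" using assms(2) c sq by simp
  have "squarefree (b * c)" using bc assms(1,2) b c
    by (metis squarefree_mult_coprime squarefree_multD(2) squarefree_multD(1) mult.commute)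
  moreover have "d3 * (b * c) * a^2 = s^2" using assms(4) b c by (simp add: power2_eq_square ac_simps)
  moreover from this have "a dvd s" by (metis dvd_triv_right pow_divides_pow_iff zero_less_numeral)
  then obtain w where "s = a * w" by auto
  ultimately have "d3 * (b * c) = w^2" using a0 by (simp add: power_mult_distrib)
  then have "d3 = b * c" using squarefree_eq_if_mult_square[OF assms(3)] \<open>squarefree (b * c)\<close> by blast
  then show ?thesis using that b c ab ac bc by blast
qed

section \<open>The coverings modulo prime powers\<close>

definition Dsol :: "int \<Rightarrow> int \<Rightarrow> int \<Rightarrow> int \<Rightarrow> int \<Rightarrow> int \<Rightarrow> int \<Rightarrow> int \<Rightarrow> int \<Rightarrow> int \<Rightarrow> int \<Rightarrow> int \<Rightarrow> bool" where
  "Dsol e1 e2 e3 m d1 d2 d3 M t u1 u2 u3 \<longleftrightarrow>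
     M dvd e1 * m * t^2 + d2 * u2^2 - d3 * u3^2 \<and>
     M dvd e2 * m * t^2 + d3 * u3^2 - d1 * u1^2 \<and>
     M dvd e3 * m * t^2 + d1 * u1^2 - d2 * u2^2"

text \<open>Cyclic symmetry of the three quadrics; it lets a local argument be carried out for one
  position of the triple and transported to the others.\<close>

lemma Dsol_rotate: "Dsol e1 e2 e3 m d1 d2 d3 M t u1 u2 u3 \<longleftrightarrow> Dsol e2 e3 e1 m d2 d3 d1 M t u2 u3 u1"
  unfolding Dsol_def by blast

lemma loc_solv_p_iff:
  "loc_solv_p e1 e2 e3 m (d1, d2, d3) p \<longleftrightarrow>
    (\<forall>N. \<exists>t u1 u2 u3. \<not> (p dvd t \<and> p dvd u1 \<and> p dvd u2 \<and> p dvd u3) \<and>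
       Dsol e1 e2 e3 m d1 d2 d3 (p ^ N) t u1 u2 u3)"
  unfolding loc_solv_p_def Deqs_def Dsol_def by (simp add: cong_0_iff)

lemma loc_solv_pD:
  assumes "loc_solv_p e1 e2 e3 m (d1, d2, d3) p"
  obtains t u1 u2 u3 where "\<not> (p dvd t \<and> p dvd u1 \<and> p dvd u2 \<and> p dvd u3)"
    "Dsol e1 e2 e3 m d1 d2 d3 (p ^ N) t u1 u2 u3"
  using assms unfolding loc_solv_p_iff by blast

lemma loc_solv_p_rotate:
  "loc_solv_p e1 e2 e3 m (d1, d2, d3) p \<longleftrightarrow> loc_solv_p e2 e3 e1 m (d2, d3, d1) p"
  unfolding loc_solv_p_iff Dsol_rotate[of e1] by blast

lemma loc_solv_R_iff:
  "loc_solv_R e1 e2 e3 m (d1, d2, d3) \<longleftrightarrow>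
    (\<exists>t u1 u2 u3 :: real. \<not> (t = 0 \<and> u1 = 0 \<and> u2 = 0 \<and> u3 = 0) \<and>
       of_int (e1 * m) * t^2 + d2 * u2^2 - d3 * u3^2 = 0 \<and>
       of_int (e2 * m) * t^2 + d3 * u3^2 - d1 * u1^2 = 0 \<and>
       of_int (e3 * m) * t^2 + d1 * u1^2 - d2 * u2^2 = 0)"
  unfolding loc_solv_R_def Deqs_def by simp

lemma loc_solv_R_rotate:
  "loc_solv_R e1 e2 e3 m (d1, d2, d3) \<longleftrightarrow> loc_solv_R e2 e3 e1 m (d2, d3, d1)"
  unfolding loc_solv_R_iff by blast

lemma Dsol_mono: "Dsol e1 e2 e3 m d1 d2 d3 M t u1 u2 u3 \<Longrightarrow> M' dvd M \<Longrightarrow> Dsol e1 e2 e3 m d1 d2 d3 M' t u1 u2 u3"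
  unfolding Dsol_def using dvd_trans by blast

text \<open>Removing a common factor p from all four variables costs p^2 in the modulus, and at most
  k - 1 removals are possible before the solution is primitive.\<close>

lemma Dsol_divide:
  assumes p: "prime (p::int)"
  shows "Dsol e1 e2 e3 m d1 d2 d3 (p ^ (N + 2 * k)) t u1 u2 u3 \<Longrightarrow>
     \<not> (p ^ k dvd t \<and> p ^ k dvd u1 \<and> p ^ k dvd u2 \<and> p ^ k dvd u3) \<Longrightarrow>
     \<exists>t u1 u2 u3. \<not> (p dvd t \<and> p dvd u1 \<and> p dvd u2 \<and> p dvd u3) \<and>
       Dsol e1 e2 e3 m d1 d2 d3 (p ^ N) t u1 u2 u3"
proof (induction k arbitrary: t u1 u2 u3)
  case (Suc k)
  show ?case
  proof (cases "p dvd t \<and> p dvd u1 \<and> p dvd u2 \<and> p dvd u3")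
    case False
    moreover have "p ^ N dvd p ^ (N + 2 * Suc k)" by (rule le_imp_power_dvd) simp
    ultimately show ?thesis using Dsol_mono[OF Suc.prems(1)] by blast
  next
    case True
    then obtain t' v1 v2 v3 where v: "t = p * t'" "u1 = p * v1" "u2 = p * v2" "u3 = p * v3"
      unfolding dvd_def by blast
    have p0: "p^2 \<noteq> 0" using p by auto
    have "Dsol e1 e2 e3 m d1 d2 d3 (p^2 * p ^ (N + 2 * k)) (p * t') (p * v1) (p * v2) (p * v3)"
      using Suc.prems(1) v by (simp add: power2_eq_square mult.assoc)
    then have "Dsol e1 e2 e3 m d1 d2 d3 (p ^ (N + 2 * k)) t' v1 v2 v3"
    proof -
      have c: "p^2 * M dvd a * (p * x)^2 + b * (p * y)^2 - c * (p * z)^2 \<longleftrightarrow> M dvd a * x^2 + b * y^2 - c * z^2"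
        for M a b c x y z :: int
      proof -
        have "a * (p * x)^2 + b * (p * y)^2 - c * (p * z)^2 = p^2 * (a * x^2 + b * y^2 - c * z^2)"
          by (simp add: algebra_simps power_mult_distrib)
        then show ?thesis using p0 by (metis dvd_mult_cancel_left)
      qed
      assume "Dsol e1 e2 e3 m d1 d2 d3 (p^2 * p ^ (N + 2 * k)) (p * t') (p * v1) (p * v2) (p * v3)"
      then show ?thesis unfolding Dsol_def c .
    qed
    moreover have "\<not> (p ^ k dvd t' \<and> p ^ k dvd v1 \<and> p ^ k dvd v2 \<and> p ^ k dvd v3)"
      using Suc.prems(2) v p0 by auto
    ultimately show ?thesis by (rule Suc.IH)
  qed
qed auto

lemma loc_solv_pI_weak:
  assumes "prime p"
    "\<And>N. \<exists>t u1 u2 u3. \<not> (p ^ k dvd t \<and> p ^ k dvd u1 \<and> p ^ k dvd u2 \<and> p ^ k dvd u3) \<and>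
       Dsol e1 e2 e3 m d1 d2 d3 (p ^ N) t u1 u2 u3"
  shows "loc_solv_p e1 e2 e3 m (d1, d2, d3) p"
  unfolding loc_solv_p_iff using assms(2) Dsol_divide[OF assms(1)] by blast

text \<open>Translation by the 2-torsion point \<open>(0,0)\<close> is \<open>x \<mapsto> -e\<^sub>1e\<^sub>2m^2/x\<close>. On the coverings it becomes a linear map
  exchanging \<open>t\<close> with \<open>u\<^sub>3\<close> and \<open>u\<^sub>1\<close> with \<open>u\<^sub>2\<close>; primitivity is lost only by a bounded power of \<open>p\<close>.\<close>

locale translation =
  fixes e1 e2 e3 m d1 d2 d3 d1' d2' d3' s r1 r2 s1 s2 s3 :: int
  assumes e_sum: "e1 + e2 + e3 = 0"
    and nonzero: "m \<noteq> 0" "d1 \<noteq> 0" "d2 \<noteq> 0" "d3 \<noteq> 0" "s \<noteq> 0" "s1 \<noteq> 0" "s2 \<noteq> 0" "s3 \<noteq> 0"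
    and prod: "d1 * d2 * d3 = s^2" and r: "s = d1 * r1" "s = d2 * r2"
    and d1': "e2 * m * d1 = d1' * s1^2" and d2': "- e1 * m * d2 = d2' * s2^2"
    and d3': "- e1 * e2 * d3 = d3' * s3^2"
begin

lemma dr: "d1 * d3 = d2 * r2^2" "d2 * d3 = d1 * r1^2"
proof -
  have "d2 * (d1 * d3) = d2 * (d2 * r2^2)" using prod r(2) by (simp add: power2_eq_square ac_simps)
  then show "d1 * d3 = d2 * r2^2" using nonzero by simp
  have "d1 * (d2 * d3) = d1 * (d1 * r1^2)" using prod r(1) by (simp add: power2_eq_square ac_simps)
  then show "d2 * d3 = d1 * r1^2" using nonzero by simp
qed

lemma e3: "e3 = - e1 - e2" using e_sum by simp

lemma d_transl:
  "d1' * (s1 * r1)^2 = e2 * m * d2 * d3"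
  "d2' * (s2 * r2)^2 = - e1 * m * d1 * d3"
  "d3' * (m * s3)^2 = - e1 * e2 * d3 * m^2"
proof -
  have "d1' * (s1 * r1)^2 = (d1' * s1^2) * r1^2" by (simp add: power_mult_distrib)
  also have "\<dots> = e2 * m * (d1 * r1^2)" unfolding d1'[symmetric] by simp
  finally show "d1' * (s1 * r1)^2 = e2 * m * d2 * d3" unfolding dr(2)[symmetric] by simp
  have "d2' * (s2 * r2)^2 = (d2' * s2^2) * r2^2" by (simp add: power_mult_distrib)
  also have "\<dots> = - e1 * m * (d2 * r2^2)" unfolding d2'[symmetric] by simp
  finally show "d2' * (s2 * r2)^2 = - e1 * m * d1 * d3" unfolding dr(1)[symmetric] by simp
  have "d3' * (m * s3)^2 = (d3' * s3^2) * m^2" by (simp add: power_mult_distrib)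
  then show "d3' * (m * s3)^2 = - e1 * e2 * d3 * m^2" unfolding d3'[symmetric] by simp
qed

text \<open>The image point is (\<open>d3 * u3\<close>, \<open>s1 * r1 * u2\<close>,
  \<open>s2 * r2 * u1\<close>, \<open>m * s3 * t\<close>), and each new quadric is a combination of
  the old ones. An arbitrary commutative ring is used so that the identities serve both the
  congruences and the real place.\<close>

lemma quadrics:
  fixes t u1 u2 u3 :: "'a::comm_ring_1"
  shows "of_int (e1 * m) * (of_int d3 * u3)^2 + of_int d2' * (of_int (s2 * r2) * u1)^2 - of_int d3' * (of_int (m * s3) * t)^2
      = of_int (e1 * m * d3) * (of_int (e2 * m) * t^2 + of_int d3 * u3^2 - of_int d1 * u1^2)"
    "of_int (e2 * m) * (of_int d3 * u3)^2 + of_int d3' * (of_int (m * s3) * t)^2 - of_int d1' * (of_int (s1 * r1) * u2)^2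
      = - of_int (e2 * m * d3) * (of_int (e1 * m) * t^2 + of_int d2 * u2^2 - of_int d3 * u3^2)"
    "of_int (e3 * m) * (of_int d3 * u3)^2 + of_int d1' * (of_int (s1 * r1) * u2)^2 - of_int d2' * (of_int (s2 * r2) * u1)^2
      = of_int (m * d3 * e2) * (of_int (e1 * m) * t^2 + of_int d2 * u2^2 - of_int d3 * u3^2)
        - of_int (m * d3 * e1) * (of_int (e2 * m) * t^2 + of_int d3 * u3^2 - of_int d1 * u1^2)"
proof -
  have sq: "of_int d * (of_int x * u)^2 = of_int (d * x^2) * u^2" for d x and u :: 'a
    by (simp add: power_mult_distrib)
  show "of_int (e1 * m) * (of_int d3 * u3)^2 + of_int d2' * (of_int (s2 * r2) * u1)^2 - of_int d3' * (of_int (m * s3) * t)^2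
      = of_int (e1 * m * d3) * (of_int (e2 * m) * t^2 + of_int d3 * u3^2 - of_int d1 * u1^2)"
    unfolding sq d_transl by (simp add: algebra_simps power2_eq_square)
  show "of_int (e2 * m) * (of_int d3 * u3)^2 + of_int d3' * (of_int (m * s3) * t)^2 - of_int d1' * (of_int (s1 * r1) * u2)^2
      = - of_int (e2 * m * d3) * (of_int (e1 * m) * t^2 + of_int d2 * u2^2 - of_int d3 * u3^2)"
    unfolding sq d_transl by (simp add: algebra_simps power2_eq_square)
  show "of_int (e3 * m) * (of_int d3 * u3)^2 + of_int d1' * (of_int (s1 * r1) * u2)^2 - of_int d2' * (of_int (s2 * r2) * u1)^2
      = of_int (m * d3 * e2) * (of_int (e1 * m) * t^2 + of_int d2 * u2^2 - of_int d3 * u3^2)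
        - of_int (m * d3 * e1) * (of_int (e2 * m) * t^2 + of_int d3 * u3^2 - of_int d1 * u1^2)"
    unfolding sq d_transl e3 by (simp add: algebra_simps power2_eq_square)
qed

lemma r_nonzero: "r1 \<noteq> 0" "r2 \<noteq> 0" using r nonzero by auto

lemma loc_solv_p_translate:
  assumes p: "prime p" and L: "loc_solv_p e1 e2 e3 m (d1, d2, d3) p"
  shows "loc_solv_p e1 e2 e3 m (d1', d2', d3') p"
proof -
  \<comment> \<open>The product of the coefficients of the linear map. If p^k, with k beyond the
    valuation of \<open>c\<close>, divides a coefficient times a variable, then p divides the
    variable; so the image of a primitive solution is not divisible by p^k.\<close>
  define c where "c = d3 * ((s1 * r1) * ((s2 * r2) * (m * s3)))"
  have "c \<noteq> 0" unfolding c_def using nonzero r_nonzero by simp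
  then have c: "\<not> p ^ Suc (multiplicity p c) dvd c"
    using p by (metis Suc_n_not_le_n multiplicity_geI not_prime_unit)
  define k where "k = Suc (multiplicity p c)"
  have red: "p dvd u" if "x dvd c" "p ^ k dvd x * u" for x u
  proof (rule ccontr)
    assume "\<not> p dvd u"
    then have "coprime (p ^ k) u" using p prime_imp_coprime by (simp add: prime_imp_coprime)
    then have "p ^ k dvd x" using that(2) coprime_dvd_mult_left_iff by blast
    then show False using that(1) c k_def dvd_trans by blast
  qed
  show ?thesis
  proof (rule loc_solv_pI_weak[OF p, of k])
    fix N
    obtain t u1 u2 u3 where prim: "\<not> (p dvd t \<and> p dvd u1 \<and> p dvd u2 \<and> p dvd u3)"
      and D: "Dsol e1 e2 e3 m d1 d2 d3 (p ^ N) t u1 u2 u3" using loc_solv_pD[OF L] .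
    have q: "e1 * m * (d3 * u3)^2 + d2' * (s2 * r2 * u1)^2 - d3' * (m * s3 * t)^2
        = e1 * m * d3 * (e2 * m * t^2 + d3 * u3^2 - d1 * u1^2)"
      "e2 * m * (d3 * u3)^2 + d3' * (m * s3 * t)^2 - d1' * (s1 * r1 * u2)^2
        = - (e2 * m * d3) * (e1 * m * t^2 + d2 * u2^2 - d3 * u3^2)"
      "e3 * m * (d3 * u3)^2 + d1' * (s1 * r1 * u2)^2 - d2' * (s2 * r2 * u1)^2
        = m * d3 * e2 * (e1 * m * t^2 + d2 * u2^2 - d3 * u3^2)
          - m * d3 * e1 * (e2 * m * t^2 + d3 * u3^2 - d1 * u1^2)"
      using quadrics(1)[where 'a=int, of u3 u1 t] quadrics(2)[where 'a=int, of u3 t u2]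
        quadrics(3)[where 'a=int, of u3 u2 u1 t] by (simp_all only: of_int_eq_id id_def)
    have "Dsol e1 e2 e3 m d1' d2' d3' (p ^ N) (d3 * u3) (s1 * r1 * u2) (s2 * r2 * u1) (m * s3 * t)"
      unfolding Dsol_def q using D unfolding Dsol_def by (blast intro: dvd_mult dvd_diff)
    moreover have "\<not> (p ^ k dvd d3 * u3 \<and> p ^ k dvd s1 * r1 * u2 \<and> p ^ k dvd s2 * r2 * u1 \<and> p ^ k dvd m * s3 * t)"
    proof -
      have "d3 dvd c" "s1 * r1 dvd c" "s2 * r2 dvd c" "m * s3 dvd c"
        unfolding c_def using dvd_triv_left dvd_mult[OF dvd_triv_left] dvd_mult[OF dvd_mult[OF dvd_triv_left]]
          dvd_mult[OF dvd_mult[OF dvd_triv_right]] by blast+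
      then show ?thesis using red prim by blast
    qed
    ultimately show "\<exists>t u1 u2 u3. \<not> (p ^ k dvd t \<and> p ^ k dvd u1 \<and> p ^ k dvd u2 \<and> p ^ k dvd u3) \<and>
       Dsol e1 e2 e3 m d1' d2' d3' (p ^ N) t u1 u2 u3" by blast
  qed
qed

lemma loc_solv_R_translate:
  assumes L: "loc_solv_R e1 e2 e3 m (d1, d2, d3)"
  shows "loc_solv_R e1 e2 e3 m (d1', d2', d3')"
proof -
  obtain t u1 u2 u3 :: real where prim: "\<not> (t = 0 \<and> u1 = 0 \<and> u2 = 0 \<and> u3 = 0)" and
    D: "of_int (e1 * m) * t^2 + d2 * u2^2 - d3 * u3^2 = 0"
       "of_int (e2 * m) * t^2 + d3 * u3^2 - d1 * u1^2 = 0"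
    using L unfolding loc_solv_R_iff by (elim exE conjE) (rule that)
  have nz: "\<not> (d3 * u3 = 0 \<and> of_int (s1 * r1) * u2 = 0 \<and> of_int (s2 * r2) * u1 = 0 \<and> of_int (m * s3) * t = 0)"
    using prim nonzero r_nonzero by auto
  show ?thesis unfolding loc_solv_R_iff
    by (intro exI conjI, rule nz) (simp_all only: quadrics(1)[of _ _ t] quadrics(2)[of _ t] quadrics(3)[of _ _ _ t] D mult_zero_right diff_zero)
qed

end

section \<open>Local solubility at odd primes\<close>

lemma sum_residues_affine:
  fixes f :: "int \<Rightarrow> int"
  assumes p: "prime p" and f: "\<And>x. f (x mod p) = f x" and g: "\<not> p dvd g"
  shows "(\<Sum>x\<in>{0..<p}. f (g * x + h)) = (\<Sum>x\<in>{0..<p}. f x)"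
proof -
  have p0: "0 < p" using p prime_gt_0_int by blast
  define \<phi> where "\<phi> x = (g * x + h) mod p" for x
  have inj: "inj_on \<phi> {0..<p}"
  proof (rule inj_onI)
    fix x y assume xy: "x \<in> {0..<p}" "y \<in> {0..<p}" "\<phi> x = \<phi> y"
    then have "p dvd (g * x + h) - (g * y + h)" unfolding \<phi>_def by (simp add: mod_eq_dvd_iff)
    then have "p dvd g * (x - y)" by (simp add: algebra_simps)
    then have "[x = y] (mod p)" using p g by (simp add: prime_dvd_mult_iff cong_iff_dvd_diff)
    then show "x = y" using xy by (intro cong_small_imp_eq) auto
  qed
  have "\<phi> ` {0..<p} \<subseteq> {0..<p}" using p0 by (auto simp: \<phi>_def)
  then have im: "\<phi> ` {0..<p} = {0..<p}" using inj by (intro endo_inj_surj) auto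
  have "(\<Sum>x\<in>{0..<p}. f (g * x + h)) = (\<Sum>x\<in>{0..<p}. f (\<phi> x))"
    unfolding \<phi>_def using f by simp
  also have "\<dots> = (\<Sum>x\<in>\<phi> ` {0..<p}. f x)" using inj by (simp add: sum.reindex)
  finally show ?thesis using im by simp
qed

lemma Legendre_mod: "Legendre (x mod p) p = Legendre x p"
  by (rule Legendre_cong) (simp add: cong_def)

text \<open>Squaring identifies 1 and p - 1, so it is not injective on the residues modulo p and
  therefore not surjective.\<close>

lemma exists_nonresidue:
  assumes "prime p" "odd p" obtains g where "\<not> p dvd g" "Legendre g p = -1"
proof -
  have p2: "2 < p" using odd_prime_gt_2 assms .
  define \<phi> where "\<phi> x = x^2 mod p" for x :: int
  have sub: "\<phi> ` {0..<p} \<subseteq> {0..<p}" using p2 by (auto simp: \<phi>_def)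
  have "\<phi> 1 = \<phi> (p - 1)"
  proof -
    have "(p - 1)^2 = 1 + p * (p - 2)" by (simp add: power2_eq_square algebra_simps)
    then show ?thesis using p2 by (simp add: \<phi>_def)
  qed
  moreover have "(1::int) \<noteq> p - 1" "1 \<in> {0..<p}" "p - 1 \<in> {0..<p}" using p2 by auto
  ultimately have "\<not> inj_on \<phi> {0..<p}" unfolding inj_on_def by blast
  then have "\<phi> ` {0..<p} \<noteq> {0..<p}" using eq_card_imp_inj_on[of "{0..<p}" \<phi>] by fastforce
  then obtain c where c: "c \<in> {0..<p}" "c \<notin> \<phi> ` {0..<p}" using sub by blast
  have nq: "\<not> QuadRes p c"
  proof
    assume "QuadRes p c"
    then obtain y where "[y^2 = c] (mod p)" unfolding QuadRes_def by blast
    then have "\<phi> (y mod p) = c" using c(1) by (simp add: \<phi>_def cong_def power_mod)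
    moreover have "y mod p \<in> {0..<p}" using p2 by simp
    ultimately show False using c(2) by blast
  qed
  have "\<not> p dvd c"
  proof
    assume "p dvd c"
    then have "QuadRes p c" unfolding QuadRes_def by (intro exI[of _ 0]) (simp add: cong_sym cong_0_iff)
    then show False using nq by blast
  qed
  moreover from this have "Legendre c p = -1" using nq Legendre_eq_1_iff Legendre_values by blast
  ultimately show ?thesis using that by blast
qed

text \<open>Scaling the variable by a nonresidue permutes the residues but negates the sum.\<close>

lemma sum_Legendre:
  assumes "prime p" "odd p" shows "(\<Sum>x\<in>{0..<p}. Legendre (x + h) p) = 0"
proof -
  obtain g where g: "\<not> p dvd g" "Legendre g p = -1" using exists_nonresidue[OF assms] .
  have "(\<Sum>x\<in>{0..<p}. Legendre (g * x + 0) p) = (\<Sum>x\<in>{0..<p}. Legendre x p)"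
    using sum_residues_affine[of p "\<lambda>x. Legendre x p" g 0] assms(1) g(1) Legendre_mod by blast
  then have "- (\<Sum>x\<in>{0..<p}. Legendre x p) = (\<Sum>x\<in>{0..<p}. Legendre x p)"
    using g(2) by (simp add: Legendre_mult[OF assms] sum_negf)
  then have "(\<Sum>x\<in>{0..<p}. Legendre x p) = 0" by linarith
  moreover have "\<not> p dvd 1" using assms(1) not_prime_unit by blast
  ultimately show ?thesis
    using sum_residues_affine[of p "\<lambda>x. Legendre x p" 1 h] assms(1) Legendre_mod by simp
qed

text \<open>Let T(c) be the sum of (y/p)((y + c)/p). Scaling y by c gives T(c) = T(1) for c prime to
  p. Moreover T(0) = p - 1 and the sum of all T(c) vanishes, so (p - 1)(1 + T(1)) = 0.\<close>

lemma sum_Legendre_quadratic: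
  assumes p: "prime p" "odd p" and ab: "\<not> p dvd a - b"
  shows "(\<Sum>x\<in>{0..<p}. Legendre (x - a) p * Legendre (x - b) p) = -1"
proof -
  have p2: "2 < p" using odd_prime_gt_2 p .
  define T where "T c = (\<Sum>y\<in>{0..<p}. Legendre y p * Legendre (y + c) p)" for c
  have per: "Legendre (x mod p) p * Legendre (x mod p + c) p = Legendre x p * Legendre (x + c) p" for x c
  proof -
    have "Legendre (x mod p + c) p = Legendre (x + c) p"
      by (rule Legendre_cong) (simp add: cong_def mod_add_left_eq)
    then show ?thesis by (simp add: Legendre_mod)
  qed
  have T1: "T c = T 1" if "\<not> p dvd c" for c
  proof -
    have "T c = (\<Sum>y\<in>{0..<p}. Legendre (c * y + 0) p * Legendre (c * y + 0 + c) p)"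
      unfolding T_def using sum_residues_affine[OF p(1), of "\<lambda>x. Legendre x p * Legendre (x + c) p" c 0] per that by simp
    also have "\<dots> = (\<Sum>y\<in>{0..<p}. Legendre y p * Legendre (y + 1) p)"
    proof (rule sum.cong[OF refl])
      fix y
      have "c * y + 0 + c = c * (y + 1)" by (simp add: algebra_simps)
      then have "Legendre (c * y + 0) p * Legendre (c * y + 0 + c) p
        = (Legendre c p * Legendre c p) * (Legendre y p * Legendre (y + 1) p)"
        using Legendre_mult[OF p] by simp
      then show "Legendre (c * y + 0) p * Legendre (c * y + 0 + c) p = Legendre y p * Legendre (y + 1) p"
        using Legendre_square[OF that] by simp
    qed
    finally show ?thesis unfolding T_def .
  qed
  have T0: "T 0 = p - 1"
  proof -
    have "T 0 = (\<Sum>y\<in>{0..<p} - {0}. Legendre y p * Legendre (y + 0) p)"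
      unfolding T_def using p2 by (intro sum.mono_neutral_right) (auto simp: Legendre_def)
    also have "\<dots> = (\<Sum>y\<in>{0..<p} - {0}. 1)"
      using zdvd_not_zless by (intro sum.cong refl) (auto intro!: Legendre_square)
    also have "\<dots> = p - 1" using p2 by (simp add: card_Diff_subset)
    finally show ?thesis .
  qed
  have "(\<Sum>c\<in>{0..<p}. T c) = (\<Sum>y\<in>{0..<p}. \<Sum>c\<in>{0..<p}. Legendre y p * Legendre (y + c) p)"
    unfolding T_def by (rule sum.swap)
  also have "\<dots> = (\<Sum>y\<in>{0..<p}. Legendre y p * (\<Sum>c\<in>{0..<p}. Legendre (c + y) p))"
    by (simp add: sum_distrib_left add.commute)
  also have "\<dots> = 0" using sum_Legendre[OF p] by simp
  finally have "0 = (\<Sum>c\<in>{0..<p}. T c)" by simp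
  also have "\<dots> = T 0 + (\<Sum>c\<in>{0..<p} - {0}. T c)" using p2 by (intro sum.remove) auto
  also have "(\<Sum>c\<in>{0..<p} - {0}. T c) = (\<Sum>c\<in>{0..<p} - {0}. T 1)"
    using zdvd_not_zless by (intro sum.cong refl T1) auto
  also have "\<dots> = (p - 1) * T 1" using p2 by (simp add: card_Diff_subset)
  finally have "T 0 + (p - 1) * T 1 = 0" by simp
  then have "(p - 1) * (1 + T 1) = 0" unfolding T0 by (simp add: algebra_simps)
  then have "T 1 = -1" using p2 by simp
  then have "T (a - b) = -1" using T1 ab by simp
  moreover have "T (a - b) = (\<Sum>x\<in>{0..<p}. Legendre (1 * x + (- a)) p * Legendre (1 * x + (- a) + (a - b)) p)"
    unfolding T_def using sum_residues_affine[OF p(1), of "\<lambda>x. Legendre x p * Legendre (x + (a - b)) p" 1 "- a"]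
      per p(1) not_prime_unit by auto
  ultimately show ?thesis by simp
qed

text \<open>A curve of genus one over a finite field has a point: if no \<open>x\<close> had the prescribed residue
  characters, the character sum would force \<open>\<Sum>\<chi>((x-r\<^sub>1)(x-r\<^sub>2)(x-r\<^sub>3)) = -(p+1)\<close>.\<close>

lemma exists_prescribed_characters:
  assumes p: "prime p" "odd p" and r: "\<not> p dvd r1 - r2" "\<not> p dvd r2 - r3" "\<not> p dvd r1 - r3"
    and c: "c1 = 1 \<or> c1 = -1" "c2 = 1 \<or> c2 = -1" "c3 = 1 \<or> c3 = -1" "c1 * c2 * c3 = (1::int)"
    and nt: "\<not> (c1 = 1 \<and> c2 = 1)"
  obtains x where "Legendre (x - r1) p \<noteq> - c1" "Legendre (x - r2) p \<noteq> - c2" "Legendre (x - r3) p \<noteq> - c3"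
proof -
  define L where "L r x = Legendre (x - r) p" for r x
  define F where "F x = (1 + c1 * L r1 x) * (1 + c2 * L r2 x) * (1 + c3 * L r3 x)" for x
  \<comment> \<open>The product is 1 and not all signs are 1, so exactly one of them is 1. The
    function \<open>F\<close> vanishes at x exactly when one of the three characters takes its
    forbidden value.\<close>
  have cs: "c1 * c2 = c3" "c1 * c3 = c2" "c2 * c3 = c1" "c1 + c2 + c3 = -1" using c nt by auto
  have "F x = 1 + c1 * L r1 x + c2 * L r2 x + c3 * L r3 x + (c1 * c2) * (L r1 x * L r2 x)
      + (c1 * c3) * (L r1 x * L r3 x) + (c2 * c3) * (L r2 x * L r3 x) + (c1 * c2 * c3) * (L r1 x * L r2 x * L r3 x)" for x
    unfolding F_def by (simp add: algebra_simps)
  then have Fx: "F x = 1 + c1 * L r1 x + c2 * L r2 x + c3 * L r3 x + c3 * (L r1 x * L r2 x)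
      + c2 * (L r1 x * L r3 x) + c1 * (L r2 x * L r3 x) + L r1 x * L r2 x * L r3 x" for x
    using c(4) cs by simp
  have s1: "(\<Sum>x\<in>{0..<p}. L r x) = 0" for r using sum_Legendre[OF p, of "- r"] by (simp add: L_def)
  have s2: "(\<Sum>x\<in>{0..<p}. L a x * L b x) = -1" if "\<not> p dvd a - b" for a b
    using sum_Legendre_quadratic[OF p that] by (simp add: L_def)
  have ge: "-1 \<le> L r1 x * L r2 x * L r3 x" for x
  proof -
    have v: "L r x \<in> {-1, 0, 1}" for r unfolding L_def Legendre_def by auto
    show ?thesis using v[of r1] v[of r2] v[of r3] by auto
  qed
  have "(\<Sum>x\<in>{0..<p}. F x) = p - (c1 + c2 + c3) + (\<Sum>x\<in>{0..<p}. L r1 x * L r2 x * L r3 x)"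
    unfolding Fx sum.distrib sum_distrib_left[symmetric] s1 s2[OF r(1)] s2[OF r(2)] s2[OF r(3)]
    using prime_gt_0_int[OF p(1)] by simp
  moreover have "(\<Sum>x\<in>{0..<p}. -1) \<le> (\<Sum>x\<in>{0..<p}. L r1 x * L r2 x * L r3 x)"
    by (intro sum_mono ge)
  ultimately have "(\<Sum>x\<in>{0..<p}. F x) \<noteq> 0" using cs(4) prime_gt_0_int[OF p(1)] by auto
  then obtain x where "F x \<noteq> 0" using sum.neutral[of "{0..<p}" F] by blast
  then have f: "1 + c1 * L r1 x \<noteq> 0" "1 + c2 * L r2 x \<noteq> 0" "1 + c3 * L r3 x \<noteq> 0"
    unfolding F_def by auto
  have ne: "L r x \<noteq> - c" if "1 + c * L r x \<noteq> 0" "c = 1 \<or> c = -1" for r c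
    using that by auto
  show ?thesis using that[of x] ne[OF f(1) c(1)] ne[OF f(2) c(2)] ne[OF f(3) c(3)] unfolding L_def by blast
qed

text \<open>The chart t = 1: \<open>y3\<close> is the x-coordinate of a point on the curve,
  \<open>y1\<close> is x + e2 m and \<open>y2\<close> is x - e1 m. Once these values are fixed, the
  three equations can be solved independently.\<close>

lemma loc_solv_p_affine:
  assumes "prime p" "e1 * m + y2 - y3 = 0" "e2 * m + y3 - y1 = 0" "e3 * m + y1 - y2 = 0"
    and "\<And>N. \<exists>u. [d1 * u^2 = y1] (mod p ^ N)"
    and "\<And>N. \<exists>u. [d2 * u^2 = y2] (mod p ^ N)"
    and "\<And>N. \<exists>u. [d3 * u^2 = y3] (mod p ^ N)"
  shows "loc_solv_p e1 e2 e3 m (d1, d2, d3) p"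
  unfolding loc_solv_p_iff
proof
  fix N
  obtain u1 u2 u3 where u: "[d1 * u1^2 = y1] (mod p ^ N)" "[d2 * u2^2 = y2] (mod p ^ N)" "[d3 * u3^2 = y3] (mod p ^ N)"
    using assms by blast
  have c: "p ^ N dvd e * m * 1^2 + a - b" if "[a = y] (mod p ^ N)" "[b = z] (mod p ^ N)" "e * m + y - z = 0" for e a b y z
  proof -
    have "[e * m + a - b = e * m + y - z] (mod p ^ N)" using that by (intro cong_add cong_diff cong_refl)
    then show ?thesis using that(3) by (simp add: cong_0_iff)
  qed
  have "Dsol e1 e2 e3 m d1 d2 d3 (p ^ N) 1 u1 u2 u3"
    unfolding Dsol_def using c[OF u(2,3) assms(2)] c[OF u(3,1) assms(3)] c[OF u(1,2) assms(4)] by blast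
  moreover have "\<not> p dvd 1" using assms(1) not_prime_unit by blast
  ultimately show "\<exists>t u1 u2 u3. \<not> (p dvd t \<and> p dvd u1 \<and> p dvd u2 \<and> p dvd u3) \<and> Dsol e1 e2 e3 m d1 d2 d3 (p ^ N) t u1 u2 u3"
    by blast
qed

text \<open>The chart t = 0, above the point at infinity. The extra power of p in the modulus shows
  that u1 is a unit even when N = 0.\<close>

lemma loc_solv_p_infinity:
  assumes "prime p" and u: "\<And>N. \<exists>u. [d1 * u^2 = 1] (mod p ^ N)"
    "\<And>N. \<exists>u. [d2 * u^2 = 1] (mod p ^ N)" "\<And>N. \<exists>u. [d3 * u^2 = 1] (mod p ^ N)"
  shows "loc_solv_p e1 e2 e3 m (d1, d2, d3) p"
  unfolding loc_solv_p_iff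
proof
  fix N
  obtain u1 u2 u3 where u: "[d1 * u1^2 = 1] (mod p ^ Suc N)" "[d2 * u2^2 = 1] (mod p ^ Suc N)" "[d3 * u3^2 = 1] (mod p ^ Suc N)"
    using u by blast
  have c: "p ^ N dvd e * m * 0^2 + a - b" if "[a = 1] (mod p ^ Suc N)" "[b = 1] (mod p ^ Suc N)" for e a b
  proof -
    have "[a = b] (mod p ^ Suc N)" using that cong_sym cong_trans by blast
    then have "p ^ Suc N dvd a - b" by (simp add: cong_iff_dvd_diff)
    then show ?thesis by (simp add: dvd_mult_right)
  qed
  have "Dsol e1 e2 e3 m d1 d2 d3 (p ^ N) 0 u1 u2 u3"
    unfolding Dsol_def using c[OF u(2,3)] c[OF u(3,1)] c[OF u(1,2)] by blast
  moreover have "\<not> p dvd u1"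
  proof
    assume "p dvd u1"
    then have "p dvd d1 * u1^2" by (simp add: power2_eq_square)
    moreover have "[d1 * u1^2 = 1] (mod p)" using u(1) by (rule cong_dvd_modulus) simp
    ultimately show False using assms(1) cong_dvd_iff not_prime_unit by blast
  qed
  ultimately show "\<exists>t u1 u2 u3. \<not> (p dvd t \<and> p dvd u1 \<and> p dvd u2 \<and> p dvd u3) \<and> Dsol e1 e2 e3 m d1 d2 d3 (p ^ N) t u1 u2 u3"
    by blast
qed

lemma residue_times_square:
  assumes "prime p" "odd p" "Legendre (d * y) p = 1"
  shows "\<exists>u. [d * u^2 = y] (mod p ^ N)"
proof -
  have "\<not> p dvd d * y" using assms(3) Legendre_eq_0_iff[of "d * y" p] by auto
  then have "\<not> p dvd d" "\<not> p dvd y" "QuadRes p (d * y)"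
    using assms Legendre_eq_1_iff by auto
  then show ?thesis using unit_times_square_cong assms(1,2) by blast
qed

lemma loc_solv_p_residues:
  assumes "prime p" "odd p" "Legendre d1 p = 1" "Legendre d2 p = 1" "Legendre d3 p = 1"
  shows "loc_solv_p e1 e2 e3 m (d1, d2, d3) p"
  using assms by (intro loc_solv_p_infinity residue_times_square) auto

lemma Legendre_triple:
  assumes "prime p" "odd p" "d1 * d2 * d3 = s^2" "\<not> p dvd d1" "\<not> p dvd d2" "\<not> p dvd d3"
  shows "Legendre d1 p * Legendre d2 p * Legendre d3 p = 1"
proof -
  have "\<not> p dvd d1 * d2 * d3" using assms(1,4-6) by (simp add: prime_dvd_mult_iff)
  then have "\<not> p dvd s" using assms by (simp add: prime_dvd_power_iff)
  then have "Legendre (d1 * d2 * d3) p = 1" using assms Legendre_square_arg by simp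
  then show ?thesis using Legendre_mult[OF assms(1,2)] by simp
qed

lemma loc_solv_p_good:
  assumes p: "prime p" "odd p" and e: "e1 + e2 + e3 = 0" "\<not> p dvd e1 * e2 * e3 * m"
    and d: "\<not> p dvd d1" "\<not> p dvd d2" "\<not> p dvd d3" "d1 * d2 * d3 = s^2"
  shows "loc_solv_p e1 e2 e3 m (d1, d2, d3) p"
proof (cases "Legendre d1 p = 1 \<and> Legendre d2 p = 1")
  case True
  then show ?thesis using Legendre_triple[OF p d(4,1,2,3)] p by (intro loc_solv_p_residues) auto
next
  case False
  define r1 r2 r3 where r: "r1 = - e2 * m" "r2 = e1 * m" "r3 = (0::int)"
  have nd: "\<not> p dvd e1 * m" "\<not> p dvd e2 * m" "\<not> p dvd e3 * m" using e(2) p by (auto simp: prime_dvd_mult_iff)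
  have E: "e3 = - e1 - e2" using e(1) by simp
  have e3: "r1 - r2 = e3 * m" "r2 - r3 = e1 * m" "r1 - r3 = - (e2 * m)"
    unfolding r E by (simp_all add: algebra_simps)
  have nd': "\<not> p dvd r1 - r2" "\<not> p dvd r2 - r3" "\<not> p dvd r1 - r3" using nd e3 by auto
  obtain x where x: "Legendre (x - r1) p \<noteq> - Legendre d1 p" "Legendre (x - r2) p \<noteq> - Legendre d2 p"
    "Legendre (x - r3) p \<noteq> - Legendre d3 p"
    by (rule exists_prescribed_characters[OF p nd' Legendre_values[OF d(1)] Legendre_values[OF d(2)]
          Legendre_values[OF d(3)] Legendre_triple[OF p d(4,1,2,3)] False])
  \<comment> \<open>If x reduces to a root of the cubic, it is replaced by that root: then u = 0
    solves the equation exactly, while a nonzero value divisible by p would escape the lifting of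
    unit residues. The residue class of x is unchanged.\<close>
  define x' where "x' = (if p dvd x - r1 then r1 else if p dvd x - r2 then r2 else if p dvd x - r3 then r3 else x)"
  have "p dvd x - x'" by (auto simp: x'_def)
  then have cong: "[x - r = x' - r] (mod p)" for r by (simp add: cong_iff_dvd_diff)
  have nd'': "\<not> p dvd r2 - r1" "\<not> p dvd r3 - r2" "\<not> p dvd r3 - r1"
    using nd' dvd_diff_commute[of p] by blast+
  have zero: "x' = r1 \<or> \<not> p dvd x' - r1" "x' = r2 \<or> \<not> p dvd x' - r2" "x' = r3 \<or> \<not> p dvd x' - r3"
    using nd' nd'' by (auto simp: x'_def)
  have sol: "\<exists>u. [d * u^2 = x' - r] (mod p ^ N)"
    if "x' = r \<or> \<not> p dvd x' - r" "Legendre (x - r) p \<noteq> - Legendre d p" "\<not> p dvd d" for d r N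
    using that(1)
  proof
    assume "x' = r" then show ?thesis by (intro exI[of _ 0]) simp
  next
    assume nx: "\<not> p dvd x' - r"
    have "Legendre (x' - r) p = Legendre d p"
      using Legendre_cong[OF cong, of r] that(2) Legendre_values[OF nx] Legendre_values[OF that(3)] by auto
    then have "Legendre (d * (x' - r)) p = 1" using Legendre_mult[OF p] Legendre_square[OF that(3)] by simp
    then show ?thesis using residue_times_square[OF p] by blast
  qed
  show ?thesis
    by (rule loc_solv_p_affine[OF p(1), where ?y1.0 = "x' - r1" and ?y2.0 = "x' - r2" and ?y3.0 = "x' - r3"])
      (use e3 sol[OF zero(1) x(1) d(1)] sol[OF zero(2) x(2) d(2)] sol[OF zero(3) x(3) d(3)] in \<open>auto simp: algebra_simps\<close>)
qed

section \<open>Ramified triples and primes dividing the twist\<close>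

lemma squarefree_dvd_mult_square:
  assumes "prime (p::int)" "squarefree d" "p^2 dvd d * u^2" shows "p dvd u"
proof (rule ccontr)
  assume "\<not> p dvd u"
  then have "coprime (p^2) (u^2)" using assms(1) by (simp add: prime_imp_coprime)
  then have "p^2 dvd d" using assms(3) coprime_dvd_mult_left_iff by blast
  then show False using assms(1,2) squarefreeD not_prime_unit by blast
qed

text \<open>Descent modulo p^2: the third quadric forces p | t and the first then p | u3. Now the
  terms in t and u3 are divisible by p^2, which pushes p into u1 and u2 because d1 and d2 are
  square-free; the solution is not primitive.\<close>

lemma not_loc_solv_p_ramified:
  assumes p: "prime p" and e: "\<not> p dvd e3 * m"
    and d: "p dvd d1" "p dvd d2" "\<not> p dvd d3" "squarefree d1" "squarefree d2"
  shows "\<not> loc_solv_p e1 e2 e3 m (d1, d2, d3) p"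
proof
  assume "loc_solv_p e1 e2 e3 m (d1, d2, d3) p"
  then obtain t u1 u2 u3 where prim: "\<not> (p dvd t \<and> p dvd u1 \<and> p dvd u2 \<and> p dvd u3)"
    and D: "Dsol e1 e2 e3 m d1 d2 d3 (p ^ 2) t u1 u2 u3" using loc_solv_pD by blast
  have f: "p^2 dvd e1 * m * t^2 + d2 * u2^2 - d3 * u3^2" "p^2 dvd e2 * m * t^2 + d3 * u3^2 - d1 * u1^2"
    "p^2 dvd e3 * m * t^2 + d1 * u1^2 - d2 * u2^2" using D unfolding Dsol_def by auto
  have f': "p dvd e3 * m * t^2 + d1 * u1^2 - d2 * u2^2" "p dvd e1 * m * t^2 + d2 * u2^2 - d3 * u3^2"
    by (rule dvd_trans[OF _ f(3)], simp) (rule dvd_trans[OF _ f(1)], simp)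
  have "p dvd e3 * m * t^2"
    using f'(1) d(1,2) by (metis add_diff_eq dvd_add_left_iff dvd_diff dvd_mult2)
  then have t: "p dvd t" using e p by (simp add: prime_dvd_mult_iff prime_dvd_power_iff)
  then have t2: "p^2 dvd e * m * t^2" for e by (simp add: dvd_power_same)
  have "p dvd e1 * m * t^2 + d2 * u2^2" using t d(2) by (simp add: power2_eq_square)
  then have "p dvd d3 * u3^2" using f'(2) by (metis dvd_diff_right_iff)
  then have u3: "p dvd u3" using d(3) p by (simp add: prime_dvd_mult_iff prime_dvd_power_iff)
  then have u32: "p^2 dvd d3 * u3^2" by (simp add: dvd_power_same)
  have "p^2 dvd d2 * u2^2" using f(1) u32 t2[of e1] by (metis dvd_add_right_iff dvd_diff_left_iff)
  then have "p dvd u2" using squarefree_dvd_mult_square p d(5) by blast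
  moreover have "p^2 dvd d1 * u1^2" using f(2) u32 t2[of e2] by (metis dvd_add dvd_diff_right_iff)
  then have "p dvd u1" using squarefree_dvd_mult_square p d(4) by blast
  ultimately show False using prim t u3 by blast
qed

text \<open>A prime dividing the triple divides exactly one of a, b, c, and each possibility is the
  ramified obstruction in one of the three rotations.\<close>

lemma not_dvd_triple_if_loc_solv_p:
  assumes p: "prime p" and e: "\<not> p dvd e1 * e2 * e3 * m"
    and d: "squarefree d1" "squarefree d2" "squarefree d3" "d1 * d2 * d3 = s^2"
    and L: "loc_solv_p e1 e2 e3 m (d1, d2, d3) p"
  shows "\<not> p dvd d1" "\<not> p dvd d2" "\<not> p dvd d3"
proof -
  obtain a b c where abc: "d1 = a * b" "d2 = a * c" "d3 = b * c" "coprime a b" "coprime a c" "coprime b c"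
    using squarefree_triple_decompose[OF d] .
  have nd: "\<not> p dvd e1 * m" "\<not> p dvd e2 * m" "\<not> p dvd e3 * m" using e p by (auto simp: prime_dvd_mult_iff)
  have cop: "\<not> (p dvd x \<and> p dvd y)" if "coprime x y" for x y
    using that p by (meson coprime_common_divisor not_prime_unit)
  have L2: "loc_solv_p e2 e3 e1 m (d2, d3, d1) p" using L loc_solv_p_rotate[of e1] by simp
  have L3: "loc_solv_p e3 e1 e2 m (d3, d1, d2) p" using L2 loc_solv_p_rotate[of e2] by simp
  have "\<not> p dvd a" 
  proof
    assume a: "p dvd a"
    then have "\<not> p dvd d3" using cop abc p by (auto simp: prime_dvd_mult_iff)
    then show False using not_loc_solv_p_ramified[OF p nd(3)] a abc d L by auto
  qed
  moreover have "\<not> p dvd c" 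
  proof
    assume a: "p dvd c"
    then have "\<not> p dvd d1" using cop abc p by (auto simp: prime_dvd_mult_iff)
    then show False using not_loc_solv_p_ramified[OF p nd(1)] a abc d L2 by auto
  qed
  moreover have "\<not> p dvd b" 
  proof
    assume a: "p dvd b"
    then have "\<not> p dvd d2" using cop abc p by (auto simp: prime_dvd_mult_iff)
    then show False using not_loc_solv_p_ramified[OF p nd(2)] a abc d L3 by auto
  qed
  ultimately show "\<not> p dvd d1" "\<not> p dvd d2" "\<not> p dvd d3" using abc p by (auto simp: prime_dvd_mult_iff)
qed

text \<open>Modulo p the terms in t vanish, so the three values d_i u_i^2 are congruent. The u_i are
  units, for otherwise t would be one and p^2 would divide \<open>e1 * m\<close>. Hence the three
  characters agree, and as their product is 1 they equal 1.\<close>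

lemma residues_if_loc_solv_p_twist:
  assumes p: "prime p" "odd p" and m: "p dvd m" "\<not> p^2 dvd m" "\<not> p dvd e1"
    and d: "\<not> p dvd d1" "\<not> p dvd d2" "\<not> p dvd d3" "d1 * d2 * d3 = s^2"
    and L: "loc_solv_p e1 e2 e3 m (d1, d2, d3) p"
  shows "Legendre d1 p = 1" "Legendre d2 p = 1" "Legendre d3 p = 1"
proof -
  obtain t u1 u2 u3 where prim: "\<not> (p dvd t \<and> p dvd u1 \<and> p dvd u2 \<and> p dvd u3)"
    and D: "Dsol e1 e2 e3 m d1 d2 d3 (p ^ 2) t u1 u2 u3" using loc_solv_pD[OF L] .
  have D1: "Dsol e1 e2 e3 m d1 d2 d3 p t u1 u2 u3" using Dsol_mono[OF D] by simp
  have eq: "[a = b] (mod p)" if "p dvd e * m * t^2 + a - b" for e a b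
  proof -
    have "p dvd (e * m * t^2 + a - b) - e * m * t^2" using that m(1) by (intro dvd_diff[OF that]) auto
    then show ?thesis by (simp add: cong_iff_dvd_diff)
  qed
  have c23: "[d2 * u2^2 = d3 * u3^2] (mod p)" and c31: "[d3 * u3^2 = d1 * u1^2] (mod p)"
    using D1 eq unfolding Dsol_def by blast+
  have dvd: "p dvd d * u^2 \<longleftrightarrow> p dvd u" if "\<not> p dvd d" for d u
    using that p by (simp add: prime_dvd_mult_iff prime_dvd_power_iff)
  have eqv: "p dvd u2 \<longleftrightarrow> p dvd u3" "p dvd u3 \<longleftrightarrow> p dvd u1"
    using cong_dvd_iff[OF c23] cong_dvd_iff[OF c31] dvd d by auto
  have nu: "\<not> p dvd u1" "\<not> p dvd u2" "\<not> p dvd u3"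
  proof -
    have "\<not> p dvd u3"
    proof
      assume u3: "p dvd u3"
      then have "p^2 dvd d2 * u2^2" "p^2 dvd d3 * u3^2" using eqv by (simp_all add: dvd_power_same)
      then have "p^2 dvd e1 * m * t^2" using D unfolding Dsol_def by (metis dvd_add_left_iff dvd_diff_left_iff)
      moreover have "\<not> p dvd t" using prim u3 eqv by blast
      ultimately have "p^2 dvd e1 * m" using p
        by (metis coprime_dvd_mult_left_iff coprime_power_left_iff coprime_power_right_iff prime_imp_coprime)
      then have "p^2 dvd m" using m(3) p
        by (metis coprime_dvd_mult_right_iff coprime_power_left_iff prime_imp_coprime)
      then show False using m(2) by blast
    qed
    then show "\<not> p dvd u1" "\<not> p dvd u2" "\<not> p dvd u3" using eqv by auto
  qed
  have L: "Legendre (d * u^2) p = Legendre d p" if "\<not> p dvd u" for d u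
    using that Legendre_mult[OF p] Legendre_square_arg[OF p] by simp
  have "Legendre d2 p = Legendre d3 p" "Legendre d3 p = Legendre d1 p"
    using Legendre_cong[OF c23] Legendre_cong[OF c31] L nu by auto
  then show "Legendre d1 p = 1" "Legendre d2 p = 1" "Legendre d3 p = 1"
    using Legendre_triple[OF p d(4,1,2,3)] Legendre_values[OF d(1)] by auto
qed

text \<open>Here p | u3, and dividing the first two quadrics by p leaves congruences between t and
  u2 and between t and u1, with t a unit. The conclusion places the first two entries in the local
  class of the 2-torsion point x = 0, that is, of e2 m and -e1 m.\<close>

lemma residues_if_loc_solv_p_twist_ramified:
  assumes p: "prime p" "odd p" and m: "\<not> p dvd m'" "\<not> p dvd e1" "\<not> p dvd e2"
    and d: "\<not> p dvd d1'" "\<not> p dvd d2'" "\<not> p dvd d3"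
    and L: "loc_solv_p e1 e2 e3 (p * m') (p * d1', p * d2', d3) p"
  shows "Legendre (e2 * m' * d1') p = 1" "Legendre (- e1 * m' * d2') p = 1"
proof -
  obtain t u1 u2 u3 where prim: "\<not> (p dvd t \<and> p dvd u1 \<and> p dvd u2 \<and> p dvd u3)"
    and D: "Dsol e1 e2 e3 (p * m') (p * d1') (p * d2') d3 (p ^ 2) t u1 u2 u3" using loc_solv_pD[OF L] .
  have f: "p^2 dvd p * (e1 * m' * t^2 + d2' * u2^2) - d3 * u3^2" "p^2 dvd p * (e2 * m' * t^2 - d1' * u1^2) + d3 * u3^2"
    using D unfolding Dsol_def by (auto simp: algebra_simps)
  have "p dvd p * (e1 * m' * t^2 + d2' * u2^2) - d3 * u3^2" by (rule dvd_trans[OF _ f(1)]) simp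
  then have "p dvd d3 * u3^2" by (metis dvd_diff_right_iff dvd_triv_left)
  then have u3: "p dvd u3" using d p by (simp add: prime_dvd_mult_iff prime_dvd_power_iff)
  then have u32: "p^2 dvd d3 * u3^2" by (simp add: dvd_power_same)
  have p0: "p \<noteq> 0" using p by auto
  have "p^2 dvd p * (e1 * m' * t^2 + d2' * u2^2)" using f(1) u32 by (metis dvd_diff_left_iff)
  then have g1: "p dvd e1 * m' * t^2 + d2' * u2^2" using p0 by (simp add: power2_eq_square)
  have "p^2 dvd p * (e2 * m' * t^2 - d1' * u1^2)" using f(2) u32 by (metis dvd_add_left_iff)
  then have g2: "p dvd e2 * m' * t^2 - d1' * u1^2" using p0 by (simp add: power2_eq_square)
  have t: "\<not> p dvd t"
  proof
    assume t: "p dvd t"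
    then have tt: "p dvd e * m' * t^2" for e by (simp add: power2_eq_square)
    have "p dvd d2' * u2^2" "p dvd d1' * u1^2" using dvd_add_right_iff[OF tt[of e1]] dvd_diff_right_iff[OF tt[of e2]] g1 g2 by blast+
    then have "p dvd u2" "p dvd u1" using d p by (auto simp: prime_dvd_mult_iff prime_dvd_power_iff)
    then show False using prim t u3 by blast
  qed
  have key: "Legendre (a * b) p = 1" if "[a * t^2 = b * u^2] (mod p)" "\<not> p dvd a" "\<not> p dvd b" for a b u
  proof -
    have "\<not> p dvd a * t^2" using that(2) t p by (simp add: prime_dvd_mult_iff prime_dvd_power_iff)
    then have u: "\<not> p dvd u" using cong_dvd_iff[OF that(1)] by (auto simp: power2_eq_square)
    have "Legendre a p = Legendre b p" 
      using Legendre_cong[OF that(1)] Legendre_mult[OF p] Legendre_square_arg[OF p t] Legendre_square_arg[OF p u] by simp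
    then show ?thesis using Legendre_mult[OF p] Legendre_square[OF that(2)] by simp
  qed
  have nd: "\<not> p dvd e2 * m'" "\<not> p dvd - e1 * m'" using m p by (auto simp: prime_dvd_mult_iff)
  show "Legendre (e2 * m' * d1') p = 1"
    using g2 nd d by (intro key[of _ _ u1]) (auto simp: cong_iff_dvd_diff)
  show "Legendre (- e1 * m' * d2') p = 1"
  proof (rule key[of _ _ u2])
    have "p dvd - (e1 * m' * t^2 + d2' * u2^2)" using g1 by (simp only: dvd_minus_iff)
    moreover have "- (e1 * m' * t^2 + d2' * u2^2) = - e1 * m' * t^2 - d2' * u2^2" by simp
    ultimately show "[- e1 * m' * t^2 = d2' * u2^2] (mod p)" unfolding cong_iff_dvd_diff by argo
  qed (use nd d in auto)
qed

text \<open>The 2-torsion point x = 0 lifts to the covering: t = 1 and u3 = 0, while u1 and u2 come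
  from square roots supplied by the two residue conditions.\<close>

lemma loc_solv_p_twist_ramified:
  assumes p: "prime p" "odd p" and e: "e1 + e2 + e3 = 0"
    and L: "Legendre (e2 * m' * d1') p = 1" "Legendre (- e1 * m' * d2') p = 1"
  shows "loc_solv_p e1 e2 e3 (p * m') (p * d1', p * d2', d3) p"
proof (rule loc_solv_p_affine[OF p(1), where ?y1.0 = "e2 * (p * m')" and ?y2.0 = "- e1 * (p * m')" and ?y3.0 = 0])
  have *: "\<exists>u. [p * d * u^2 = p * y] (mod p ^ N)" if yd: "Legendre (y * d) p = 1" for d y N
  proof -
    obtain u where "[d * u^2 = y] (mod p ^ N)" using residue_times_square[OF p, of d y N] yd by (auto simp: mult.commute)
    then have "[p * (d * u^2) = p * y] (mod p ^ N)" by (rule cong_scalar_left)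
    then show ?thesis by (auto simp: mult.assoc)
  qed
  show "\<exists>u. [p * d1' * u^2 = e2 * (p * m')] (mod p ^ N)" for N using *[OF L(1)] by (simp add: ac_simps)
  show "\<exists>u. [p * d2' * u^2 = - e1 * (p * m')] (mod p ^ N)" for N using *[OF L(2)] by (simp add: ac_simps)
  show "\<exists>u. [d3 * u^2 = 0] (mod p ^ N)" for N by (intro exI[of _ 0]) simp
  show "e3 * (p * m') + e2 * (p * m') - - e1 * (p * m') = 0"
    using e by (simp add: distrib_right[symmetric])
qed auto

text \<open>Residues modulo p are squares modulo every power of p and are absorbed into the
  variables.\<close>

lemma loc_solv_p_scale:
  assumes p: "prime p" "odd p"
    and c: "Legendre c0 p = 1" "Legendre c1 p = 1" "Legendre c2 p = 1" "Legendre c3 p = 1"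
    and L: "loc_solv_p e1 e2 e3 (m * c0) (d1 * c1, d2 * c2, d3 * c3) p"
  shows "loc_solv_p e1 e2 e3 m (d1, d2, d3) p"
  unfolding loc_solv_p_iff
proof
  fix N
  have sq: "\<exists>s. [s^2 = c] (mod p ^ N) \<and> \<not> p dvd s" if "Legendre c p = 1" for c
    using that p Legendre_eq_0_iff[of c p] Legendre_eq_1_iff[of p c] by (intro square_root_mod_power) auto
  obtain s0 s1 s2 s3 where s: "[s0^2 = c0] (mod p ^ N)" "[s1^2 = c1] (mod p ^ N)" "[s2^2 = c2] (mod p ^ N)" "[s3^2 = c3] (mod p ^ N)"
    and n: "\<not> p dvd s0" "\<not> p dvd s1" "\<not> p dvd s2" "\<not> p dvd s3" using sq c by metis
  obtain t u1 u2 u3 where prim: "\<not> (p dvd t \<and> p dvd u1 \<and> p dvd u2 \<and> p dvd u3)"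
    and D: "Dsol e1 e2 e3 (m * c0) (d1 * c1) (d2 * c2) (d3 * c3) (p ^ N) t u1 u2 u3" using loc_solv_pD[OF L] .
  have key: "p ^ N dvd e * m * (s0 * t)^2 + a * (x * u)^2 - b * (y * v)^2"
    if "p ^ N dvd e * (m * c0) * t^2 + a * ca * u^2 - b * cb * v^2" "[x^2 = ca] (mod p ^ N)" "[y^2 = cb] (mod p ^ N)"
    for e a b x y u v ca cb
  proof -
    have "[e * m * t^2 * s0^2 + a * u^2 * x^2 - b * v^2 * y^2 = e * m * t^2 * c0 + a * u^2 * ca - b * v^2 * cb] (mod p ^ N)"
      using s(1) that by (intro cong_add cong_diff cong_mult cong_refl)
    moreover have "[e * m * t^2 * c0 + a * u^2 * ca - b * v^2 * cb = 0] (mod p ^ N)"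
      using that(1) by (simp add: cong_0_iff ac_simps)
    ultimately have "[e * m * t^2 * s0^2 + a * u^2 * x^2 - b * v^2 * y^2 = 0] (mod p ^ N)" by (rule cong_trans)
    then show ?thesis by (simp add: cong_0_iff power_mult_distrib ac_simps)
  qed
  have "Dsol e1 e2 e3 m d1 d2 d3 (p ^ N) (s0 * t) (s1 * u1) (s2 * u2) (s3 * u3)"
    unfolding Dsol_def using D key s unfolding Dsol_def by blast
  moreover have "\<not> (p dvd s0 * t \<and> p dvd s1 * u1 \<and> p dvd s2 * u2 \<and> p dvd s3 * u3)"
    using prim n p by (simp add: prime_dvd_mult_iff)
  ultimately show "\<exists>t u1 u2 u3. \<not> (p dvd t \<and> p dvd u1 \<and> p dvd u2 \<and> p dvd u3) \<and> Dsol e1 e2 e3 m d1 d2 d3 (p ^ N) t u1 u2 u3"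
    by blast
qed

section \<open>Multiplicative primes, the prime 2 and the real place\<close>

lemma square_product_pos:
  fixes d1 d2 d3 :: int
  assumes "d1 * d2 * d3 = s^2" "d1 \<noteq> 0" "d2 \<noteq> 0" "d3 \<noteq> 0" shows "0 < d1 * d2 * d3"
proof -
  have "d1 * d2 * d3 \<noteq> 0" using assms(2-4) by simp
  moreover have "0 \<le> d1 * d2 * d3" using assms(1) by simp
  ultimately show ?thesis by linarith
qed

lemma odd_if_square_product_odd:
  fixes d1 d2 d3 :: int
  assumes "d1 * d2 * d3 = s^2" "odd d1" "odd d2" "odd d3" shows "odd s"
proof -
  have "odd (d1 * d2 * d3)" using assms(2-4) by simp
  then show ?thesis using assms(1) by simp
qed

text \<open>Units are norms from an unramified quadratic algebra. For -1 this amounts to an x such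
  that x and D (x + 1) are both residues or 0; the weighted count of such x is
  \<open>p - Legendre D p\<close>, which is positive.\<close>

lemma exists_neg_one_norm:
  fixes p :: int
  assumes p: "prime p" "odd p" and D: "\<not> p dvd D"
  shows "\<exists>a b. [a^2 - D * b^2 = -1] (mod p ^ N)"
proof -
  define F where "F x = (1 + Legendre (x - 0) p) * (1 + Legendre D p * Legendre (x - (-1)) p)" for x
  have "F x = 1 + Legendre (x + 0) p + Legendre D p * Legendre (x + 1) p
      + Legendre D p * (Legendre (x - 0) p * Legendre (x - (-1)) p)" for x
    unfolding F_def by (simp add: algebra_simps)
  moreover have "\<not> p dvd 0 - (-1)" using p(1) not_prime_unit by auto
  ultimately have "(\<Sum>x\<in>{0..<p}. F x) = p - Legendre D p"
    using prime_gt_0_int[OF p(1)] sum_Legendre[OF p, of 0] sum_Legendre[OF p, of 1] sum_Legendre_quadratic[OF p, of 0 "-1"]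
    by (simp only: sum.distrib sum_distrib_left[symmetric]) simp
  moreover have "Legendre D p \<le> 1" "2 < p" using Legendre_le odd_prime_gt_2[OF p] by auto
  ultimately have "(\<Sum>x\<in>{0..<p}. F x) \<noteq> 0" by linarith
  then obtain x where "F x \<noteq> 0" using sum.neutral[of "{0..<p}" F] by blast
  then have f: "Legendre x p \<noteq> -1" "Legendre D p * Legendre (x + 1) p \<noteq> -1" unfolding F_def by auto
  define y where "y = (if p dvd x then 0 else if p dvd x + 1 then -1 else x)"
  have "[x = y] (mod p)" by (auto simp: y_def cong_iff_dvd_diff)
  then have c: "[x = y] (mod p)" "[x + 1 = y + 1] (mod p)" by (auto intro: cong_add)
  have f': "Legendre y p \<noteq> -1" "Legendre D p * Legendre (y + 1) p \<noteq> -1"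
    using f Legendre_cong[OF c(1)] Legendre_cong[OF c(2)] by auto
  have np: "\<not> p dvd 1" using p(1) not_prime_unit by blast
  have z: "y = 0 \<or> \<not> p dvd y" "y + 1 = 0 \<or> \<not> p dvd y + 1" using np by (auto simp: y_def)
  have "\<exists>a. [1 * a^2 = y] (mod p ^ N)"
    using z(1)
  proof
    assume "y = 0" then show ?thesis by (intro exI[of _ 0]) simp
  next
    assume "\<not> p dvd y"
    then show ?thesis using f'(1) Legendre_values[of p y] by (intro residue_times_square[OF p]) auto
  qed
  moreover have "\<exists>b. [D * b^2 = y + 1] (mod p ^ N)"
    using z(2)
  proof
    assume "y + 1 = 0" then show ?thesis by (intro exI[of _ 0]) simp
  next
    assume "\<not> p dvd y + 1"
    then show ?thesis using f'(2) Legendre_values[of p "y + 1"] Legendre_values[OF D] Legendre_mult[OF p]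
      by (intro residue_times_square[OF p]) auto
  qed
  ultimately obtain a b where "[1 * a^2 = y] (mod p ^ N)" "[D * b^2 = y + 1] (mod p ^ N)" by blast
  then have "[1 * a^2 - D * b^2 = y - (y + 1)] (mod p ^ N)" by (rule cong_diff)
  then show ?thesis by auto
qed

text \<open>If d3 is a residue, the point at infinity lifts. Otherwise d2 and d3 are both
  nonresidues, and so are x and x - e1 m for a nonresidue x, because p | e1. What remains is to find
  such an x for which x + e2 m is 0 or a residue, and a quadratic character sum counts
  these.\<close>

lemma loc_solv_p_multiplicative:
  assumes p: "prime p" "odd p" and e: "e1 + e2 + e3 = 0" "p dvd e1" "\<not> p dvd e2 * m"
    and d: "Legendre d1 p = 1" "\<not> p dvd d2" "\<not> p dvd d3" "d1 * d2 * d3 = s^2"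
  shows "loc_solv_p e1 e2 e3 m (d1, d2, d3) p"
proof (cases "Legendre d3 p = 1")
  case True
  moreover have "\<not> p dvd d1" using d(1) Legendre_eq_0_iff[of d1 p] by auto
  ultimately show ?thesis using Legendre_triple[OF p d(4) _ d(2,3)] d(1) by (intro loc_solv_p_residues[OF p]) auto
next
  case False
  then have d3: "Legendre d3 p = -1" using Legendre_values[OF d(3)] by blast
  have nd1: "\<not> p dvd d1" using d(1) Legendre_eq_0_iff[of d1 p] by auto
  have d2: "Legendre d2 p = -1"
    using Legendre_triple[OF p d(4) nd1 d(2,3)] d(1) d3 by simp
  define c where "c = e2 * m"
  define F where "F x = (1 - Legendre (x - 0) p) * (1 + Legendre (x - (- c)) p)" for x
  have p2: "2 < p" using odd_prime_gt_2[OF p] .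
  have "F x = 1 + (-1) * Legendre (x + 0) p + Legendre (x + c) p
      + (-1) * (Legendre (x - 0) p * Legendre (x - (- c)) p)" for x
    unfolding F_def by (simp add: algebra_simps)
  moreover have "\<not> p dvd 0 - (- c)" using e(3) by (simp add: c_def)
  ultimately have S: "(\<Sum>x\<in>{0..<p}. F x) = p + 1"
    using p2 sum_Legendre[OF p, of 0] sum_Legendre[OF p, of c] sum_Legendre_quadratic[OF p, of 0 "- c"]
    by (simp only: sum.distrib sum_distrib_left[symmetric]) simp
  \<comment> \<open>The value x = 0 is not a unit and must be discarded; it contributes at most 2,
    less than the total p + 1.\<close>
  have "(\<Sum>x\<in>{0..<p}. F x) = F 0 + (\<Sum>x\<in>{0..<p} - {0}. F x)" using p2 by (intro sum.remove) auto
  moreover have "F 0 \<le> 2" using Legendre_le[of c p] by (simp add: F_def Legendre_def)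
  ultimately have "(\<Sum>x\<in>{0..<p} - {0}. F x) \<noteq> 0" using S p2 by linarith
  then obtain x where x: "x \<in> {0..<p} - {0}" "F x \<noteq> 0" using sum.neutral[of "{0..<p} - {0}" F] by blast
  have nx: "\<not> p dvd x" using x(1) zdvd_not_zless by auto
  have f: "Legendre x p = -1" "Legendre (x + c) p \<noteq> -1" using x(2) Legendre_values[OF nx] by (auto simp: F_def)
  define y where "y = (if p dvd x + c then - c else x)"
  have cg: "[x = y] (mod p)" by (auto simp: y_def cong_iff_dvd_diff)
  have y: "Legendre y p = -1" using f(1) Legendre_cong[OF cg] by simp
  have "[y = y - e1 * m] (mod p)" using e(2) by (simp add: cong_iff_dvd_diff)
  then have y2: "Legendre (y - e1 * m) p = -1" using y Legendre_cong by simp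
  have y1: "y + c = 0 \<or> Legendre (y + c) p = 1"
  proof (cases "p dvd x + c")
    case True then show ?thesis by (simp add: y_def)
  next
    case False
    then show ?thesis using f(2) Legendre_values[OF False] by (simp add: y_def)
  qed
  have E: "e3 = - e1 - e2" using e(1) by simp
  show ?thesis
  proof (rule loc_solv_p_affine[OF p(1), where ?y1.0 = "y + c" and ?y2.0 = "y - e1 * m" and ?y3.0 = y])
    show "\<exists>u. [d1 * u^2 = y + c] (mod p ^ N)" for N
      using y1
    proof
      assume "y + c = 0" then show ?thesis by (intro exI[of _ 0]) simp
    next
      assume "Legendre (y + c) p = 1"
      then show ?thesis using d(1) Legendre_mult[OF p] by (intro residue_times_square[OF p]) simp
    qed
    show "\<exists>u. [d2 * u^2 = y - e1 * m] (mod p ^ N)" for N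
      using y2 d2 Legendre_mult[OF p] by (intro residue_times_square[OF p]) simp
    show "\<exists>u. [d3 * u^2 = y] (mod p ^ N)" for N
      using y d3 Legendre_mult[OF p] by (intro residue_times_square[OF p]) simp
  qed (auto simp: c_def E algebra_simps)
qed

lemma DsolI:
  assumes "e1 + e2 + e3 = 0" "M dvd e1 * m * t^2 + d2 * u2^2 - d3 * u3^2" "M dvd e2 * m * t^2 + d3 * u3^2 - d1 * u1^2"
  shows "Dsol e1 e2 e3 m d1 d2 d3 M t u1 u2 u3"
proof -
  have "e3 = - e1 - e2" using assms(1) by simp
  have "e3 * m * t^2 + d1 * u1^2 - d2 * u2^2
    = - ((e1 * m * t^2 + d2 * u2^2 - d3 * u3^2) + (e2 * m * t^2 + d3 * u3^2 - d1 * u1^2))"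
    unfolding \<open>e3 = - e1 - e2\<close> by (simp add: algebra_simps)
  then show ?thesis using assms(2,3) unfolding Dsol_def by (metis dvd_add dvd_minus_iff)
qed

text \<open>The binary form \<open>d\<^sub>2u\<^sub>2^2 - d\<^sub>3u\<^sub>3^2\<close> is, up to a factor, a norm form from an unramified algebra;
  multiplying by an element of norm \<open>-1\<close> negates it.\<close>

lemma loc_solv_p_negate_step:
  assumes p: "prime p" "odd p" and e: "e1 + e2 + e3 = 0" "p dvd e1" "\<not> p dvd e2 * m"
    and d: "\<not> p dvd d1" "d2 = w * f2" "d3 = w * f3" "\<not> p dvd f2 * f3"
    and sol: "\<not> p dvd t" "p dvd w \<or> (p dvd u2 \<and> p dvd u3)"
      "Dsol e1 e2 e3 m d1 d2 d3 (p ^ Suc N) t u1 u2 u3"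
  shows "\<exists>v1 v2 v3. Dsol e1 e2 e3 m d1 (- d2) (- d3) (p ^ N) t v1 v2 v3"
proof -
  obtain a b where ab: "[a^2 - (f2 * f3) * b^2 = -1] (mod p ^ Suc N)"
    using exists_neg_one_norm[OF p d(4)] by blast
  \<comment> \<open>Multiplication by a + b sqrt(f2 f3), an element of norm -1, written out for the
    form w (f2 X^2 - f3 Y^2).\<close>
  define v2 v3 where v: "v2 = a * u2 + b * f3 * u3" "v3 = a * u3 + b * f2 * u2"
  have D1: "p ^ Suc N dvd e1 * m * t^2 + d2 * u2^2 - d3 * u3^2" and D2: "p ^ Suc N dvd e2 * m * t^2 + d3 * u3^2 - d1 * u1^2"
    using sol(3) unfolding Dsol_def by auto
  have "- d2 * v2^2 - - d3 * v3^2 = (a^2 - (f2 * f3) * b^2) * (- (d2 * u2^2 - d3 * u3^2))"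
    unfolding v d(2,3) by (simp add: algebra_simps power2_eq_square)
  also have "[(a^2 - (f2 * f3) * b^2) * (- (d2 * u2^2 - d3 * u3^2)) = (-1) * (- (d2 * u2^2 - d3 * u3^2))] (mod p ^ Suc N)"
    using ab by (rule cong_scalar_right)
  finally have "[e1 * m * t^2 + (- d2 * v2^2 - - d3 * v3^2) = e1 * m * t^2 + (d2 * u2^2 - d3 * u3^2)] (mod p ^ Suc N)"
    by (intro cong_add cong_refl) simp
  then have "[e1 * m * t^2 + (- d2 * v2^2 - - d3 * v3^2) = 0] (mod p ^ Suc N)"
    using D1 by (metis add_diff_eq cong_0_iff cong_trans)
  then have q1: "p ^ Suc N dvd e1 * m * t^2 + - d2 * v2^2 - - d3 * v3^2"
    unfolding cong_0_iff add_diff_eq .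
  have z: "p dvd d3 * u3^2" "p dvd d3 * v3^2"
    using sol(2) d(3) unfolding v by (auto simp: power2_eq_square)
  \<comment> \<open>The value that the new u1 has to produce. Modulo p it equals the old
    \<open>d1 * u1^2\<close>, because both terms in d3 vanish there; so \<open>d1 * Y\<close> is a
    unit residue and the equation for u1 can be solved again.\<close>
  define Y where "Y = e2 * m * t^2 + - d3 * v3^2"
  have nt: "\<not> p dvd e2 * m * t^2" using e(3) sol(1) p by (simp add: prime_dvd_mult_iff prime_dvd_power_iff)
  have nY: "\<not> p dvd Y"
    unfolding Y_def using nt z(2) by (simp add: dvd_diff_left_iff)
  have "p dvd e2 * m * t^2 + d3 * u3^2 - d1 * u1^2" by (rule dvd_trans[OF _ D2]) simp
  then have "p dvd (e2 * m * t^2 + d3 * u3^2 - d1 * u1^2) - (d3 * u3^2 + d3 * v3^2)" by (rule dvd_diff[OF _ dvd_add[OF z]])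
  then have "[Y = d1 * u1^2] (mod p)" unfolding Y_def cong_iff_dvd_diff by (simp add: algebra_simps)
  then have "[d1 * Y = d1 * (d1 * u1^2)] (mod p)" by (rule cong_scalar_left)
  then have "[(d1 * u1)^2 = d1 * Y] (mod p)" by (simp add: cong_sym power2_eq_square ac_simps)
  then have "QuadRes p (d1 * Y)" unfolding QuadRes_def by blast
  then obtain v1 where "[d1 * v1^2 = Y] (mod p ^ N)" using unit_times_square_cong[OF p d(1) nY] by blast
  then have "p ^ N dvd Y - d1 * v1^2" by (simp add: cong_iff_dvd_diff dvd_diff_commute)
  then have q2: "p ^ N dvd e2 * m * t^2 + - d3 * v3^2 - d1 * v1^2" unfolding Y_def .
  have "p ^ N dvd p ^ Suc N" by simp
  then show ?thesis using DsolI[OF e(1) dvd_trans[OF _ q1] q2] by blast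
qed

text \<open>The ramified obstruction makes a and b units at p. If c is a unit and d1 a residue,
  solubility holds outright. If c is a unit and d1 a nonresidue, or if p | c, then the form in u2,
  u3 vanishes modulo p and t is a unit, which is the situation of
  \<open>loc_solv_p_negate_step\<close>.\<close>

lemma loc_solv_p_negate:
  assumes p: "prime p" "odd p" and e: "e1 + e2 + e3 = 0" "p dvd e1" "\<not> p dvd e2 * m"
    and d: "squarefree d1" "squarefree d2" "squarefree d3" "d1 * d2 * d3 = s^2"
    and L: "loc_solv_p e1 e2 e3 m (d1, d2, d3) p"
  shows "loc_solv_p e1 e2 e3 m (d1, - d2, - d3) p"
proof -
  have e3m: "\<not> p dvd e3 * m"
  proof
    assume "p dvd e3 * m"
    moreover have "e2 = - e1 - e3" using e(1) by simp
    have "e2 * m = - (e1 * m) - e3 * m" unfolding \<open>e2 = - e1 - e3\<close> by (simp add: algebra_simps)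
    ultimately show False using e(2,3) by (metis dvd_diff dvd_minus_iff dvd_mult2)
  qed
  obtain a b c where abc: "d1 = a * b" "d2 = a * c" "d3 = b * c" "coprime a b" "coprime a c" "coprime b c"
    using squarefree_triple_decompose[OF d] .
  have cop: "\<not> (p dvd x \<and> p dvd y)" if "coprime x y" for x y
    using that p by (meson coprime_common_divisor not_prime_unit)
  have L2: "loc_solv_p e3 e1 e2 m (d3, d1, d2) p" using L loc_solv_p_rotate by blast
  have na: "\<not> p dvd a"
  proof
    assume a: "p dvd a"
    then have "\<not> p dvd d3" using cop abc p by (auto simp: prime_dvd_mult_iff)
    then show False using not_loc_solv_p_ramified[OF p(1) e3m] a abc d L by auto
  qed
  have nb: "\<not> p dvd b"
  proof
    assume a: "p dvd b"
    then have "\<not> p dvd d2" using cop abc p by (auto simp: prime_dvd_mult_iff)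
    then show False using not_loc_solv_p_ramified[OF p(1) e(3)] a abc d L2 by auto
  qed
  have nd1: "\<not> p dvd d1" using na nb abc p by (simp add: prime_dvd_mult_iff)
  consider "\<not> p dvd c" "Legendre d1 p = 1" | "\<not> p dvd c" "Legendre d1 p = -1" | "p dvd c"
    using Legendre_values[OF nd1] by blast
  then show ?thesis
  proof cases
    case 1
    then have "\<not> p dvd - d2" "\<not> p dvd - d3" "d1 * (- d2) * (- d3) = s^2" using abc na nb p d(4) by (auto simp: prime_dvd_mult_iff)
    then show ?thesis using loc_solv_p_multiplicative[OF p e 1(2)] by blast
  next
    case 2
    have nd: "\<not> p dvd d2" "\<not> p dvd d3" using abc na nb p 2 by (auto simp: prime_dvd_mult_iff)
    show ?thesis unfolding loc_solv_p_iff
    proof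
      fix N
      obtain t u1 u2 u3 where prim: "\<not> (p dvd t \<and> p dvd u1 \<and> p dvd u2 \<and> p dvd u3)"
        and D: "Dsol e1 e2 e3 m d1 d2 d3 (p ^ Suc N) t u1 u2 u3" using loc_solv_pD[OF L] .
      have D1: "Dsol e1 e2 e3 m d1 d2 d3 p t u1 u2 u3" using Dsol_mono[OF D] by simp
      have "p dvd (e1 * m * t^2 + d2 * u2^2 - d3 * u3^2) - e1 * m * t^2"
        using D1 e(2) unfolding Dsol_def by (intro dvd_diff[of p "e1 * m * t^2 + d2 * u2^2 - d3 * u3^2"]) auto
      then have c: "[d2 * u2^2 = d3 * u3^2] (mod p)" by (simp add: cong_iff_dvd_diff)
      have dvd: "p dvd d2 * u2^2 \<longleftrightarrow> p dvd u2" "p dvd d3 * u3^2 \<longleftrightarrow> p dvd u3" "p dvd d1 * u1^2 \<longleftrightarrow> p dvd u1"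
        using nd nd1 p by (simp_all add: prime_dvd_mult_iff prime_dvd_power_iff)
      have eqv: "p dvd u2 \<longleftrightarrow> p dvd u3" using cong_dvd_iff[OF c] dvd by simp
      \<comment> \<open>As d1 is a nonresidue, d2 and d3 have different characters, so d2 u2^2 = d3
        u3^2 modulo p has only the zero solution.\<close>
      have u3: "p dvd u3"
      proof (rule ccontr)
        assume u3: "\<not> p dvd u3"
        then have "Legendre d2 p = Legendre d3 p"
          using Legendre_cong[OF c] eqv Legendre_mult[OF p] Legendre_square_arg[OF p] by simp
        then show False using Legendre_triple[OF p d(4) nd1 nd] 2 Legendre_values[OF nd(1)] by auto
      qed
      have "\<not> p dvd t"
      proof
        assume t: "p dvd t"
        have "p dvd e2 * m * t^2 + d3 * u3^2" using t u3 by (simp add: power2_eq_square)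
        then have "p dvd d1 * u1^2" using D1 unfolding Dsol_def by (metis dvd_diff_right_iff)
        then show False using prim t u3 eqv dvd by blast
      qed
      moreover have "\<not> p dvd d2 * d3" using nd p by (simp add: prime_dvd_mult_iff)
      ultimately show "\<exists>t u1 u2 u3. \<not> (p dvd t \<and> p dvd u1 \<and> p dvd u2 \<and> p dvd u3) \<and>
          Dsol e1 e2 e3 m d1 (- d2) (- d3) (p ^ N) t u1 u2 u3"
        using loc_solv_p_negate_step[OF p e nd1, of d2 1 d2 d3 d3 t u2 u3 N u1] D u3 eqv by auto
    qed
  next
    case 3
    then obtain c' where c': "c = p * c'" by auto
    have nc': "\<not> p dvd c'"
    proof
      assume "p dvd c'"
      then have "p^2 dvd d2" using c' abc(2) by (simp add: power2_eq_square)
      then show False using squarefreeD[OF d(2)] p(1) not_prime_unit by blast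
    qed
    show ?thesis unfolding loc_solv_p_iff
    proof
      fix N
      obtain t u1 u2 u3 where prim: "\<not> (p dvd t \<and> p dvd u1 \<and> p dvd u2 \<and> p dvd u3)"
        and D: "Dsol e1 e2 e3 m d1 d2 d3 (p ^ (N + 2)) t u1 u2 u3" using loc_solv_pD[OF L] .
      have D2: "Dsol e1 e2 e3 m d1 d2 d3 (p^2) t u1 u2 u3" using Dsol_mono[OF D] le_imp_power_dvd[of 2 "N + 2" p] by simp
      have D1: "Dsol e1 e2 e3 m d1 d2 d3 p t u1 u2 u3" using Dsol_mono[OF D2] by simp
      have "\<not> p dvd t"
      proof
        assume t: "p dvd t"
        then have tt: "p^2 dvd e * m * t^2" for e by (simp add: dvd_power_same)
        have "p dvd e2 * m * t^2 + d3 * u3^2" using t 3 abc by (simp add: power2_eq_square)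
        then have "p dvd d1 * u1^2" using D1 unfolding Dsol_def by (metis dvd_diff_right_iff)
        then have u1: "p dvd u1" using nd1 p by (simp add: prime_dvd_mult_iff prime_dvd_power_iff)
        then have uu: "p^2 dvd d1 * u1^2" by (simp add: dvd_power_same)
        have "p^2 dvd d3 * u3^2" using D2 uu tt[of e2] unfolding Dsol_def by (metis dvd_add_right_iff dvd_diff_left_iff)
        then have u3: "p dvd u3" using squarefree_dvd_mult_square p d by blast
        have "p^2 dvd d2 * u2^2" using D2 uu tt[of e3] unfolding Dsol_def by (metis dvd_add dvd_diff_right_iff)
        then have "p dvd u2" using squarefree_dvd_mult_square p d by blast
        then show False using prim t u1 u3 by blast
      qed
      moreover have nf: "\<not> p dvd (a * c') * (b * c')" using nc' na nb p by (simp add: prime_dvd_mult_iff)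
      have "Dsol e1 e2 e3 m d1 d2 d3 (p ^ Suc N) t u1 u2 u3" using Dsol_mono[OF D] by simp
      then have "\<exists>v1 v2 v3. Dsol e1 e2 e3 m d1 (- d2) (- d3) (p ^ N) t v1 v2 v3"
        using abc c' by (intro loc_solv_p_negate_step[OF p e nd1 _ _ nf \<open>\<not> p dvd t\<close>, where w = p]) auto
      ultimately show "\<exists>t u1 u2 u3. \<not> (p dvd t \<and> p dvd u1 \<and> p dvd u2 \<and> p dvd u3) \<and>
          Dsol e1 e2 e3 m d1 (- d2) (- d3) (p ^ N) t u1 u2 u3"
        by blast
    qed
  qed
qed

text \<open>All u_i are odd, since otherwise t is odd and the first quadric gives 4 | e1. As 4 | e3,
  the third quadric then makes d1 and d2 congruent modulo 4, and the odd square d1 d2 d3 is 1 modulo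
  4.\<close>

lemma d3_mod_4_if_loc_solv_2:
  assumes e: "2 dvd e1" "\<not> 4 dvd e1" "2 dvd e2" "4 dvd e3" and "odd m"
    and d: "odd d1" "odd d2" "odd d3" "d1 * d2 * d3 = s^2"
    and L: "loc_solv_p e1 e2 e3 m (d1, d2, d3) 2"
  shows "d3 mod 4 = 1"
proof -
  obtain t u1 u2 u3 where prim: "\<not> (2 dvd t \<and> 2 dvd u1 \<and> 2 dvd u2 \<and> 2 dvd u3)"
    and D: "Dsol e1 e2 e3 m d1 d2 d3 (2^2) t u1 u2 u3" using loc_solv_pD[OF L] .
  have D: "4 dvd e1 * m * t^2 + d2 * u2^2 - d3 * u3^2" "4 dvd e2 * m * t^2 + d3 * u3^2 - d1 * u1^2"
    "4 dvd e3 * m * t^2 + d1 * u1^2 - d2 * u2^2" using D unfolding Dsol_def by auto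
  have "2 dvd e1 * m * t^2 + d2 * u2^2 - d3 * u3^2" "2 dvd e2 * m * t^2 + d3 * u3^2 - d1 * u1^2"
    by (rule dvd_trans[OF _ D(1)], simp) (rule dvd_trans[OF _ D(2)], simp)
  then have par: "even u2 \<longleftrightarrow> even u3" "even u3 \<longleftrightarrow> even u1" using e d by auto
  have ev: "4 dvd d * u^2" if "even u" for d u :: int
    using that by (auto simp: power2_eq_square elim!: evenE)
  have od: "odd u1" "odd u2"
  proof -
    have "odd u1"
    proof
      assume u1: "even u1"
      then have "4 dvd d2 * u2^2" "4 dvd d3 * u3^2" using ev par by auto
      then have "4 dvd e1 * m * t^2" using D(1) by (metis dvd_add_left_iff dvd_diff_left_iff)
      moreover have "odd t" using prim u1 par by blast
      then have "coprime 4 (m * t^2)" using \<open>odd m\<close> coprime_power_left_iff[of 2 2 "m * t^2"] by simp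
      ultimately have "4 dvd e1" by (metis coprime_dvd_mult_left_iff mult.assoc)
      then show False using e(2) by blast
    qed
    then show "odd u1" "odd u2" using par by auto
  qed
  have "4 dvd e3 * m * t^2" using e(4) by simp
  then have c: "[d1 * u1^2 = d2 * u2^2] (mod 4)"
    using D(3) by (metis add_diff_eq cong_iff_dvd_diff dvd_add_right_iff)
  have sq: "[u^2 = 1] (mod 4)" if "odd u" for u :: int
  proof -
    obtain k where "u = 2 * k + 1" using \<open>odd u\<close> by (elim oddE)
    then have "u^2 - 1 = 4 * (k * k + k)" by (simp add: power2_eq_square algebra_simps)
    then show ?thesis by (simp add: cong_iff_dvd_diff)
  qed
  have "[d1 * u1^2 = d1 * 1] (mod 4)" "[d2 * u2^2 = d2 * 1] (mod 4)"
    by (rule cong_scalar_left[OF sq[OF od(1)]], rule cong_scalar_left[OF sq[OF od(2)]])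
  then have "[d1 = d2] (mod 4)" using c unfolding cong_def by simp
  then have "[d1 * d2 * d3 = d2 * d2 * d3] (mod 4)" by (intro cong_mult cong_refl)
  moreover have "[d2 * d2 * d3 = 1 * d3] (mod 4)"
    using sq[OF d(2)] by (intro cong_mult cong_refl) (simp add: power2_eq_square)
  moreover have "odd s" using odd_if_square_product_odd d by blast
  then have "[d1 * d2 * d3 = 1] (mod 4)" using sq d(4) by simp
  ultimately have "[d3 = 1] (mod 4)" by (metis cong_sym cong_trans mult_1)
  then show ?thesis by (simp add: cong_def)
qed

text \<open>Multiplying the first quadric by d3 gives the conic d2 d3 X^2 + e1 m d3 Y^2 = Z^2 with Z
  = d3 u3, and d2 d3 is d1 up to a square.\<close>

lemma hs_eq_1_if_loc_solv_p:
  assumes p: "prime p" "odd p" and nz: "e1 \<noteq> 0" "m \<noteq> 0"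
    and d: "squarefree d1" "squarefree d2" "squarefree d3" "d1 * d2 * d3 = s^2"
    and L: "loc_solv_p e1 e2 e3 m (d1, d2, d3) p"
  shows "hs p d1 (e1 * m * d3) = 1"
proof -
  have nzd: "d1 \<noteq> 0" "d2 \<noteq> 0" "d3 \<noteq> 0" using d by auto
  obtain a b c where abc: "d1 = a * b" "d2 = a * c" "d3 = b * c"
    using squarefree_triple_decompose[OF d] by metis
  \<comment> \<open>Beyond the valuation of d3, so that p^k | d3 u3 forces p | u3. With p | t as
    well, the second quadric modulo p^2 forces p | u1, against primitivity.\<close>
  define k where "k = Suc (Suc (multiplicity p d3))"
  have "hs p (d2 * d3) (e1 * m * d3) = 1"
  proof (rule hs_eq_1_if_conic_solvable[OF p, where k = k])
    fix N
    obtain t u1 u2 u3 where prim: "\<not> (p dvd t \<and> p dvd u1 \<and> p dvd u2 \<and> p dvd u3)"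
      and D: "Dsol e1 e2 e3 m d1 d2 d3 (p ^ (N + 2)) t u1 u2 u3" using loc_solv_pD[OF L] .
    have D2: "Dsol e1 e2 e3 m d1 d2 d3 (p^2) t u1 u2 u3" using Dsol_mono[OF D] le_imp_power_dvd[of 2 "N + 2" p] by simp
    have DN: "Dsol e1 e2 e3 m d1 d2 d3 (p ^ N) t u1 u2 u3" using Dsol_mono[OF D] by simp
    have "p ^ N dvd d3 * (e1 * m * t^2 + d2 * u2^2 - d3 * u3^2)" using DN unfolding Dsol_def by simp
    moreover have "d3 * (e1 * m * t^2 + d2 * u2^2 - d3 * u3^2) = d2 * d3 * u2^2 + e1 * m * d3 * t^2 - (d3 * u3)^2"
      by (simp add: algebra_simps power2_eq_square)
    ultimately have c: "[d2 * d3 * u2^2 + e1 * m * d3 * t^2 = (d3 * u3)^2] (mod p ^ N)" by (simp add: cong_iff_dvd_diff)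
    have "\<not> (p ^ k dvd u2 \<and> p ^ k dvd t \<and> p ^ k dvd d3 * u3)"
    proof
      assume a: "p ^ k dvd u2 \<and> p ^ k dvd t \<and> p ^ k dvd d3 * u3"
      have pk: "p dvd p ^ k" by (simp add: k_def)
      then have tu2: "p dvd t" "p dvd u2" using a dvd_trans by blast+
      have u3: "p dvd u3"
      proof (rule ccontr)
        assume "\<not> p dvd u3"
        then have "coprime (p ^ k) u3" using p(1) by (simp add: prime_imp_coprime)
        then have "p ^ k dvd d3" using a coprime_dvd_mult_left_iff by blast
        then have "k \<le> multiplicity p d3" using nzd p not_prime_unit by (intro multiplicity_geI) auto
        then show False by (simp add: k_def)
      qed
      have "p^2 dvd e2 * m * t^2" "p^2 dvd d3 * u3^2" using tu2 u3 by (simp_all add: dvd_power_same)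
      then have "p^2 dvd d1 * u1^2" using D2 unfolding Dsol_def by (metis dvd_add dvd_diff_right_iff)
      then have "p dvd u1" using squarefree_dvd_mult_square p d by blast
      then show False using prim tu2 u3 by blast
    qed
    then show "\<exists>x y z. \<not> (p ^ k dvd x \<and> p ^ k dvd y \<and> p ^ k dvd z) \<and> [d2 * d3 * x^2 + e1 * m * d3 * y^2 = z^2] (mod p ^ N)"
      using c by blast
  qed (use nz nzd in auto)
  moreover have "d2 * d3 = d1 * c^2" using abc by (simp add: power2_eq_square)
  moreover have "c \<noteq> 0" using abc nzd by auto
  ultimately show ?thesis using hs_square_left[OF p nzd(1)] nz nzd by simp
qed

text \<open>Symbol -1 means that d1 and e1 m d3 are negative; then d2 d3 is negative too, and d3
  times the first quadric is a negative definite form.\<close>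

lemma hs_inf_eq_1_if_loc_solv_R:
  assumes nz: "e1 \<noteq> 0" "m \<noteq> 0" "d1 \<noteq> 0" "d2 \<noteq> 0" "d3 \<noteq> 0" and s: "d1 * d2 * d3 = s^2"
    and L: "loc_solv_R e1 e2 e3 m (d1, d2, d3)"
  shows "hs_inf d1 (e1 * m * d3) = 1"
proof (rule ccontr)
  assume "hs_inf d1 (e1 * m * d3) \<noteq> 1"
  then have neg: "d1 < 0" "(e1 * m) * d3 < 0" unfolding hs_inf_def sgnc_def by (auto simp: sgn_if linorder_not_less order.strict_iff_order split: if_splits)
  have "0 < d1 * d2 * d3" using square_product_pos s nz by blast
  then have d23: "d2 * d3 < 0" using neg by (simp add: zero_less_mult_iff mult_less_0_iff mult.assoc)
  obtain t u1 u2 u3 :: real where prim: "\<not> (t = 0 \<and> u1 = 0 \<and> u2 = 0 \<and> u3 = 0)" and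
    D: "of_int (e1 * m) * t^2 + d2 * u2^2 - d3 * u3^2 = 0"
       "of_int (e2 * m) * t^2 + d3 * u3^2 - d1 * u1^2 = 0"
    using L unfolding loc_solv_R_iff by (elim exE conjE) (rule that)
  have "of_int d3 * (of_int (e1 * m) * t^2 + d2 * u2^2 - d3 * u3^2) = (0::real)" using D(1) by simp
  then have eq: "of_int (e1 * m * d3) * t^2 + of_int (d2 * d3) * u2^2 - (d3 * u3)^2 = (0::real)"
    by (simp add: algebra_simps power2_eq_square)
  have n: "of_int (e1 * m * d3) < (0::real)" "of_int (d2 * d3) < (0::real)" using neg d23 by (simp_all only: of_int_less_0_iff)
  have "of_int (e1 * m * d3) * t^2 \<le> 0" "of_int (d2 * d3) * u2^2 \<le> 0" "0 \<le> (d3 * u3)^2"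
    using n by (auto intro: mult_nonpos_nonneg simp del: of_int_mult)
  then have "of_int (e1 * m * d3) * t^2 = 0" "of_int (d2 * d3) * u2^2 = 0" "(d3 * u3)^2 = 0"
    using eq by linarith+
  then have z: "t = 0" "u2 = 0" "u3 = 0" using n nz by auto
  then have "u1 = 0" using D(2) nz by simp
  then show False using prim z by blast
qed

lemma hs_2_eq_1_by_reciprocity:
  assumes nz: "e1 \<noteq> 0" "m \<noteq> 0"
    and d: "squarefree d1" "squarefree d2" "squarefree d3" "d1 * d2 * d3 = s^2"
    and R: "loc_solv_R e1 e2 e3 m (d1, d2, d3)"
    and L: "\<And>p. prime p \<Longrightarrow> odd p \<Longrightarrow> loc_solv_p e1 e2 e3 m (d1, d2, d3) p"
  shows "hs_2 d1 (e1 * m * d3) = 1"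
proof -
  define S where "S = {p \<in> prime_factors (d1 * (e1 * m * d3)). odd p}"
  have nzd: "d1 \<noteq> 0" "d2 \<noteq> 0" "d3 \<noteq> 0" using d by auto
  have "hs_inf d1 (e1 * m * d3) * hs_2 d1 (e1 * m * d3) * (\<Prod>p\<in>S. hs p d1 (e1 * m * d3)) = 1"
    by (rule hilbert_product_formula) (use nz nzd in \<open>auto simp: S_def prime_factors_dvd\<close>)
  moreover have "(\<Prod>p\<in>S. hs p d1 (e1 * m * d3)) = 1"
    using L nz d by (intro prod.neutral ballI hs_eq_1_if_loc_solv_p) (auto simp: S_def)
  moreover have "hs_inf d1 (e1 * m * d3) = 1" using hs_inf_eq_1_if_loc_solv_R nz nzd d R by blast
  ultimately show ?thesis by simp
qed

lemma hs_2_odd_twice_odd: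
  assumes "odd a" "odd b" shows "hs_2 a (2 * b) = sgnc (chi4 a) (chi4 b) * chi8 a"
proof -
  have "multiplicity 2 (2 ^ 1 * b) = 1" "upart 2 (2 ^ 1 * b) = b"
    using assms by (intro multiplicity_upart_eqI; simp)+
  then show ?thesis using assms by (simp add: hs_2_def not_dvd_imp_multiplicity_0 upart_unit)
qed

text \<open>The three quadrics are conics with Hilbert symbols \<open>(d\<^sub>1, e\<^sub>1md\<^sub>3)\<close>, \<open>(d\<^sub>2, e\<^sub>2md\<^sub>1)\<close>, \<open>(d\<^sub>3, e\<^sub>3md\<^sub>2)\<close>, trivial away
  from 2, hence trivial at 2. For odd \<open>d\<^sub>i\<close> and \<open>d\<^sub>3 \<equiv> 1 (mod 4)\<close> the first two leave only the trivial class
  and the class of the point with \<open>x \<equiv> d\<^sub>3 (mod 8)\<close>.\<close>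

lemma loc_solv_2_by_reciprocity:
  assumes e: "e1 + e2 + e3 = 0" "2 dvd e1" "\<not> 4 dvd e1" "2 dvd e2" "\<not> 4 dvd e2" and m: "odd m"
    and sf: "squarefree d1" "squarefree d2" "squarefree d3" "d1 * d2 * d3 = s^2"
    and d: "odd d1" "odd d2" "d3 mod 4 = 1"
    and R: "loc_solv_R e1 e2 e3 m (d1, d2, d3)"
    and L: "\<And>p. prime p \<Longrightarrow> odd p \<Longrightarrow> loc_solv_p e1 e2 e3 m (d1, d2, d3) p"
  shows "loc_solv_p e1 e2 e3 m (d1, d2, d3) 2"
proof -
  obtain a1 a2 where a: "e1 = 2 * a1" "e2 = 2 * a2" using e(2,4) by (elim dvdE)
  have oa: "odd a1" "odd a2" using e(3,5) a by presburger+
  define A B where AB: "A = a1 * m" "B = a2 * m"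
  have oAB: "odd A" "odd B" using oa m AB by auto
  have eAB: "e1 * m = 2 * A" "e2 * m = 2 * B" using a AB by auto
  have od3: "odd d3" using d(3) by presburger
  have "hs_2 d1 (e1 * m * d3) = 1"
    using hs_2_eq_1_by_reciprocity[OF _ _ sf R L] a oa m by auto
  then have h1: "sgnc (chi4 d1) (chi4 A * chi4 d3) * chi8 d1 = 1"
    using hs_2_odd_twice_odd[of d1 "A * d3"] d oAB od3 eAB(1) by (simp add: mult.assoc chi4_mult)
  have "hs_2 d2 (e2 * m * d1) = 1"
  proof (rule hs_2_eq_1_by_reciprocity[OF _ _ sf(2,3,1)])
    show "loc_solv_R e2 e3 e1 m (d2, d3, d1)" using R loc_solv_R_rotate by blast
    show "loc_solv_p e2 e3 e1 m (d2, d3, d1) p" if "prime p" "odd p" for p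
      using L[OF that] loc_solv_p_rotate by blast
    show "d2 * d3 * d1 = s^2" using sf(4) by (simp add: ac_simps)
  qed (use a oa m in auto)
  then have h2: "sgnc (chi4 d2) (chi4 B * chi4 d1) * chi8 d2 = 1"
    using hs_2_odd_twice_odd[of d2 "B * d1"] d oAB eAB(2) by (simp add: mult.assoc chi4_mult)
  have c4: "chi4 x = (if x mod 8 = 1 \<or> x mod 8 = 5 then 1 else -1)" if "odd x" for x
  proof -
    have "x mod 4 = 1 \<longleftrightarrow> x mod 8 = 1 \<or> x mod 8 = 5" by presburger
    then show ?thesis using that by (simp add: chi4_def)
  qed
  have c8: "chi8 x = (if x mod 8 = 1 \<or> x mod 8 = 7 then 1 else -1)" if "odd x" for x
    using that by (simp add: chi8_def)
  have "odd s" using odd_if_square_product_odd sf(4) d od3 by blast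
  have sq8: "x^2 mod 8 = 1" if "odd x" for x :: int
  proof -
    have "x mod 8 = 1 \<or> x mod 8 = 3 \<or> x mod 8 = 5 \<or> x mod 8 = 7" using that int_odd_mod8 by blast
    moreover have "x^2 mod 8 = (x mod 8)^2 mod 8" by (simp add: power_mod)
    ultimately show ?thesis by (elim disjE) simp_all
  qed
  have "((d1 mod 8) * (d2 mod 8) * (d3 mod 8)) mod 8 = 1"
    using sq8[OF \<open>odd s\<close>] sf(4) by (metis mod_mult_left_eq mod_mult_right_eq)
  then have prod: "((d1 mod 8) * (d2 mod 8) * (d3 mod 8)) mod 8 = 1" .
  have m1: "d1 mod 8 = 1 \<or> d1 mod 8 = 3 \<or> d1 mod 8 = 5 \<or> d1 mod 8 = 7" using d int_odd_mod8 by blast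
  have m2: "d2 mod 8 = 1 \<or> d2 mod 8 = 3 \<or> d2 mod 8 = 5 \<or> d2 mod 8 = 7" using d int_odd_mod8 by blast
  have m3: "d3 mod 8 = 1 \<or> d3 mod 8 = 5" using d by presburger
  have mA: "chi4 A = 1 \<and> (2 * A) mod 8 = 2 \<or> chi4 A = -1 \<and> (2 * A) mod 8 = 6"
    using int_odd_mod4[OF oAB(1)] oAB(1) by (auto simp: chi4_def) presburger+
  have mB: "chi4 B = 1 \<and> (2 * B) mod 8 = 2 \<or> chi4 B = -1 \<and> (2 * B) mod 8 = 6"
    using int_odd_mod4[OF oAB(2)] oAB(2) by (auto simp: chi4_def) presburger+
  \<comment> \<open>The x-coordinate of the candidate 2-adic point: with t = 1 the other two values
    are \<open>x + 2 * B\<close> and \<open>x - 2 * A\<close>, and odd numbers congruent modulo 8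
    differ by a 2-adic square.\<close>
  define x where "x = d3 mod 8"
  have mods: "(x + 2 * B) mod 8 = (d3 mod 8 + (2 * B) mod 8) mod 8" "(x - 2 * A) mod 8 = (d3 mod 8 - (2 * A) mod 8) mod 8"
    unfolding x_def by (simp_all add: mod_add_right_eq mod_diff_right_eq)
  \<comment> \<open>A finite check over the residues of d1, d2, d3 modulo 8 and of A, B modulo 4,
    subject to both symbol equations and the square product.\<close>
  have "(d1 mod 8 = 1 \<and> d2 mod 8 = 1 \<and> d3 mod 8 = 1) \<or> ((x + 2 * B) mod 8 = d1 mod 8 \<and> (x - 2 * A) mod 8 = d2 mod 8)"
    using h1 h2 prod m1 m2 m3 mA mB unfolding mods c4[OF d(1)] c4[OF d(2)] c4[OF od3] c8[OF d(1)] c8[OF d(2)]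
    by (elim disjE conjE) (simp_all add: sgnc_def)
  then show ?thesis
  proof
    assume "d1 mod 8 = 1 \<and> d2 mod 8 = 1 \<and> d3 mod 8 = 1"
    then have "\<exists>u. [d1 * u^2 = 1] (mod 2 ^ N)" "\<exists>u. [d2 * u^2 = 1] (mod 2 ^ N)" "\<exists>u. [d3 * u^2 = 1] (mod 2 ^ N)" for N
      using unit_times_square_cong_2[of d1 1 N] unit_times_square_cong_2[of d2 1 N] unit_times_square_cong_2[of d3 1 N] by auto
    then show ?thesis by (intro loc_solv_p_infinity) auto
  next
    assume y: "(x + 2 * B) mod 8 = d1 mod 8 \<and> (x - 2 * A) mod 8 = d2 mod 8"
    have sol: "\<exists>u. [d * u^2 = y] (mod 2 ^ N)" if "y mod 8 = d mod 8" "odd d" for d y :: int and N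
    proof -
      have "(d * y) mod 8 = (d^2) mod 8" using that(1) by (metis mod_mult_right_eq power2_eq_square)
      then show ?thesis using sq8[OF that(2)] unit_times_square_cong_2 by metis
    qed
    have E: "e3 = - e1 - e2" using e(1) by simp
    show ?thesis
      by (rule loc_solv_p_affine[where ?y1.0 = "x + 2 * B" and ?y2.0 = "x - 2 * A" and ?y3.0 = x])
        (use sol y d od3 eAB in \<open>auto simp: x_def E left_diff_distrib\<close>)
  qed
qed

text \<open>If d1 < 0, then d2 and d3 have opposite signs, and the second quadric (for d3 > 0) or
  the third (for d2 > 0) is definite.\<close>

lemma loc_solv_R_imp_pos:
  assumes "0 < e2" "e3 < 0" "0 < m" "d1 * d2 * d3 = s^2" "d1 \<noteq> 0" "d2 \<noteq> 0" "d3 \<noteq> 0"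
    and L: "loc_solv_R e1 e2 e3 m (d1, d2, d3)"
  shows "0 < d1"
proof (rule ccontr)
  assume "\<not> 0 < d1"
  then have d1: "d1 < 0" using assms by simp
  obtain t u1 u2 u3 :: real where prim: "\<not> (t = 0 \<and> u1 = 0 \<and> u2 = 0 \<and> u3 = 0)" and
    D: "of_int (e2 * m) * t^2 + d3 * u3^2 - d1 * u1^2 = 0"
       "of_int (e3 * m) * t^2 + d1 * u1^2 - d2 * u2^2 = 0"
    using L unfolding loc_solv_R_iff by (elim exE conjE) (rule that)
  have "0 < d1 * d2 * d3" using square_product_pos assms by blast
  then have "d2 * d3 < 0" using d1 by (simp add: mult.assoc zero_less_mult_iff)
  then have "0 < d2 \<or> 0 < d3" by (auto simp: mult_less_0_iff)
  have c1: "(0::real) < of_int (e2 * m)" and c2: "of_int (e3 * m) < (0::real)"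
    using assms by (simp_all add: zero_less_mult_iff mult_less_0_iff)
  have z: "x = 0 \<and> y = 0 \<and> w = 0" if "a * x^2 + b * y^2 + c * w^2 = 0" "0 < a" "0 < b" "0 < c" for a b c x y w :: real
  proof -
    have "0 \<le> a * x^2" "0 \<le> b * y^2" "0 \<le> c * w^2" using that by auto
    then have "a * x^2 = 0" "b * y^2 = 0" "c * w^2 = 0" using that(1) by linarith+
    then show ?thesis using that by auto
  qed
  show False
  proof (cases "0 < d3")
    case True
    have "t = 0 \<and> u3 = 0 \<and> u1 = 0"
      using z[of "of_int (e2 * m)" t "of_int d3" u3 "- of_int d1" u1] D(1) c1 True d1 by simp
    then show False using D(2) prim assms by auto
  next
    case False
    then have "0 < d2" using \<open>0 < d2 \<or> 0 < d3\<close> by blast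
    have "t = 0 \<and> u1 = 0 \<and> u2 = 0"
      using z[of "- of_int (e3 * m)" t "- of_int d1" u1 "of_int d2" u2] D(2) c2 \<open>0 < d2\<close> d1 by simp
    then show False using D(1) prim assms by auto
  qed
qed

lemma loc_solv_R_if_pos:
  assumes "0 < d1" "0 < d2" "0 < d3" shows "loc_solv_R e1 e2 e3 m (d1, d2, d3)"
  unfolding loc_solv_R_iff
proof (intro exI conjI)
  show "\<not> ((0::real) = 0 \<and> 1 / sqrt d1 = 0 \<and> 1 / sqrt d2 = 0 \<and> 1 / sqrt d3 = 0)" using assms by simp
qed (use assms in \<open>auto simp: power_divide\<close>)

text \<open>If d2 and d3 are negative, the 2-torsion point x = -e2 m lifts: t = 1, u1 = 0, and the
  values e3 m and -e2 m are negative like d2 and d3.\<close>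

lemma loc_solv_R_if_d1_pos:
  assumes e: "0 < e2" "e3 < 0" "0 < m" "e1 + e2 + e3 = 0" and d: "d1 * d2 * d3 = s^2" "0 < d1" "d2 \<noteq> 0" "d3 \<noteq> 0"
  shows "loc_solv_R e1 e2 e3 m (d1, d2, d3)"
proof (cases "0 < d2")
  case True
  have "0 < d1 * (d2 * d3)" using square_product_pos[OF d(1)] d(2-4) by (simp add: mult.assoc)
  then have "0 < d3" using d(2) True by (simp add: zero_less_mult_iff)
  then show ?thesis using loc_solv_R_if_pos d True by blast
next
  case False
  have "0 < d1 * (d2 * d3)" using square_product_pos[OF d(1)] d(2-4) by (simp add: mult.assoc)
  then have neg: "d2 < 0" "d3 < 0" using d(2) False by (auto simp: zero_less_mult_iff)
  have E: "e1 = - e2 - e3" using e(4) by simp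
  have k: "real_of_int e3 * m \<le> 0" "- real_of_int e2 * m \<le> 0" using e by (simp_all add: mult_le_0_iff)
  have "0 \<le> real_of_int e3 * m / d2" "0 \<le> - real_of_int e2 * m / d3"
    by (rule divide_nonpos_neg[OF k(1)], use neg in simp) (rule divide_nonpos_neg[OF k(2)], use neg in simp)
  then have s: "d2 * (sqrt (e3 * m / d2))^2 = e3 * m" "d3 * (sqrt (- e2 * m / d3))^2 = - e2 * m"
    using neg by simp_all
  show ?thesis unfolding loc_solv_R_iff
    by (rule exI[of _ 1], rule exI[of _ 0], rule exI[of _ "sqrt (e3 * m / d2)"], rule exI[of _ "sqrt (- e2 * m / d3)"])
      (use s in \<open>simp add: E algebra_simps\<close>)
qed

lemma loc_solv_R_scale:
  assumes c: "0 < c0" "0 < c1" "0 < c2" "0 < c3"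
    and L: "loc_solv_R e1 e2 e3 (m * c0) (d1 * c1, d2 * c2, d3 * c3)"
  shows "loc_solv_R e1 e2 e3 m (d1, d2, d3)"
proof -
  obtain t u1 u2 u3 :: real where prim: "\<not> (t = 0 \<and> u1 = 0 \<and> u2 = 0 \<and> u3 = 0)" and
    D: "of_int (e1 * (m * c0)) * t^2 + of_int (d2 * c2) * u2^2 - of_int (d3 * c3) * u3^2 = 0"
       "of_int (e2 * (m * c0)) * t^2 + of_int (d3 * c3) * u3^2 - of_int (d1 * c1) * u1^2 = 0"
       "of_int (e3 * (m * c0)) * t^2 + of_int (d1 * c1) * u1^2 - of_int (d2 * c2) * u2^2 = 0"
    using L unfolding loc_solv_R_iff by (elim exE conjE) (rule that)
  show ?thesis unfolding loc_solv_R_iff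
  proof (intro exI conjI)
    show "\<not> (sqrt c0 * t = 0 \<and> sqrt c1 * u1 = 0 \<and> sqrt c2 * u2 = 0 \<and> sqrt c3 * u3 = 0)" using prim c by auto
  qed (use D c in \<open>simp_all add: power_mult_distrib ac_simps\<close>)
qed

section \<open>Selmer groups and torsion\<close>

lemma Sel2_iff:
  "(d1, d2, d3) \<in> Sel2 e1 e2 e3 m \<longleftrightarrow>
     squarefree d1 \<and> squarefree d2 \<and> squarefree d3 \<and> (\<exists>s. d1 * d2 * d3 = s^2) \<and>
     loc_solv_R e1 e2 e3 m (d1, d2, d3) \<and> (\<forall>p. prime p \<longrightarrow> loc_solv_p e1 e2 e3 m (d1, d2, d3) p)"
  unfolding Sel2_def by auto

lemma Sel2_rotate: "(d1, d2, d3) \<in> Sel2 e1 e2 e3 m \<longleftrightarrow> (d2, d3, d1) \<in> Sel2 e2 e3 e1 m"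
proof -
  have "d1 * d2 * d3 = d2 * d3 * d1" by (simp add: ac_simps)
  then show ?thesis
    unfolding Sel2_iff loc_solv_R_rotate[of e1] loc_solv_p_rotate[of e1] by metis
qed

lemma square_factor_cancel:
  fixes x y z :: int assumes "x * y^2 = z^2" "y \<noteq> 0" obtains w where "x = w^2"
proof -
  have "y dvd z" using assms(1) by (metis dvd_triv_right pow_divides_pow_iff zero_less_numeral)
  then obtain w where "z = y * w" by auto
  then have "x = w^2" using assms by (simp add: power_mult_distrib)
  then show ?thesis using that by blast
qed

lemma Sel2_translate:
  assumes e: "e1 \<noteq> 0" "e2 \<noteq> 0" "m \<noteq> 0" "e1 + e2 + e3 = 0" and L: "(d1, d2, d3) \<in> Sel2 e1 e2 e3 m"
  shows "(sqf (d1 * (e2 * m)), sqf (d2 * (- e1 * m)), sqf (d3 * (- e1 * e2))) \<in> Sel2 e1 e2 e3 m"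
proof -
  obtain s where sf: "squarefree d1" "squarefree d2" "squarefree d3" "d1 * d2 * d3 = s^2"
    and R: "loc_solv_R e1 e2 e3 m (d1, d2, d3)" and P: "\<And>p. prime p \<Longrightarrow> loc_solv_p e1 e2 e3 m (d1, d2, d3) p"
    using L unfolding Sel2_iff by blast
  have nz: "d1 \<noteq> 0" "d2 \<noteq> 0" "d3 \<noteq> 0" using sf by auto
  then have s0: "s \<noteq> 0" using sf(4) by auto
  have "d1 dvd s" "d2 dvd s" using sf by (metis dvd_triv_left squarefree_dvd_square mult.commute mult.assoc)+
  then obtain r1 r2 where r: "s = d1 * r1" "s = d2 * r2" unfolding dvd_def by blast
  have nz': "d1 * (e2 * m) \<noteq> 0" "d2 * (- e1 * m) \<noteq> 0" "d3 * (- e1 * e2) \<noteq> 0" using nz e by auto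
  define d1' d2' d3' where d': "d1' = sqf (d1 * (e2 * m))" "d2' = sqf (d2 * (- e1 * m))" "d3' = sqf (d3 * (- e1 * e2))"
  obtain s1 where s1: "d1 * (e2 * m) = d1' * s1^2" "s1 \<noteq> 0" using sqf_decompose[OF nz'(1)] unfolding d' .
  obtain s2 where s2: "d2 * (- e1 * m) = d2' * s2^2" "s2 \<noteq> 0" using sqf_decompose[OF nz'(2)] unfolding d' .
  obtain s3 where s3: "d3 * (- e1 * e2) = d3' * s3^2" "s3 \<noteq> 0" using sqf_decompose[OF nz'(3)] unfolding d' .
  interpret translation e1 e2 e3 m d1 d2 d3 d1' d2' d3' s r1 r2 s1 s2 s3
    by unfold_locales (use e nz s0 sf r s1 s2 s3 in \<open>auto simp: ac_simps\<close>)
  have "(d1' * d2' * d3') * (s1 * s2 * s3)^2 = (d1' * s1^2) * (d2' * s2^2) * (d3' * s3^2)"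
    by (simp add: power_mult_distrib ac_simps)
  also have "\<dots> = (d1 * d2 * d3) * (e1 * e2 * m)^2"
    unfolding s1(1)[symmetric] s2(1)[symmetric] s3(1)[symmetric] by (simp add: power2_eq_square ac_simps)
  also have "\<dots> = (s * (e1 * e2 * m))^2" unfolding sf(4) by (simp add: power_mult_distrib)
  finally obtain w where "d1' * d2' * d3' = w^2" using s1(2) s2(2) s3(2) by (auto elim: square_factor_cancel)
  moreover have "squarefree d1'" "squarefree d2'" "squarefree d3'" unfolding d' using nz' squarefree_sqf by auto
  ultimately have "(d1', d2', d3') \<in> Sel2 e1 e2 e3 m"
    unfolding Sel2_iff using loc_solv_R_translate[OF R] loc_solv_p_translate P by blast
  then show ?thesis unfolding d' .
qed

lemma trip_mul_sqf_trip:
  assumes "a \<noteq> 0" "b \<noteq> 0" "c \<noteq> 0" "d1 \<noteq> 0" "d2 \<noteq> 0" "d3 \<noteq> 0"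
  shows "trip_mul (d1, d2, d3) (sqf_trip a b c) = (sqf (d1 * a), sqf (d2 * b), sqf (d3 * c))"
  using assms sqf_mult_sqf_left[of a d1] sqf_mult_sqf_left[of b d2] sqf_mult_sqf_left[of c d3]
  by (simp add: trip_mul_def sqf_trip_def mult.commute)

text \<open>Translation is available for the point x = 0; the cyclic symmetry moves each of the
  other two points of order 2 into that position.\<close>

lemma Sel2_tors_closed:
  assumes e: "e1 \<noteq> 0" "e2 \<noteq> 0" "e3 \<noteq> 0" "m \<noteq> 0" "e1 + e2 + e3 = 0"
    and L: "(d1, d2, d3) \<in> Sel2 e1 e2 e3 m" and T: "T \<in> tors_img e1 e2 e3 m"
  shows "trip_mul (d1, d2, d3) T \<in> Sel2 e1 e2 e3 m"
proof -
  have nz: "d1 \<noteq> 0" "d2 \<noteq> 0" "d3 \<noteq> 0" and sf: "squarefree d1" "squarefree d2" "squarefree d3"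
    using L by (auto simp: Sel2_iff)
  have r: "(d2, d3, d1) \<in> Sel2 e2 e3 e1 m" "(d3, d1, d2) \<in> Sel2 e3 e1 e2 m" using L Sel2_rotate by blast+
  have e': "e2 + e3 + e1 = 0" "e3 + e1 + e2 = 0" using e(5) by auto
  consider "T = (1, 1, 1)" | "T = sqf_trip (- e3*m) (- e1*e3) (e1*m)" | "T = sqf_trip (- e2*e3) (e3*m) (- e2*m)"
    | "T = sqf_trip (e2*m) (- e1*m) (- e1*e2)" using T unfolding tors_img_def by blast
  then show ?thesis
  proof cases
    case 1
    then show ?thesis using L sf by (simp add: trip_mul_def sqf_of_squarefree)
  next
    case 2
    have "(sqf (d3 * (e1 * m)), sqf (d1 * (- e3 * m)), sqf (d2 * (- e3 * e1))) \<in> Sel2 e3 e1 e2 m"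
      using Sel2_translate[OF e(3,1,4) e'(2) r(2)] .
    then have "(sqf (d1 * (- e3 * m)), sqf (d2 * (- e3 * e1)), sqf (d3 * (e1 * m))) \<in> Sel2 e1 e2 e3 m"
      using Sel2_rotate by blast
    then show ?thesis unfolding 2 using e nz by (simp add: trip_mul_sqf_trip mult.commute)
  next
    case 3
    have "(sqf (d2 * (e3 * m)), sqf (d3 * (- e2 * m)), sqf (d1 * (- e2 * e3))) \<in> Sel2 e2 e3 e1 m"
      using Sel2_translate[OF e(2,3,4) e'(1) r(1)] .
    then have "(sqf (d1 * (- e2 * e3)), sqf (d2 * (e3 * m)), sqf (d3 * (- e2 * m))) \<in> Sel2 e1 e2 e3 m"
      using Sel2_rotate by blast
    then show ?thesis unfolding 3 using e nz by (simp add: trip_mul_sqf_trip)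
  next
    case 4
    then show ?thesis using Sel2_translate[OF e(1,2,4,5) L] e nz by (simp add: trip_mul_sqf_trip)
  qed
qed

lemma one_in_Sel2: "(1, 1, 1) \<in> Sel2 e1 e2 e3 m"
proof -
  have "\<exists>u. [1 * u^2 = 1] (mod p ^ N)" for p :: int and N by (intro exI[of _ 1]) simp
  then show ?thesis unfolding Sel2_iff using loc_solv_R_if_pos[of 1 1 1] loc_solv_p_infinity[of _ 1 1 1]
    by (auto intro: exI[of _ 1])
qed

lemma tors_img_subset_Sel2:
  assumes e: "e1 \<noteq> 0" "e2 \<noteq> 0" "e3 \<noteq> 0" "m \<noteq> 0" "e1 + e2 + e3 = 0"
  shows "tors_img e1 e2 e3 m \<subseteq> Sel2 e1 e2 e3 m"
proof
  fix T assume T: "T \<in> tors_img e1 e2 e3 m"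
  have "trip_mul (1, 1, 1) (sqf_trip a b c) = sqf_trip a b c" if "a \<noteq> 0" "b \<noteq> 0" "c \<noteq> 0" for a b c
    using trip_mul_sqf_trip[OF that, of 1 1 1] by (simp add: sqf_trip_def)
  moreover have "trip_mul (1, 1, 1) (1, 1, 1) = (1, 1, 1)" by (simp add: trip_mul_def sqf_of_squarefree)
  ultimately have "trip_mul (1, 1, 1) T = T" using T e unfolding tors_img_def by auto
  then show "T \<in> Sel2 e1 e2 e3 m" using Sel2_tors_closed[OF e one_in_Sel2 T] by simp
qed

text \<open>Parity of the 2-adic valuation, an invariant of the square class; it alone tells the
  torsion classes apart.\<close>

definition odd_val :: "int \<Rightarrow> bool" where "odd_val a \<longleftrightarrow> odd (multiplicity 2 a)"

lemma odd_val_mult: "a \<noteq> 0 \<Longrightarrow> b \<noteq> 0 \<Longrightarrow> odd_val (a * b) \<longleftrightarrow> odd_val a \<noteq> odd_val b"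
  unfolding odd_val_def by (simp add: multiplicity_mult_prime)

lemma odd_val_minus: "odd_val (- a) \<longleftrightarrow> odd_val a" unfolding odd_val_def by simp

lemma odd_val_odd: "odd a \<Longrightarrow> \<not> odd_val a"
  unfolding odd_val_def by (simp add: not_dvd_imp_multiplicity_0)

lemma odd_val_squarefree: "squarefree d \<Longrightarrow> odd_val d \<longleftrightarrow> even d"
proof (cases "even d")
  case True
  assume sf: "squarefree d"
  then have "d \<noteq> 0" by auto
  then have "multiplicity 2 d \<le> 1" using sf squarefree_factorial_semiring''[of d] by auto
  moreover have "multiplicity 2 d \<ge> 1" using True \<open>d \<noteq> 0\<close> by (intro multiplicity_geI) auto
  ultimately have "multiplicity 2 d = 1" by linarith
  then show ?thesis using True by (simp add: odd_val_def)
qed (simp add: odd_val_odd)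

lemma even_sqf_iff: "a \<noteq> 0 \<Longrightarrow> even (sqf a) \<longleftrightarrow> odd_val a"
proof -
  assume a: "a \<noteq> 0"
  obtain r where r: "a = sqf a * r^2" "r \<noteq> 0" using sqf_decompose[OF a] .
  have "odd_val (sqf a * r^2) \<longleftrightarrow> odd_val (sqf a)"
    using odd_val_mult[of "sqf a" "r^2"] odd_val_mult[of r r] r(2) sqf_nonzero[OF a] by (simp add: power2_eq_square)
  then show ?thesis using r(1) odd_val_squarefree[OF squarefree_sqf[OF a]] by simp
qed

lemma odd_val_two_mod_four: "2 dvd e \<Longrightarrow> \<not> 4 dvd e \<Longrightarrow> odd_val e"
proof -
  assume "2 dvd e" "\<not> 4 dvd e"
  then obtain k where k: "e = 2 * k" by (elim dvdE)
  then have "odd k" using \<open>\<not> 4 dvd e\<close> by presburger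
  moreover have "e = 2 ^ 1 * k" using k by simp
  ultimately have "multiplicity 2 e = 1" using multiplicity_upart_eqI(1)[of 2 k 1] by simp
  then show ?thesis by (simp add: odd_val_def)
qed

text \<open>Used both for m = 1 and for m = n. Of the conditions on e1 and e2 at 2, only the odd
  valuations are retained.\<close>

locale two_torsion =
  fixes e1 e2 e3 m :: int
  assumes e_nz: "e1 \<noteq> 0" "e2 \<noteq> 0" "e3 \<noteq> 0" and e_sum: "e1 + e2 + e3 = 0"
    and e_val: "odd_val e1" "odd_val e2" and m_odd: "odd m"
begin

lemma m_nz: "m \<noteq> 0" using m_odd by auto

text \<open>With v the parity of the valuation of e3, the nontrivial classes have parity vectors (v,
  1 + v, 1), (1 + v, v, 1) and (1, 1, 0). Together with (0, 0, 0) these are all vectors of even sum.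
  Triples with square product have even parity sum, so exactly one torsion class makes such a triple
  odd.\<close>

lemma tors_odd_val:
  "odd_val (- e3 * m) \<longleftrightarrow> odd_val e3" "odd_val (- e1 * e3) \<longleftrightarrow> \<not> odd_val e3" "odd_val (e1 * m)"
  "odd_val (- e2 * e3) \<longleftrightarrow> \<not> odd_val e3" "odd_val (e3 * m) \<longleftrightarrow> odd_val e3" "odd_val (- e2 * m)"
  "odd_val (e2 * m)" "odd_val (- e1 * m)" "\<not> odd_val (- e1 * e2)"
  using e_nz m_nz e_val odd_val_odd[OF m_odd] by (auto simp: odd_val_mult odd_val_minus)

lemma tors_odd_imp_one:
  assumes "(t1, t2, t3) \<in> tors_img e1 e2 e3 m" "odd t1" "odd t2" "odd t3"
  shows "(t1, t2, t3) = (1, 1, 1)"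
proof -
  have "even (sqf (e1 * m))" "even (sqf (- e2 * m))" "even (sqf (e2 * m))"
    using tors_odd_val e_nz m_nz by (auto simp: even_sqf_iff)
  then show ?thesis using assms unfolding tors_img_def sqf_trip_def by auto
qed

lemma card_tors_img: "card (tors_img e1 e2 e3 m) = 4"
proof -
  let ?T1 = "sqf_trip (- e3*m) (- e1*e3) (e1*m)" and ?T2 = "sqf_trip (- e2*e3) (e3*m) (- e2*m)"
    and ?T3 = "sqf_trip (e2*m) (- e1*m) (- e1*e2)"
  have ev: "even (sqf (e1 * m))" "even (sqf (- e2 * m))" "even (sqf (e2 * m))" "odd (sqf (- e1 * e2))"
    "even (sqf (- e3 * m)) \<longleftrightarrow> odd_val e3" "even (sqf (- e2 * e3)) \<longleftrightarrow> \<not> odd_val e3"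
    using tors_odd_val e_nz m_nz by (auto simp: even_sqf_iff)
  have "?T1 \<noteq> ?T2" using ev(5,6) unfolding sqf_trip_def by (auto simp del: mult_minus_left)
  moreover have "?T1 \<noteq> ?T3" "?T2 \<noteq> ?T3" "(1, 1, 1) \<noteq> ?T1" "(1, 1, 1) \<noteq> ?T2" "(1, 1, 1) \<noteq> ?T3"
    using ev(1-4) odd_one unfolding sqf_trip_def by (metis prod.inject)+
  ultimately show ?thesis unfolding tors_img_def by simp
qed

lemma exists_odd_translate:
  assumes L: "(d1, d2, d3) \<in> Sel2 e1 e2 e3 m"
  obtains T c1 c2 c3 where "T \<in> tors_img e1 e2 e3 m" "trip_mul (d1, d2, d3) T = (c1, c2, c3)"
    "odd c1" "odd c2" "odd c3"
proof -
  obtain s where sf: "squarefree d1" "squarefree d2" "squarefree d3" "d1 * d2 * d3 = s^2"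
    using L unfolding Sel2_iff by blast
  have nz: "d1 \<noteq> 0" "d2 \<noteq> 0" "d3 \<noteq> 0" using sf by auto
  obtain a b c where abc: "d1 = a * b" "d2 = a * c" "d3 = b * c" "coprime a b" "coprime a c" "coprime b c"
    using squarefree_triple_decompose[OF sf] .
  have "\<not> (even a \<and> even b)" "\<not> (even a \<and> even c)" "\<not> (even b \<and> even c)"
    using abc coprime_common_divisor[of _ _ 2] odd_one by blast+
  then have pat: "odd d1 \<and> odd d2 \<and> odd d3 \<or> even d1 \<and> even d2 \<and> odd d3 \<or> odd d1 \<and> even d2 \<and> even d3 \<or> even d1 \<and> odd d2 \<and> even d3"
    unfolding abc by auto
  have ev: "even (sqf (d * x)) \<longleftrightarrow> even d \<noteq> odd_val x" if "squarefree d" "x \<noteq> 0" for d x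
  proof -
    have "d \<noteq> 0" using that by auto
    then show ?thesis using that by (simp add: even_sqf_iff odd_val_mult odd_val_squarefree)
  qed
  let ?T1 = "sqf_trip (- e3*m) (- e1*e3) (e1*m)" and ?T2 = "sqf_trip (- e2*e3) (e3*m) (- e2*m)"
    and ?T3 = "sqf_trip (e2*m) (- e1*m) (- e1*e2)"
  have mem: "(1, 1, 1) \<in> tors_img e1 e2 e3 m" "?T1 \<in> tors_img e1 e2 e3 m" "?T2 \<in> tors_img e1 e2 e3 m" "?T3 \<in> tors_img e1 e2 e3 m"
    unfolding tors_img_def by auto
  have nzt: "- e3 * m \<noteq> 0" "- e1 * e3 \<noteq> 0" "e1 * m \<noteq> 0" "- e2 * e3 \<noteq> 0" "e3 * m \<noteq> 0" "- e2 * m \<noteq> 0"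
    "e2 * m \<noteq> 0" "- e1 * m \<noteq> 0" "- e1 * e2 \<noteq> 0" using e_nz m_nz by auto
  consider (0) "odd d1" "odd d2" "odd d3" | (3) "even d1" "even d2" "odd d3"
    | (1) "even d1 \<longleftrightarrow> odd_val e3" "even d2 \<longleftrightarrow> \<not> odd_val e3" "even d3"
    | (2) "even d1 \<longleftrightarrow> \<not> odd_val e3" "even d2 \<longleftrightarrow> odd_val e3" "even d3"
    using pat by blast
  then show ?thesis
  proof cases
    case 0
    then show ?thesis using that[OF mem(1)] sf by (simp add: trip_mul_def sqf_of_squarefree)
  next
    case 1
    show ?thesis by (rule that[OF mem(2) trip_mul_sqf_trip[OF nzt(1,2,3) nz]])
      (use 1 ev sf nzt tors_odd_val in blast)+
  next
    case 2
    show ?thesis by (rule that[OF mem(3) trip_mul_sqf_trip[OF nzt(4,5,6) nz]])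
      (use 2 ev sf nzt tors_odd_val in blast)+
  next
    case 3
    show ?thesis by (rule that[OF mem(4) trip_mul_sqf_trip[OF nzt(7,8,9) nz]])
      (use 3 ev sf nzt tors_odd_val in blast)+
  qed
qed

end

section \<open>The twist by n: residues, signs and removal of the n-part\<close>

locale twist =
  fixes e1 e2 e3 n :: int
  assumes e_nz: "e1 \<noteq> 0" "e2 \<noteq> 0" "e3 \<noteq> 0" and e_sum: "e1 + e2 + e3 = 0"
    and e_mod: "2 dvd e1" "\<not> 4 dvd e1" "2 dvd e2" "\<not> 4 dvd e2" "4 dvd e3"
    and n: "n > 0" "odd n" "squarefree n" "coprime n (e1 * e2 * e3)"
    and res: "\<forall>p\<in>prime_factors n. \<forall>q::int. prime q \<and> odd q \<and> q dvd e1 * e2 * e3 \<longrightarrow> QuadRes q p"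
    and sign: "(e2 > 0 \<and> e3 < 0) \<or> (\<forall>p\<in>prime_factors n. [p = 1] (mod 4))"
    and star: "\<forall>p\<in>prime_factors n. \<forall>q::int. prime q \<and> odd q \<and> q dvd e2 * e3 \<longrightarrow>
           Legendre ((-1) ^ nat ((p - 1) div 2) * p) q = 1"
    and card_Sel2: "card (Sel2 e1 e2 e3 1) = 4"

sublocale twist \<subseteq> T1: two_torsion e1 e2 e3 1
  using e_nz e_sum e_mod by unfold_locales (auto intro: odd_val_two_mod_four)

sublocale twist \<subseteq> Tn: two_torsion e1 e2 e3 n
  using n(2) e_nz e_sum e_mod by unfold_locales (auto intro: odd_val_two_mod_four)

context twist begin

text \<open>The torsion image has four elements and lies inside a Selmer group with four
  elements.\<close>

lemma Sel2_1_eq: "Sel2 e1 e2 e3 1 = tors_img e1 e2 e3 1"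
proof -
  have "finite (Sel2 e1 e2 e3 1)" using card_Sel2 by (simp add: card_ge_0_finite)
  then show ?thesis
    using card_subset_eq[of "Sel2 e1 e2 e3 1" "tors_img e1 e2 e3 1"] tors_img_subset_Sel2[of e1 e2 e3 1] e_nz e_sum
      T1.card_tors_img card_Sel2 by simp
qed

lemma not_dvd_n: "prime q \<Longrightarrow> q dvd e1 * e2 * e3 \<Longrightarrow> \<not> q dvd n"
  using n(4) by (meson coprime_common_divisor not_prime_unit)

lemma Legendre_divisor_n:
  assumes q: "prime q" "odd q" "q dvd e1 * e2 * e3"
  shows "g dvd n \<Longrightarrow> 0 < g \<Longrightarrow> Legendre g q = 1"
proof (induction g rule: prime_divisors_induct)
  case (unit x)
  then have "x = 1" by auto
  then show ?case using Legendre_1 q by simp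
next
  case (factor p x)
  have p: "p dvd n" "x dvd n" using factor.prems(1) by (auto dest: dvd_mult_left dvd_mult_right)
  have "0 < x" using factor.prems(2) prime_gt_0_int[OF factor.hyps(1)] by (simp add: zero_less_mult_iff)
  moreover have "p \<in> prime_factors n" using p n factor.hyps by (auto simp: prime_factors_dvd)
  then have "QuadRes q p" using res q by blast
  moreover have "\<not> q dvd p" using not_dvd_n[OF q(1,3)] p dvd_trans by blast
  ultimately show ?case using factor.IH p Legendre_mult[OF q(1,2)] Legendre_eq_1_iff[of q p] by simp
qed auto

lemma Legendre_minus_1_eq_1:
  assumes q: "prime q" "odd q" "q dvd e2 * e3" and p: "p \<in> prime_factors n" "p mod 4 \<noteq> 1"
  shows "Legendre (-1) q = 1"
proof -
  have pn: "prime p" "p dvd n" using p by (auto simp: prime_factors_dvd)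
  then have op: "odd p" "prime p" "p dvd n" "0 < p" using n(2) prime_gt_0_int[OF pn(1)] dvd_trans by auto
  have "odd ((p - 1) div 2)" using op(1) p(2) by presburger
  then have "odd (nat ((p - 1) div 2))" using op by (simp add: even_nat_iff)
  then have "Legendre (- 1 * p) q = 1" using star p(1) q by auto
  moreover have "q dvd e1 * e2 * e3" using q(3) by (metis dvd_mult mult.assoc)
  then have "Legendre p q = 1" using Legendre_divisor_n q op by blast
  ultimately show ?thesis using Legendre_mult[OF q(1,2), of "-1" p] by simp
qed

lemma divisor_mod_4:
  assumes "\<forall>p\<in>prime_factors n. p mod 4 = 1"
  shows "g dvd n \<Longrightarrow> 0 < g \<Longrightarrow> g mod 4 = 1"
proof (induction g rule: prime_divisors_induct)
  case (unit x)
  then have "x = 1" by auto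
  then show ?case by simp
next
  case (factor p x)
  have p: "p dvd n" "x dvd n" using factor.prems(1) by (auto dest: dvd_mult_left dvd_mult_right)
  have "0 < x" using factor.prems(2) prime_gt_0_int[OF factor.hyps(1)] by (simp add: zero_less_mult_iff)
  then have "x mod 4 = 1" using factor.IH p by blast
  moreover have "p mod 4 = 1" using assms p n factor.hyps by (auto simp: prime_factors_dvd)
  ultimately show ?case using mod_mult_eq[of p 4 x] by simp
qed auto

text \<open>If s = -1, then g is not 1 modulo 4, so some prime factor of n is not either. This
  excludes the second alternative of the sign hypothesis and makes -1 a residue at each odd q | e2
  e3.\<close>

lemma sign_cases:
  assumes "g dvd n" "0 < g" and s: "s = 1 \<or> s = (-1::int)" "(s * g) mod 4 = 1"
  obtains "s = 1" | "s = -1" "0 < e2" "e3 < 0" "\<And>q. prime q \<Longrightarrow> odd q \<Longrightarrow> q dvd e2 * e3 \<Longrightarrow> Legendre (-1) q = 1"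
proof (cases "s = 1")
  case False
  then have s1: "s = -1" using s by blast
  then have "g mod 4 \<noteq> 1" using s(2) by presburger
  then obtain p where p: "p \<in> prime_factors n" "p mod 4 \<noteq> 1" using divisor_mod_4 assms(1,2) by blast
  then have "0 < e2 \<and> e3 < 0" using sign by (auto simp: cong_def)
  then show ?thesis using that(2)[OF s1] Legendre_minus_1_eq_1 p by blast
qed (use that in blast)

lemma gcd_decompose:
  assumes "squarefree a" obtains g a' where "a = g * a'" "0 < g" "g dvd n" "\<forall>p. prime p \<and> p dvd n \<longrightarrow> \<not> p dvd a'"
proof -
  define g where "g = gcd a n"
  have g: "g dvd n" "0 < g" using n by (auto simp: g_def)
  obtain a' where a': "a = g * a'" unfolding g_def by (metis dvdE gcd_dvd1)
  have "\<not> p dvd a'" if "prime p" "p dvd n" for p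
  proof
    assume "p dvd a'"
    moreover from this have "p dvd g" using a' that unfolding g_def by (metis dvd_mult gcd_greatest)
    ultimately have "p^2 dvd a" using a' by (simp add: power2_eq_square mult_dvd_mono)
    then show False using squarefreeD[OF assms] that not_prime_unit by blast
  qed
  then show ?thesis using that a' g by blast
qed

text \<open>Stripping the \<open>n\<close>-part of the triple, with a sign \<open>\<sigma>\<close> making the part removed from \<open>d\<^sub>3\<close> congruent to 1
  modulo 4, leaves an odd Selmer element of the untwisted curve, which must be trivial.\<close>

lemma odd_Sel2_in_sel_reps:
  assumes L: "(d1, d2, d3) \<in> Sel2 e1 e2 e3 n" and od: "odd d1" "odd d2" "odd d3"
  shows "(d1, d2, d3) \<in> sel_reps e1 e2 e3 n"
proof -
  obtain s where sf: "squarefree d1" "squarefree d2" "squarefree d3" "d1 * d2 * d3 = s^2"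
    and R: "loc_solv_R e1 e2 e3 n (d1, d2, d3)" and P: "\<And>p. prime p \<Longrightarrow> loc_solv_p e1 e2 e3 n (d1, d2, d3) p"
    using L unfolding Sel2_iff by blast
  obtain a b c where abc: "d1 = a * b" "d2 = a * c" "d3 = b * c" "coprime a b" "coprime a c" "coprime b c"
    using squarefree_triple_decompose[OF sf] .
  have d34: "d3 mod 4 = 1"
    using d3_mod_4_if_loc_solv_2[OF e_mod(1,2,3,5) n(2) od sf(4)] P by simp
  have sfa: "squarefree a" "squarefree b" "squarefree c"
    using sf abc squarefree_multD by blast+
  obtain ga a' where a: "a = ga * a'" "0 < ga" "ga dvd n" "\<forall>p. prime p \<and> p dvd n \<longrightarrow> \<not> p dvd a'"
    using gcd_decompose[OF sfa(1)] .
  obtain gb b' where b: "b = gb * b'" "0 < gb" "gb dvd n" "\<forall>p. prime p \<and> p dvd n \<longrightarrow> \<not> p dvd b'"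
    using gcd_decompose[OF sfa(2)] .
  obtain gc c' where c: "c = gc * c'" "0 < gc" "gc dvd n" "\<forall>p. prime p \<and> p dvd n \<longrightarrow> \<not> p dvd c'"
    using gcd_decompose[OF sfa(3)] .
  have cop: "coprime ga gb" "coprime ga gc" "coprime gb gc" using abc a b c by auto
  define g1 g2 g3 where g: "g1 = ga * gb" "g2 = ga * gc" "g3 = gb * gc"
  have gn: "g1 dvd n" "g2 dvd n" "g3 dvd n" unfolding g using divides_mult a b c cop by blast+
  have gp: "0 < g1" "0 < g2" "0 < g3" unfolding g using a b c by auto
  have "odd g3" using gn(3) n(2) dvd_trans by blast
  then have "(1 * g3) mod 4 = 1 \<or> (-1 * g3) mod 4 = 1" by presburger
  then obtain \<sigma> :: int where \<sigma>: "\<sigma> = 1 \<or> \<sigma> = -1" "(\<sigma> * g3) mod 4 = 1" by blast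
  then have \<sigma>2: "\<sigma> * \<sigma> = 1" by auto
  \<comment> \<open>The sign \<open>\<sigma>\<close> travels with \<open>g3\<close>, so that both
    factors of d3 are 1 modulo 4 and \<open>D3\<close> meets the congruence needed at 2. The same
    sign in \<open>D2\<close> keeps the product a square.\<close>
  define D1 D2 D3 where D: "D1 = a' * b'" "D2 = \<sigma> * (a' * c')" "D3 = \<sigma> * (b' * c')"
  have dD: "d1 = D1 * g1" "d2 = \<sigma> * D2 * g2" "d3 = D3 * (\<sigma> * g3)"
    unfolding D abc g a(1) b(1) c(1) using \<sigma> by auto
  have sfD: "squarefree D1" "squarefree D2" "squarefree D3"
  proof -
    have "D1 dvd d1" "D2 dvd d2" "D3 dvd d3" unfolding dD by auto
    then show "squarefree D1" "squarefree D2" "squarefree D3" using sf squarefree_mono by blast+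
  qed
  have prodD: "D1 * D2 * D3 = (a' * b' * c')^2"
    unfolding D using \<sigma> by (auto simp: power2_eq_square)
  have oD: "odd D1" "odd D2" "odd D3" using od unfolding dD by auto
  have "chi4 D3 * chi4 (\<sigma> * g3) = chi4 d3" unfolding dD chi4_mult ..
  then have D34: "D3 mod 4 = 1" using d34 \<sigma>(2) oD \<open>odd g3\<close> \<sigma>(1) by (auto simp: chi4_def od split: if_splits)
  \<comment> \<open>For \<open>\<sigma>\<close> = -1 the signs of the second and third entries
    change, so real solubility cannot be transported by positive factors; it is rebuilt from
    \<open>D1 > 0\<close>.\<close>
  have LR: "loc_solv_R e1 e2 e3 1 (D1, D2, D3)"
  proof (rule sign_cases[OF gn(3) gp(3) \<sigma>])
    assume "\<sigma> = 1"
    then show ?thesis using loc_solv_R_scale[OF n(1) gp, of e1 e2 e3 1 D1 D2 D3] R dD by simp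
  next
    assume "0 < e2" "e3 < 0"
    have nzd: "d1 \<noteq> 0" "d2 \<noteq> 0" "d3 \<noteq> 0" "D2 \<noteq> 0" "D3 \<noteq> 0" using sf sfD by auto
    have "0 < d1" using loc_solv_R_imp_pos[OF \<open>0 < e2\<close> \<open>e3 < 0\<close> n(1) sf(4) nzd(1-3) R] .
    then have "0 < D1" using dD(1) gp(1) by (simp add: zero_less_mult_iff)
    then show ?thesis using loc_solv_R_if_d1_pos[OF \<open>0 < e2\<close> \<open>e3 < 0\<close> _ e_sum prodD] nzd by simp
  qed
  have LP: "loc_solv_p e1 e2 e3 1 (D1, D2, D3) p" if p: "prime p" "odd p" for p
  proof (cases "p dvd e1 * e2 * e3")
    case False
    have "\<not> p dvd D1" "\<not> p dvd D2" "\<not> p dvd D3"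
    proof -
      have "\<not> p dvd D1 \<and> \<not> p dvd D2 \<and> \<not> p dvd D3"
      proof (cases "p dvd n")
        case True
        then have "\<not> p dvd a'" "\<not> p dvd b'" "\<not> p dvd c'" using a b c p by auto
        then show ?thesis unfolding D using p(1) \<sigma>(1) by (auto simp: prime_dvd_mult_iff)
      next
        case False
        then have "\<not> p dvd e1 * e2 * e3 * n" using \<open>\<not> p dvd e1 * e2 * e3\<close> p by (simp add: prime_dvd_mult_iff)
        then have "\<not> p dvd d1" "\<not> p dvd d2" "\<not> p dvd d3" using not_dvd_triple_if_loc_solv_p[OF p(1) _ sf] P p(1) by blast+
        then show ?thesis unfolding dD by auto
      qed
      then show "\<not> p dvd D1" "\<not> p dvd D2" "\<not> p dvd D3" by auto
    qed
    then show ?thesis using loc_solv_p_good[OF p e_sum _ _ _ _ prodD] False by simp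
  next
    case True
    have Ln: "Legendre n p = 1" using Legendre_divisor_n[OF p True, of n] n by simp
    have Lg: "Legendre g1 p = 1" "Legendre g2 p = 1" "Legendre g3 p = 1"
      using Legendre_divisor_n[OF p True] gn gp by auto
    have scaled: "loc_solv_p e1 e2 e3 1 (D1, D2, D3) p" if "Legendre \<sigma> p = 1"
      by (rule loc_solv_p_scale[OF p Ln Lg(1), of "\<sigma> * g2" "\<sigma> * g3"])
        (use that Lg P[OF p(1)] dD Legendre_mult[OF p] in \<open>simp_all add: ac_simps\<close>)
    show ?thesis
    proof (rule sign_cases[OF gn(3) gp(3) \<sigma>])
      assume "\<sigma> = 1"
      then show ?thesis using scaled Legendre_1[OF p(1)] by simp
    next
      assume s1: "\<sigma> = -1" and l: "\<And>q. prime q \<Longrightarrow> odd q \<Longrightarrow> q dvd e2 * e3 \<Longrightarrow> Legendre (-1) q = 1"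
      show ?thesis
      proof (cases "p dvd e2 * e3")
        case True
        then show ?thesis using scaled l[OF p] s1 by simp
      next
        case False
        then have pe: "p dvd e1" "\<not> p dvd e2 * 1" using True p by (auto simp: prime_dvd_mult_iff)
        \<comment> \<open>At a prime dividing e1 but not e2 e3 the sign need not be a square.
          Scaling reaches only the triple with \<open>D2\<close> and \<open>D3\<close> negated, and
          \<open>loc_solv_p_negate\<close> turns it back.\<close>
        have "loc_solv_p e1 e2 e3 1 (D1, - D2, - D3) p"
          by (rule loc_solv_p_scale[OF p Ln Lg])
            (use P[OF p(1)] dD s1 in simp)
        moreover have "D1 * (- D2) * (- D3) = (a' * b' * c')^2" using prodD by simp
        ultimately show ?thesis
          using loc_solv_p_negate[OF p e_sum pe, of D1 "- D2" "- D3" "a' * b' * c'"] sfD by simp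
      qed
    qed
  qed
  have "loc_solv_p e1 e2 e3 1 (D1, D2, D3) 2"
    by (rule loc_solv_2_by_reciprocity[OF e_sum e_mod(1-4) _ sfD prodD oD(1,2) D34 LR LP]) simp
  moreover have "p = 2" if "prime p" "even p" for p :: int
    using that by (metis prime_odd_int prime_ge_2_int le_neq_trans)
  ultimately have "\<forall>p. prime p \<longrightarrow> loc_solv_p e1 e2 e3 1 (D1, D2, D3) p" using LP by metis
  then have "(D1, D2, D3) \<in> Sel2 e1 e2 e3 1" unfolding Sel2_iff using sfD prodD LR by blast
  then have "(D1, D2, D3) = (1, 1, 1)" using T1.tors_odd_imp_one oD unfolding Sel2_1_eq by blast
  then have "d1 = g1" "d2 = \<sigma> * g2" "d3 = \<sigma> * g3" using dD by auto
  then show ?thesis using L gn gp d34 \<sigma>(1) unfolding sel_reps_def by auto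
qed

end

section \<open>The matrix conditions\<close>

text \<open>The isomorphism of F_2 with the group of signs, through which the rows of the matrix
  become products of Legendre symbols.\<close>

definition sg :: "bit \<Rightarrow> int" where "sg b = (if b = 0 then 1 else -1)"

lemma sg_simps [simp]: "sg 0 = 1" "sg 1 = -1" by (auto simp: sg_def)

lemma bit_cases: "(b::bit) = 0 \<or> b = 1" by (cases b) auto

lemma sg_add: "sg (a + b) = sg a * sg b"
  using bit_cases[of a] bit_cases[of b] by auto

lemma sg_sum: "sg (\<Sum>x\<in>A. f x) = (\<Prod>x\<in>A. sg (f x))"
  by (induction A rule: infinite_finite_induct)
    (simp_all only: sum.infinite prod.infinite sum.empty prod.empty sum.insert prod.insert sg_add sg_simps not_False_eq_True)

lemma sg_eq_1_iff: "sg b = 1 \<longleftrightarrow> b = 0" by (auto simp: sg_def)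

lemma sg_qr_bit: "\<not> p dvd u \<Longrightarrow> sg (qr_bit u p) = Legendre u p"
  by (auto simp: qr_bit_def Legendre_def cong_0_iff)

text \<open>\<open>hilb\<close> is defined by solubility, so its value is computed directly. A root
  s of q gives the solution (1, 0, s). For a nonresidue q, a solution modulo p^2 has p | x and p |
  z, and then p^2 | n y^2 forces p | y.\<close>

lemma sg_hilb_unit:
  assumes p: "prime p" "odd p" "p dvd n" "\<not> p^2 dvd n" and q: "\<not> p dvd q"
  shows "sg (hilb q (- n) p) = Legendre q p"
proof (cases "QuadRes p q")
  case True
  have "\<exists>x y z. \<not> (p dvd x \<and> p dvd y \<and> p dvd z) \<and> [q * x^2 + - n * y^2 = z^2] (mod p ^ N)" for N
  proof -
    obtain s where "[s^2 = q] (mod p ^ N)" "\<not> p dvd s" using square_root_mod_power[OF p(1,2) q True] by blast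
    then show ?thesis by (intro exI[of _ 1] exI[of _ 0] exI[of _ s]) (auto simp: cong_sym)
  qed
  then have "hilb q (- n) p = 0" unfolding hilb_def by simp
  then show ?thesis using True Legendre_eq_1_iff[OF q] by simp
next
  case False
  have "\<not> (\<exists>x y z. \<not> (p dvd x \<and> p dvd y \<and> p dvd z) \<and> [q * x^2 + - n * y^2 = z^2] (mod p ^ 2))"
  proof
    assume "\<exists>x y z. \<not> (p dvd x \<and> p dvd y \<and> p dvd z) \<and> [q * x^2 + - n * y^2 = z^2] (mod p ^ 2)"
    then obtain x y z where prim: "\<not> (p dvd x \<and> p dvd y \<and> p dvd z)"
      and c: "p^2 dvd q * x^2 + - n * y^2 - z^2" unfolding cong_iff_dvd_diff by blast
    have "p dvd q * x^2 + - n * y^2 - z^2" by (rule dvd_trans[OF _ c]) simp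
    moreover have "p dvd - n * y^2" using p(3) by simp
    ultimately have "p dvd (q * x^2 + - n * y^2 - z^2) - (- n * y^2)" by (rule dvd_diff)
    then have cg: "[q * x^2 = z^2] (mod p)" by (simp add: cong_iff_dvd_diff)
    have x: "p dvd x"
    proof (rule ccontr)
      assume x: "\<not> p dvd x"
      have "Legendre (z^2) p = Legendre q p"
        using Legendre_cong[OF cg] Legendre_mult[OF p(1,2)] Legendre_square_arg[OF p(1,2) x] by simp
      moreover have "Legendre q p = -1" using False Legendre_values[OF q] Legendre_eq_1_iff[OF q] by blast
      moreover have "Legendre (z^2) p = Legendre z p * Legendre z p" using Legendre_mult[OF p(1,2)] by (simp add: power2_eq_square)
      ultimately show False using zero_le_square[of "Legendre z p"] by linarith
    qed
    then have z: "p dvd z" using cong_dvd_iff[OF cg] p(1) by (simp add: prime_dvd_power_iff power2_eq_square prime_dvd_mult_iff)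
    have "p^2 dvd q * x^2 - z^2" using x z by (intro dvd_diff) (simp_all add: dvd_power_same)
    then have "p^2 dvd (q * x^2 - z^2) - (q * x^2 + - n * y^2 - z^2)" using c by (rule dvd_diff)
    then have ny: "p^2 dvd n * y^2" by simp
    have "\<not> p dvd y" using prim x z by blast
    then have "coprime (p^2) (y^2)" using p(1) by (simp add: prime_imp_coprime)
    then show False using ny p(4) coprime_dvd_mult_left_iff by blast
  qed
  then have "hilb q (- n) p = 1" unfolding hilb_def by auto
  then show ?thesis using False Legendre_values[OF q] Legendre_eq_1_iff[OF q] by simp
qed

text \<open>In symbols, (p, -p n') = (p, -p)(p, n') = (n'/p). Explicitly, a root s of n' gives the
  solution (s, 1, 0); conversely, a solution modulo p^2 has p | z, and dividing by p leaves x^2 = n'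
  y^2 modulo p.\<close>

lemma sg_hilb_self:
  assumes p: "prime p" "odd p" "\<not> p dvd n'"
  shows "sg (hilb p (- (p * n')) p) = Legendre n' p"
proof (cases "QuadRes p n'")
  case True
  have "\<exists>x y z. \<not> (p dvd x \<and> p dvd y \<and> p dvd z) \<and> [p * x^2 + - (p * n') * y^2 = z^2] (mod p ^ N)" for N
  proof -
    obtain s where s: "[s^2 = n'] (mod p ^ N)" "\<not> p dvd s" using square_root_mod_power[OF p True] by blast
    then have "[p * s^2 - p * n' * 1^2 = p * n' - p * n' * 1^2] (mod p ^ N)" by (intro cong_diff cong_scalar_left cong_refl)
    then show ?thesis using s by (intro exI[of _ s] exI[of _ 1] exI[of _ 0]) auto
  qed
  then have "hilb p (- (p * n')) p = 0" unfolding hilb_def by simp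
  then show ?thesis using True Legendre_eq_1_iff[OF p(3)] by simp
next
  case False
  have p0: "p \<noteq> 0" using p by auto
  have "\<not> (\<exists>x y z. \<not> (p dvd x \<and> p dvd y \<and> p dvd z) \<and> [p * x^2 + - (p * n') * y^2 = z^2] (mod p ^ 2))"
  proof
    assume "\<exists>x y z. \<not> (p dvd x \<and> p dvd y \<and> p dvd z) \<and> [p * x^2 + - (p * n') * y^2 = z^2] (mod p ^ 2)"
    then obtain x y z where prim: "\<not> (p dvd x \<and> p dvd y \<and> p dvd z)"
      and c: "p^2 dvd p * x^2 + - (p * n') * y^2 - z^2" unfolding cong_iff_dvd_diff by blast
    have c1: "p dvd p * x^2 + - (p * n') * y^2 - z^2" by (rule dvd_trans[OF _ c]) simp
    have "p dvd p * x^2 + - (p * n') * y^2" by (intro dvd_add) auto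
    from dvd_diff[OF this c1]
    have "p dvd (p * x^2 + - (p * n') * y^2) - (p * x^2 + - (p * n') * y^2 - z^2)" .
    then have "p dvd z^2" by simp
    then have z: "p dvd z" using p(1) by (simp add: prime_dvd_power_iff)
    then have "p^2 dvd z^2" by (simp add: dvd_power_same)
    with c have "p^2 dvd (p * x^2 + - (p * n') * y^2 - z^2) + z^2" by (rule dvd_add)
    moreover have "(p * x^2 + - (p * n') * y^2 - z^2) + z^2 = p * (x^2 - n' * y^2)" by (simp add: algebra_simps)
    ultimately have "p * p dvd p * (x^2 - n' * y^2)" by (simp add: power2_eq_square)
    then have "p dvd x^2 - n' * y^2" using p0 by simp
    then have cg: "[x^2 = n' * y^2] (mod p)" by (simp add: cong_iff_dvd_diff)
    show False
    proof (cases "p dvd y")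
      case True
      then have "p dvd x" using cong_dvd_iff[OF cg] p(1) by (simp add: prime_dvd_power_iff power2_eq_square prime_dvd_mult_iff)
      then show False using prim True z by blast
    next
      case y: False
      have "Legendre (x^2) p = Legendre n' p"
        using Legendre_cong[OF cg] Legendre_mult[OF p(1,2)] Legendre_square_arg[OF p(1,2) y] by simp
      moreover have "Legendre n' p = -1" using False Legendre_values[OF p(3)] Legendre_eq_1_iff[OF p(3)] by blast
      moreover have "Legendre (x^2) p = Legendre x p * Legendre x p" using Legendre_mult[OF p(1,2)] by (simp add: power2_eq_square)
      ultimately show False using zero_le_square[of "Legendre x p"] by linarith
    qed
  qed
  then have "hilb p (- (p * n')) p = 1" unfolding hilb_def by auto
  then show ?thesis using False Legendre_values[OF p(3)] Legendre_eq_1_iff[OF p(3)] by simp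
qed

section \<open>Row sums as Legendre symbols\<close>

lemma prod_prime_factors_squarefree:
  assumes "squarefree (d::int)" shows "(\<Prod>q\<in>prime_factors d. q) = \<bar>d\<bar>"
proof -
  have d: "d \<noteq> 0" using assms by auto
  have "(\<Prod>q\<in>prime_factors d. q) = (\<Prod>q\<in>prime_factors d. q ^ multiplicity q d)"
    using assms squarefree_factorial_semiring'[OF d] by (intro prod.cong) auto
  then show ?thesis using prod_prime_factors[OF d] by simp
qed

lemma Legendre_prod:
  assumes "prime p" "odd p" shows "Legendre (\<Prod>q\<in>A. f q) p = (\<Prod>q\<in>A. Legendre (f q) p)"
  by (induction A rule: infinite_finite_induct) (use assms in \<open>auto simp: Legendre_mult Legendre_1\<close>)

lemma squarefree_multiplicity_eq:
  "squarefree (d::int) \<Longrightarrow> prime q \<Longrightarrow> multiplicity q d = (if q dvd d then 1 else 0)"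
  using squarefree_factorial_semiring'[of d] by (cases "d = 0") (auto simp: prime_factors_dvd not_dvd_imp_multiplicity_0)

lemma sg_sum_multiplicity:
  assumes "squarefree d" "d dvd n" "n \<noteq> (0::int)"
  shows "sg (\<Sum>q\<in>prime_factors n. F q * of_nat (multiplicity q d)) = (\<Prod>q\<in>prime_factors d. sg (F q))"
proof -
  have d: "d \<noteq> 0" using assms by auto
  have "sg (\<Sum>q\<in>prime_factors n. F q * of_nat (multiplicity q d))
    = (\<Prod>q\<in>prime_factors n. if q dvd d then sg (F q) else 1)"
    unfolding sg_sum
  proof (intro prod.cong refl)
    fix q assume "q \<in> prime_factors n"
    then have "multiplicity q d = (if q dvd d then 1 else 0)"
      using squarefree_multiplicity_eq[OF assms(1)] in_prime_factors_imp_prime by blast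
    then show "sg (F q * of_nat (multiplicity q d)) = (if q dvd d then sg (F q) else 1)" by (cases "q dvd d") simp_all
  qed
  also have "\<dots> = (\<Prod>q\<in>prime_factors d. sg (F q))"
    using assms d by (intro prod.mono_neutral_cong_right) (auto simp: prime_factors_dvd intro: dvd_trans)
  finally show ?thesis .
qed

text \<open>\<open>chi4 q * q\<close> is q^*; the sign in the reciprocity law is the symbol of
  \<open>chi4 q\<close> modulo p.\<close>

lemma Legendre_star_reciprocity:
  assumes "prime p" "odd p" "prime q" "odd q" "p \<noteq> q"
  shows "Legendre p q = Legendre (chi4 q * q) p"
proof -
  have n: "\<not> q dvd p" "\<not> p dvd q" using assms prime_not_dvd_prime by auto
  have c: "chi4 q = 1 \<or> chi4 q = -1" "chi4 p = 1 \<or> chi4 p = -1" using assms by (auto simp: chi4_def)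
  have r: "Legendre p q * Legendre q p = (if chi4 p = -1 \<and> chi4 q = -1 then -1 else 1)"
    using Legendre_reciprocity[OF assms] .
  have "Legendre (chi4 q * q) p = Legendre (chi4 q) p * Legendre q p" using Legendre_mult assms by blast
  moreover have "Legendre (chi4 q) p = (if chi4 p = -1 \<and> chi4 q = -1 then -1 else 1)"
    using c Legendre_1[OF assms(1)] Legendre_minus1[OF assms(1,2)] by auto
  ultimately show ?thesis using r Legendre_values[OF n(1)] Legendre_values[OF n(2)] by auto
qed

text \<open>The product of the q^* is d up to sign, and it is 1 modulo 4 like d. This is what
  normalising \<open>d3\<close> achieves: after reciprocity the transposed row yields the symbol of
  \<open>d3\<close>, sign included.\<close>

lemma prod_star_primes:
  assumes "squarefree d" "d mod 4 = 1" shows "(\<Prod>q\<in>prime_factors d. chi4 q * q) = d"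
proof -
  let ?P = "\<Prod>q\<in>prime_factors d. chi4 q * q"
  have od: "odd d" using assms(2) by presburger
  have d0: "d \<noteq> 0" using od by auto
  have oq: "odd q" if "q \<in> prime_factors d" for q using that od by (auto simp: prime_factors_dvd dest: dvd_trans)
  have c1: "chi4 q = 1 \<or> chi4 q = -1" if "q \<in> prime_factors d" for q using oq[OF that] by (simp add: chi4_def)
  have chi4_prod: "chi4 (\<Prod>q\<in>A. f q) = (\<Prod>q\<in>A. chi4 (f q))" for A :: "int set" and f
    by (induction A rule: infinite_finite_induct) (auto simp: chi4_mult, auto simp: chi4_def)
  have "chi4 ?P = (\<Prod>q\<in>prime_factors d. 1)"
    unfolding chi4_prod
  proof (intro prod.cong refl)
    fix q assume q: "q \<in> prime_factors d"
    have "chi4 1 = 1" "chi4 (-1) = -1" by (auto simp: chi4_def)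
    then show "chi4 (chi4 q * q) = 1" using c1[OF q] by (auto simp: chi4_mult)
  qed
  then have P4: "chi4 ?P = 1" by simp
  have u: "(\<Prod>q\<in>A. chi4 q) = 1 \<or> (\<Prod>q\<in>A. chi4 q) = -1" if "A \<subseteq> prime_factors d" for A
    using that
  proof (induction A rule: infinite_finite_induct)
    case (insert x F)
    then show ?case using c1[of x] by auto
  qed auto
  have "?P = (\<Prod>q\<in>prime_factors d. chi4 q) * \<bar>d\<bar>"
    using prod_prime_factors_squarefree[OF assms(1)] by (simp add: prod.distrib)
  then have "?P = d \<or> ?P = - d" using u[OF order_refl] by (cases "0 \<le> d") auto
  moreover have "chi4 (- d) = -1"
  proof -
    have "(- d) mod 4 \<noteq> 1" using assms(2) by presburger
    then show ?thesis using od by (simp add: chi4_def)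
  qed
  ultimately show ?thesis using P4 by auto
qed

context twist begin

lemma prime_factor_n:
  assumes "p \<in> prime_factors n"
  obtains n' where "prime p" "odd p" "p dvd n" "\<not> p^2 dvd n" "n = p * n'" "\<not> p dvd n'"
    "\<not> p dvd e1" "\<not> p dvd e2" "\<not> p dvd e3"
proof -
  have p: "prime p" "p dvd n" using assms by (auto simp: prime_factors_dvd)
  have sq: "\<not> p^2 dvd n" using n(3) p squarefreeD not_prime_unit by blast
  obtain n' where n': "n = p * n'" using p(2) by auto
  have "\<not> p dvd n'" using sq n' by (auto simp: power2_eq_square)
  moreover have "odd p" using p(2) n(2) dvd_trans by blast
  moreover have "\<not> p dvd e1 * e2 * e3" using p not_dvd_n by blast
  then have "\<not> p dvd e1" "\<not> p dvd e2" "\<not> p dvd e3" by auto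
  ultimately show ?thesis using that p sq n' by blast
qed

text \<open>Off the diagonal (q, -n) at p is (q/p), and the diagonal entry is (n'/p). Multiplying
  over the primes of the positive number d gives the symbol of d, or of d/p together with the
  diagonal entry.\<close>

lemma row1_sum:
  assumes p: "p \<in> prime_factors n" and np: "n = p * n'" and d: "d dvd n" "0 < d"
  shows "sg (\<Sum>q\<in>prime_factors n. hilb q (- n) p * of_nat (multiplicity q d))
    = (if p dvd d then Legendre (d div p) p * Legendre n' p else Legendre d p)"
proof -
  obtain n'' where P: "prime p" "odd p" "p dvd n" "\<not> p^2 dvd n" "n = p * n''" "\<not> p dvd n''"
    using prime_factor_n[OF p] by metis
  have "n'' = n'" using P np by auto
  have sf: "squarefree d" using d n(3) squarefree_mono by blast
  have S: "sg (\<Sum>q\<in>prime_factors n. hilb q (- n) p * of_nat (multiplicity q d)) = (\<Prod>q\<in>prime_factors d. sg (hilb q (- n) p))"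
    using sg_sum_multiplicity[OF sf d(1)] n(1) by simp
  have L: "sg (hilb q (- n) p) = Legendre q p" if "q \<in> prime_factors d" "q \<noteq> p" for q
    using that P prime_not_dvd_prime[of p q] by (intro sg_hilb_unit) (auto simp: prime_factors_dvd)
  have pd: "(\<Prod>q\<in>prime_factors d. q) = d" using prod_prime_factors_squarefree[OF sf] d(2) by simp
  show ?thesis
  proof (cases "p dvd d")
    case False
    then have "(\<Prod>q\<in>prime_factors d. sg (hilb q (- n) p)) = (\<Prod>q\<in>prime_factors d. Legendre q p)"
      using L by (intro prod.cong refl) (auto simp: prime_factors_dvd)
    then show ?thesis unfolding S using False Legendre_prod[OF P(1,2), of "\<lambda>q. q" "prime_factors d"] unfolding pd by simp
  next
    case True
    then have mem: "p \<in> prime_factors d" using P d by (auto simp: prime_factors_dvd)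
    have rm: "prod f (prime_factors d) = f p * prod f (prime_factors d - {p})" for f :: "int \<Rightarrow> int"
      using mem by (intro prod.remove) auto
    have "(\<Prod>q\<in>prime_factors d - {p}. sg (hilb q (- n) p)) = (\<Prod>q\<in>prime_factors d - {p}. Legendre q p)"
      using L by (intro prod.cong refl) auto
    moreover have "(\<Prod>q\<in>prime_factors d - {p}. q) = d div p"
      using rm[of "\<lambda>q. q"] pd P(1) by (metis nonzero_mult_div_cancel_left not_prime_0)
    moreover have "sg (hilb p (- n) p) = Legendre n' p"
      using sg_hilb_self[OF P(1,2,6)] P(5) \<open>n'' = n'\<close> by simp
    ultimately show ?thesis unfolding S rm[of "\<lambda>q. sg (hilb q (- n) p)"]
      using True Legendre_prod[OF P(1,2), of "\<lambda>q. q" "prime_factors d - {p}"] by simp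
  qed
qed

text \<open>The transposed entries (p, -n) are taken at q and equal (p/q), so reciprocity first
  moves them to p as (q^*/p). If p | d, leaving p^* out of the product of the q^* leaves
  \<open>chi4 p * (d div p)\<close>.\<close>

lemma row2_sum:
  assumes p: "p \<in> prime_factors n" and np: "n = p * n'" and d: "d dvd n" "d mod 4 = 1"
  shows "sg (\<Sum>q\<in>prime_factors n. hilb p (- n) q * of_nat (multiplicity q d))
    = (if p dvd d then Legendre (chi4 p * (d div p)) p * Legendre n' p else Legendre d p)"
proof -
  obtain n'' where P: "prime p" "odd p" "p dvd n" "\<not> p^2 dvd n" "n = p * n''" "\<not> p dvd n''"
    using prime_factor_n[OF p] by metis
  have "n'' = n'" using P np by auto
  have sf: "squarefree d" using d n(3) squarefree_mono by blast
  have d0: "d \<noteq> 0" using sf by auto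
  have S: "sg (\<Sum>q\<in>prime_factors n. hilb p (- n) q * of_nat (multiplicity q d)) = (\<Prod>q\<in>prime_factors d. sg (hilb p (- n) q))"
    using sg_sum_multiplicity[OF sf d(1)] n(1) by simp
  have L: "sg (hilb p (- n) q) = Legendre (chi4 q * q) p" if "q \<in> prime_factors d" "q \<noteq> p" for q
  proof -
    have "q \<in> prime_factors n" using that(1) d n by (auto simp: prime_factors_dvd intro: dvd_trans)
    then obtain m where Q: "prime q" "odd q" "q dvd n" "\<not> q^2 dvd n" "n = q * m" using prime_factor_n by metis
    have "sg (hilb p (- n) q) = Legendre p q" using Q P prime_not_dvd_prime[of q p] that by (intro sg_hilb_unit) auto
    then show ?thesis using Legendre_star_reciprocity[OF P(1,2) Q(1,2)] that by auto
  qed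
  have pd: "(\<Prod>q\<in>prime_factors d. chi4 q * q) = d" using prod_star_primes[OF sf d(2)] .
  show ?thesis
  proof (cases "p dvd d")
    case False
    then have "(\<Prod>q\<in>prime_factors d. sg (hilb p (- n) q)) = (\<Prod>q\<in>prime_factors d. Legendre (chi4 q * q) p)"
      using L by (intro prod.cong refl) (auto simp: prime_factors_dvd)
    then show ?thesis unfolding S using False Legendre_prod[OF P(1,2), of "\<lambda>q. chi4 q * q" "prime_factors d"] unfolding pd by simp
  next
    case True
    then have mem: "p \<in> prime_factors d" using P d0 by (auto simp: prime_factors_dvd)
    have rm: "prod f (prime_factors d) = f p * prod f (prime_factors d - {p})" for f :: "int \<Rightarrow> int"
      using mem by (intro prod.remove) auto
    let ?Q = "\<Prod>q\<in>prime_factors d - {p}. chi4 q * q"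
    have "(\<Prod>q\<in>prime_factors d - {p}. sg (hilb p (- n) q)) = (\<Prod>q\<in>prime_factors d - {p}. Legendre (chi4 q * q) p)"
      using L by (intro prod.cong refl) auto
    moreover have "?Q = chi4 p * (d div p)"
    proof -
      have "d = p * (chi4 p * ?Q)" using rm[of "\<lambda>q. chi4 q * q"] pd by (simp add: ac_simps)
      then have "d div p = chi4 p * ?Q" using P(1) by (metis nonzero_mult_div_cancel_left not_prime_0)
      moreover have "chi4 p * chi4 p = 1" using P(2) by (simp add: chi4_def)
      ultimately show ?thesis by (metis mult.assoc mult_1)
    qed
    moreover have "sg (hilb p (- n) p) = Legendre n' p"
      using sg_hilb_self[OF P(1,2,6)] P(5) \<open>n'' = n'\<close> by simp
    ultimately show ?thesis unfolding S rm[of "\<lambda>q. sg (hilb p (- n) q)"]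
      using True Legendre_prod[OF P(1,2), of "\<lambda>q. chi4 q * q" "prime_factors d - {p}"] by simp
  qed
qed

text \<open>The four positions of p in the triple correspond to the four local torsion classes. In
  each of them the two rows are either the two residue conditions for solubility, or one of these
  and the product of both.\<close>

lemma rows_iff_loc_solv:
  assumes p: "p \<in> prime_factors n"
    and d: "d1 dvd n" "d2 dvd n" "d3 dvd n" "0 < d1" "d3 mod 4 = 1" "d1 * d2 * d3 = s^2"
  shows "(\<Sum>q\<in>prime_factors n. hilb q (- n) p * of_nat (multiplicity q d1)) + qr_bit e2 p * of_nat (multiplicity p d1)
          + qr_bit (- e2*e3) p * of_nat (multiplicity p d3) = 0 \<and>
        qr_bit (- e1*e2) p * of_nat (multiplicity p d1)
          + (\<Sum>q\<in>prime_factors n. hilb p (- n) q * of_nat (multiplicity q d3)) + qr_bit e2 p * of_nat (multiplicity p d3) = 0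
     \<longleftrightarrow> loc_solv_p e1 e2 e3 n (d1, d2, d3) p" (is "?r1 = 0 \<and> ?r2 = 0 \<longleftrightarrow> _")
proof -
  obtain n' where P: "prime p" "odd p" "p dvd n" "\<not> p^2 dvd n" "n = p * n'" "\<not> p dvd n'"
    and pe: "\<not> p dvd e1" "\<not> p dvd e2" "\<not> p dvd e3"
    using prime_factor_n[OF p] by metis
  have sf: "squarefree d1" "squarefree d2" "squarefree d3" using d n(3) squarefree_mono by blast+
  obtain a b c where abc: "d1 = a * b" "d2 = a * c" "d3 = b * c" "coprime a b" "coprime a c" "coprime b c"
    using squarefree_triple_decompose[OF sf d(6)] .
  have cop: "\<not> (p dvd x \<and> p dvd y)" if "coprime x y" for x y
    using that P by (meson coprime_common_divisor not_prime_unit)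
  have nd1: "\<not> p dvd -1" using not_dvd_minus_1 P by blast
  have npe: "\<not> p dvd - e2 * e3" "\<not> p dvd - e1 * e2" using pe P by (auto simp: prime_dvd_mult_iff)
  note LM = Legendre_mult[OF P(1,2)]
  define l where "l x = Legendre x p" for x
  have lm: "l (x * y) = l x * l y" for x y unfolding l_def by (rule LM)
  have lneg: "l (- x) = l (-1) * l x" for x using lm[of "-1" x] by simp
  have lv: "l x = 1 \<or> l x = -1" if "\<not> p dvd x" for x unfolding l_def using Legendre_values[OF that] .
  have lsq: "l x * l x = 1" if "\<not> p dvd x" for x unfolding l_def using Legendre_square[OF that] .
  have lchi: "l (chi4 p) = l (-1)"
  proof -
    have "chi4 p = 1 \<or> chi4 p = -1" using P(2) by (simp add: chi4_def)
    then show ?thesis unfolding l_def using Legendre_minus1[OF P(1,2)] Legendre_1[OF P(1)] by auto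
  qed
  have m1: "sg (x * of_nat (multiplicity p y)) = (if p dvd y then sg x else 1)" if "squarefree y" for x y
    using squarefree_multiplicity_eq[OF that P(1)] by simp
  define R1 R2 where R_def: "R1 = sg ?r1" "R2 = sg ?r2"
  have r1: "R1 = (if p dvd d1 then l (d1 div p) * l n' else l d1) * (if p dvd d1 then l e2 else 1)
      * (if p dvd d3 then l (- e2 * e3) else 1)"
    unfolding R_def sg_add row1_sum[OF p P(5) d(1,4)] m1[OF sf(1)] m1[OF sf(3)] sg_qr_bit[OF pe(2)] sg_qr_bit[OF npe(1)] l_def ..
  have r2: "R2 = (if p dvd d1 then l (- e1 * e2) else 1) * (if p dvd d3 then l (chi4 p * (d3 div p)) * l n' else l d3)
      * (if p dvd d3 then l e2 else 1)"
    unfolding R_def sg_add row2_sum[OF p P(5) d(3,5)] m1[OF sf(1)] m1[OF sf(3)] sg_qr_bit[OF pe(2)] sg_qr_bit[OF npe(2)] l_def ..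
  have ndiv: "\<not> p dvd x'" if "squarefree (p * x')" for x'
  proof
    assume "p dvd x'"
    then have "p^2 dvd p * x'" by (simp add: power2_eq_square)
    then show False using squarefreeD[OF that] P(1) not_prime_unit by blast
  qed
  have p0: "p \<noteq> 0" using P by auto
  have trip: "l x * l y * l z = 1" if "(p * x) * (p * y) * z = s^2" "\<not> p dvd x" "\<not> p dvd y" "\<not> p dvd z" for x y z
  proof -
    have "(x * y * z) * p^2 = s^2" using that(1) by (simp add: power2_eq_square ac_simps)
    then obtain w where "x * y * z = w^2" using square_factor_cancel p0 by blast
    then show ?thesis unfolding l_def using Legendre_triple[OF P(1,2)] that by blast
  qed
  have l1: "l 1 = 1" unfolding l_def using Legendre_1 P by blast
  consider (0) "\<not> p dvd d1" "\<not> p dvd d2" "\<not> p dvd d3" | (a) "p dvd d1" "p dvd d2" "\<not> p dvd d3"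
    | (b) "p dvd d1" "\<not> p dvd d2" "p dvd d3" | (c) "\<not> p dvd d1" "p dvd d2" "p dvd d3"
    using cop abc P(1) by (auto simp: prime_dvd_mult_iff)
  then have "R1 = 1 \<and> R2 = 1 \<longleftrightarrow> loc_solv_p e1 e2 e3 n (d1, d2, d3) p"
  proof cases
    case 0
    have "loc_solv_p e1 e2 e3 n (d1, d2, d3) p \<longleftrightarrow> l d1 = 1 \<and> l d3 = 1"
    proof
      assume "loc_solv_p e1 e2 e3 n (d1, d2, d3) p"
      then show "l d1 = 1 \<and> l d3 = 1" unfolding l_def
        using residues_if_loc_solv_p_twist[OF P(1-4) pe(1) 0 d(6)] by blast
    next
      assume a: "l d1 = 1 \<and> l d3 = 1"
      then have "Legendre d2 p = 1" using Legendre_triple[OF P(1,2) d(6) 0] unfolding l_def by simp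
      then show "loc_solv_p e1 e2 e3 n (d1, d2, d3) p" using a unfolding l_def by (intro loc_solv_p_residues[OF P(1,2)]) auto
    qed
    then show ?thesis unfolding r1 r2 using 0 by simp
  next
    case a
    then obtain x y where xy: "d1 = p * x" "d2 = p * y" unfolding dvd_def by blast
    have nd: "\<not> p dvd x" "\<not> p dvd y" using ndiv sf xy by auto
    have iff: "loc_solv_p e1 e2 e3 n (d1, d2, d3) p \<longleftrightarrow> l (e2 * n' * x) = 1 \<and> l (- e1 * n' * y) = 1"
      unfolding xy P(5) l_def
      using residues_if_loc_solv_p_twist_ramified[OF P(1,2,6) pe(1,2) nd a(3)] loc_solv_p_twist_ramified[OF P(1,2) e_sum] by blast
    have "l x * l y * l d3 = 1" using trip[of x y d3] d(6) nd a(3) xy by simp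
    then have lx: "l x * l d3 = l y" using lv[OF nd(2)] by auto
    have dv: "d1 div p = x" using xy p0 by auto
    have s1: "R1 = l (e2 * n' * x)" unfolding r1 dv lm using a by simp
    have "R1 * R2 = (l e2 * l e2) * l (-1) * l e1 * l n' * (l x * l d3)"
      unfolding s1 unfolding r2 lm lneg[of e1] using a by simp
    also have "\<dots> = l (- e1 * n' * y)" unfolding lx lsq[OF pe(2)] lm lneg[of e1] by simp
    finally have "R1 * R2 = l (- e1 * n' * y)" .
    then show ?thesis unfolding iff s1 by auto
  next
    case b
    then obtain x y where xy: "d3 = p * x" "d1 = p * y" unfolding dvd_def by blast
    have nd: "\<not> p dvd x" "\<not> p dvd y" using ndiv sf xy by auto
    have "loc_solv_p e1 e2 e3 n (d1, d2, d3) p \<longleftrightarrow> loc_solv_p e3 e1 e2 n (d3, d1, d2) p" using loc_solv_p_rotate by metis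
    also have "\<dots> \<longleftrightarrow> l (e1 * n' * x) = 1 \<and> l (- e3 * n' * y) = 1"
      unfolding xy P(5) l_def
      using residues_if_loc_solv_p_twist_ramified[OF P(1,2,6) pe(3,1) nd b(2)] loc_solv_p_twist_ramified[OF P(1,2), of e3 e1 e2] e_sum by auto
    finally have iff: "loc_solv_p e1 e2 e3 n (d1, d2, d3) p \<longleftrightarrow> l (e1 * n' * x) = 1 \<and> l (- e3 * n' * y) = 1" .
    have dv: "d3 div p = x" "d1 div p = y" using xy p0 by auto
    have "R1 = (l e2 * l e2) * l (- e3 * n' * y)"
      unfolding r1 dv lm lneg[of e2] lneg[of e3] using b by simp
    moreover have "R2 = (l e2 * l e2) * (l (-1) * l (-1)) * l (e1 * n' * x)"
      unfolding r2 dv lm lneg[of e1] lchi using b by simp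
    ultimately show ?thesis unfolding iff using lsq[OF pe(2)] lsq[OF nd1] by auto
  next
    case c
    then obtain x y where xy: "d2 = p * x" "d3 = p * y" unfolding dvd_def by blast
    have nd: "\<not> p dvd x" "\<not> p dvd y" using ndiv sf xy by auto
    have "loc_solv_p e1 e2 e3 n (d1, d2, d3) p \<longleftrightarrow> loc_solv_p e2 e3 e1 n (d2, d3, d1) p" using loc_solv_p_rotate by metis
    also have "\<dots> \<longleftrightarrow> l (e3 * n' * x) = 1 \<and> l (- e2 * n' * y) = 1"
      unfolding xy P(5) l_def
      using residues_if_loc_solv_p_twist_ramified[OF P(1,2,6) pe(2,3) nd c(1)] loc_solv_p_twist_ramified[OF P(1,2), of e2 e3 e1] e_sum by auto
    finally have iff: "loc_solv_p e1 e2 e3 n (d1, d2, d3) p \<longleftrightarrow> l (e3 * n' * x) = 1 \<and> l (- e2 * n' * y) = 1" .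
    have "l x * l y * l d1 = 1" using trip[of x y d1] d(6) nd c(1) xy by (simp add: ac_simps)
    then have lx: "l y * l d1 = l x" using lv[OF nd(1)] by auto
    have dv: "d3 div p = y" using xy p0 by auto
    have s2: "R2 = l (- e2 * n' * y)"
      unfolding r2 dv lm lneg[of e2] lchi using c by simp
    have "R1 * R2 = (l e2 * l e2) * (l (-1) * l (-1)) * l e3 * l n' * (l y * l d1)"
      unfolding s2 unfolding r1 lm lneg[of e2] using c by simp
    also have "\<dots> = l (e3 * n' * x)" unfolding lx lsq[OF pe(2)] lsq[OF nd1] lm by simp
    finally have "R1 * R2 = l (e3 * n' * x)" .
    then show ?thesis unfolding iff s2 by auto
  qed
  then show ?thesis unfolding R_def sg_eq_1_iff .
qed

end

section \<open>The isomorphism\<close>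

context two_torsion begin

lemma tors_eq_if_parity_eq:
  assumes "(t1, t2, t3) \<in> tors_img e1 e2 e3 m" "(t1', t2', t3') \<in> tors_img e1 e2 e3 m"
    and "even t1 = even t1'" "even t3 = even t3'"
  shows "(t1, t2, t3) = (t1', t2', t3')"
proof -
  have ev: "even (sqf (e1 * m))" "even (sqf (- e2 * m))" "even (sqf (e2 * m))" "odd (sqf (- e1 * e2))"
    "even (sqf (- e3 * m)) \<longleftrightarrow> odd_val e3" "even (sqf (- e2 * e3)) \<longleftrightarrow> \<not> odd_val e3"
    using tors_odd_val e_nz m_nz by (auto simp: even_sqf_iff)
  show ?thesis using assms ev unfolding tors_img_def sqf_trip_def
    by (auto simp del: mult_minus_left)
qed

lemma tors_squarefree:
  assumes "(t1, t2, t3) \<in> tors_img e1 e2 e3 m"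
  shows "squarefree t1" "squarefree t2" "squarefree t3"
  using assms tors_img_subset_Sel2[OF e_nz m_nz e_sum] Sel2_iff by blast+

end

context twist begin

lemma sel_reps_iff:
  "(d1, d2, d3) \<in> sel_reps e1 e2 e3 n \<longleftrightarrow> (d1, d2, d3) \<in> Sel2 e1 e2 e3 n \<and> d1 dvd n \<and> d2 dvd n \<and> d3 dvd n \<and> 0 < d1 \<and> d3 mod 4 = 1"
  unfolding sel_reps_def by simp

lemma divisor_squarefree: "d dvd n \<Longrightarrow> squarefree d"
  using n(3) squarefree_mono by blast

lemma divisor_odd: "d dvd n \<Longrightarrow> odd d"
  using n(2) dvd_trans by blast

text \<open>Outside n the normalised divisors are soluble everywhere: a positive divisor of n is a
  residue at odd q | e1 e2 e3, the sign is handled through \<open>sign_cases\<close>, and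
  reciprocity settles the prime 2. Only the conditions at p | n remain for the matrix.\<close>

lemma divisors_in_Sel2:
  assumes d: "d1 dvd n" "d2 dvd n" "d3 dvd n" "0 < d1" "d3 mod 4 = 1" "d1 * d2 * d3 = s^2"
    and L: "\<forall>p\<in>prime_factors n. loc_solv_p e1 e2 e3 n (d1, d2, d3) p"
  shows "(d1, d2, d3) \<in> Sel2 e1 e2 e3 n"
proof -
  have sf: "squarefree d1" "squarefree d2" "squarefree d3" using d divisor_squarefree by auto
  have nz: "d1 \<noteq> 0" "d2 \<noteq> 0" "d3 \<noteq> 0" using sf by auto
  have "0 < d1 * (d2 * d3)" using square_product_pos[OF d(6) nz] by (simp add: mult.assoc)
  then have "0 < d2 * d3" using d(4) by (simp add: zero_less_mult_iff)
  then have sgn23: "0 < d2 \<and> 0 < d3 \<or> d2 < 0 \<and> d3 < 0" by (simp add: zero_less_mult_iff)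
  have g: "\<bar>d3\<bar> dvd n" "0 < \<bar>d3\<bar>" "\<bar>d2\<bar> dvd n" "0 < \<bar>d2\<bar>" using d nz by auto
  have s: "sgn d3 = 1 \<or> sgn d3 = -1" "(sgn d3 * \<bar>d3\<bar>) mod 4 = 1" using nz(3) d(5) by (auto simp: sgn_if mult_sgn_abs)
  have R: "loc_solv_R e1 e2 e3 n (d1, d2, d3)"
  proof (rule sign_cases[OF g(1,2) s])
    assume "sgn d3 = 1"
    then have "0 < d3" by (auto simp: sgn_if split: if_splits)
    then show ?thesis using sgn23 d(4) by (intro loc_solv_R_if_pos) auto
  next
    assume "0 < e2" "e3 < 0"
    then show ?thesis using loc_solv_R_if_d1_pos n(1) e_sum d nz by blast
  qed
  have P: "loc_solv_p e1 e2 e3 n (d1, d2, d3) p" if p: "prime p" "odd p" for p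
  proof (cases "p dvd n")
    case True
    then show ?thesis using L p n(1) by (auto simp: prime_factors_dvd)
  next
    case False
    then have nd: "\<not> p dvd d1" "\<not> p dvd d2" "\<not> p dvd d3" using d dvd_trans by blast+
    show ?thesis
    proof (cases "p dvd e1 * e2 * e3")
      case F: False
      then have "\<not> p dvd e1 * e2 * e3 * n" using False p by (simp add: prime_dvd_mult_iff)
      then show ?thesis using loc_solv_p_good[OF p e_sum _ nd d(6)] by blast
    next
      case T: True
      have Lg: "Legendre d1 p = 1" "Legendre \<bar>d2\<bar> p = 1" "Legendre \<bar>d3\<bar> p = 1"
        using Legendre_divisor_n[OF p T] d g by auto
      have neg: "Legendre d2 p = 1" "Legendre d3 p = 1" if "Legendre (-1) p = 1" "d2 < 0" "d3 < 0"
        using Lg that Legendre_mult[OF p, of "-1" "- d2"] Legendre_mult[OF p, of "-1" "- d3"] by auto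
      show ?thesis
      proof (rule sign_cases[OF g(1,2) s])
        assume "sgn d3 = 1"
        then have "0 < d3" by (auto simp: sgn_if split: if_splits)
        then show ?thesis using Lg sgn23 by (intro loc_solv_p_residues[OF p]) auto
      next
        assume "sgn d3 = -1" and l: "\<And>q. prime q \<Longrightarrow> odd q \<Longrightarrow> q dvd e2 * e3 \<Longrightarrow> Legendre (-1) q = 1"
        then have "d3 < 0" by (auto simp: sgn_if split: if_splits)
        then have "d2 < 0" using sgn23 by auto
        show ?thesis
        proof (cases "p dvd e2 * e3")
          case True
          then show ?thesis using neg[OF l[OF p True] \<open>d2 < 0\<close> \<open>d3 < 0\<close>] Lg(1) by (intro loc_solv_p_residues[OF p])
        next
          case False
          \<comment> \<open>Here -1 may be a nonresidue; but d1 is positive, hence a residue, which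
            suffices at a prime dividing e1 and not e2.\<close>
          then have "p dvd e1" "\<not> p dvd e2 * n" using T \<open>\<not> p dvd n\<close> p by (auto simp: prime_dvd_mult_iff)
          then show ?thesis using loc_solv_p_multiplicative[OF p e_sum _ _ Lg(1) nd(2,3) d(6)] by blast
        qed
      qed
    qed
  qed
  have "loc_solv_p e1 e2 e3 n (d1, d2, d3) 2"
    by (rule loc_solv_2_by_reciprocity[OF e_sum e_mod(1-4) n(2) sf d(6) _ _ d(5) R P]) (use divisor_odd d in auto)
  moreover have "p = 2" if "prime p" "even p" for p :: int
    using that by (metis prime_odd_int prime_ge_2_int le_neq_trans)
  ultimately have "\<forall>p. prime p \<longrightarrow> loc_solv_p e1 e2 e3 n (d1, d2, d3) p" using P by metis
  then show ?thesis unfolding Sel2_iff using sf d(6) R by blast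
qed

section \<open>The bijection between representatives and the kernel\<close>

lemma sel_vec_in_kernel_iff:
  assumes d: "d1 dvd n" "d2 dvd n" "d3 dvd n" "0 < d1" "d3 mod 4 = 1" "d1 * d2 * d3 = s^2"
  shows "sel_vec n (d1, d2, d3) \<in> sel_kernel e1 e2 e3 n \<longleftrightarrow> (\<forall>p\<in>prime_factors n. loc_solv_p e1 e2 e3 n (d1, d2, d3) p)"
proof -
  have s1: "(\<Sum>q\<in>prime_factors n. hilb q (- n) p * (if q \<in> prime_factors n then of_nat (multiplicity q d) else 0))
     = (\<Sum>q\<in>prime_factors n. hilb q (- n) p * of_nat (multiplicity q d))" for p d
    by (rule sum.cong) simp_all
  have s2: "(\<Sum>q\<in>prime_factors n. hilb p (- n) q * (if q \<in> prime_factors n then of_nat (multiplicity q d) else 0))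
     = (\<Sum>q\<in>prime_factors n. hilb p (- n) q * of_nat (multiplicity q d))" for p d
    by (rule sum.cong) simp_all
  show ?thesis
    unfolding sel_vec_def sel_kernel_def prod.case mem_Collect_eq s1 s2
    using rows_iff_loc_solv[OF _ d]
    by (smt (verit, best))
qed

lemma multiplicity_bit_eq:
  assumes "d dvd n" "d' dvd n" "\<And>q. q \<in> prime_factors n \<Longrightarrow> of_nat (multiplicity q d) = (of_nat (multiplicity q d') :: bit)"
  shows "\<bar>d\<bar> = \<bar>d'\<bar>"
proof -
  have sf: "squarefree d" "squarefree d'" using assms divisor_squarefree by auto
  have iff: "q dvd d \<longleftrightarrow> q dvd d'" if "prime q" for q
  proof (cases "q dvd n")
    case True
    then have "q \<in> prime_factors n" using that n(1) by (auto simp: prime_factors_dvd)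
    then show ?thesis using assms(3)[of q] squarefree_multiplicity_eq[OF sf(1) that] squarefree_multiplicity_eq[OF sf(2) that]
      by (auto split: if_splits)
  next
    case False
    then show ?thesis using assms(1,2) dvd_trans by blast
  qed
  have "d \<noteq> 0" "d' \<noteq> 0" using sf by auto
  then have "prime_factors d = prime_factors d'" using iff by (auto simp: prime_factors_dvd)
  then show ?thesis using prod_prime_factors_squarefree[OF sf(1)] prod_prime_factors_squarefree[OF sf(2)] by simp
qed

text \<open>The bits determine |d1| and |d3|, the normalisations d1 > 0 and d3 = 1 modulo 4 fix the
  signs, and d2 is the square-free representative of d1 d3.\<close>

lemma inj_on_sel_vec: "inj_on (sel_vec n) (sel_reps e1 e2 e3 n)"
proof (rule inj_onI)
  fix L L' assume LL: "L \<in> sel_reps e1 e2 e3 n" "L' \<in> sel_reps e1 e2 e3 n" "sel_vec n L = sel_vec n L'"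
  obtain d1 d2 d3 c1 c2 c3 where L: "L = (d1, d2, d3)" "L' = (c1, c2, c3)" by (metis prod_cases3)
  have d: "(d1, d2, d3) \<in> Sel2 e1 e2 e3 n" "d1 dvd n" "d2 dvd n" "d3 dvd n" "0 < d1" "d3 mod 4 = 1"
    and c: "(c1, c2, c3) \<in> Sel2 e1 e2 e3 n" "c1 dvd n" "c2 dvd n" "c3 dvd n" "0 < c1" "c3 mod 4 = 1"
    using LL L by (auto simp: sel_reps_iff)
  have v: "of_nat (multiplicity q d1) = (of_nat (multiplicity q c1) :: bit)"
     "of_nat (multiplicity q d3) = (of_nat (multiplicity q c3) :: bit)" if "q \<in> prime_factors n" for q
    using LL(3) that unfolding L sel_vec_def by (auto dest!: fun_cong[of _ _ q])
  have e1: "d1 = c1" using multiplicity_bit_eq[OF d(2) c(2) v(1)] d c by auto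
  have "\<bar>d3\<bar> = \<bar>c3\<bar>" using multiplicity_bit_eq[OF d(4) c(4) v(2)] .
  then have "d3 = c3 \<or> d3 = - c3" by linarith
  then have e3: "d3 = c3" using d(6) c(6) by presburger
  obtain s s' where s: "d1 * d2 * d3 = s^2" "c1 * c2 * c3 = s'^2" using d(1) c(1) unfolding Sel2_iff by blast
  have "(d2 * c2) * (d1 * d3)^2 = (d1 * d2 * d3) * (c1 * c2 * c3)" unfolding e1 e3 by (simp add: power2_eq_square ac_simps)
  also have "\<dots> = (s * s')^2" unfolding s by (simp add: power_mult_distrib)
  finally obtain w where "d2 * c2 = w^2" using d c by (auto elim: square_factor_cancel)
  then have "d2 = c2" using squarefree_eq_if_mult_square divisor_squarefree d(3) c(3) by blast
  then show "L = L'" using L e1 e3 by simp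
qed

lemma prod_subset_prime_factors:
  assumes "A \<subseteq> prime_factors n"
  shows "\<Prod>A dvd n" "0 < \<Prod>A" "\<And>q. q \<in> prime_factors n \<Longrightarrow> multiplicity q (\<Prod>A) = (if q \<in> A then 1 else 0)"
proof -
  have fin: "finite A" using assms finite_subset by blast
  have "\<Prod>A dvd \<Prod>(prime_factors n)" using assms by (intro prod_dvd_prod_subset) auto
  then show dvd: "\<Prod>A dvd n" using prod_prime_factors_squarefree[OF n(3)] n(1) by simp
  show "0 < \<Prod>A" using assms in_prime_factors_imp_prime prime_gt_0_int by (intro prod_pos) blast
  fix q assume q: "q \<in> prime_factors n"
  then have pq: "prime q" using in_prime_factors_imp_prime by blast
  have "q dvd \<Prod>A \<longleftrightarrow> q \<in> A"
  proof
    assume "q dvd \<Prod>A"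
    then obtain r where "r \<in> A" "q dvd r" using prime_dvd_prod_iff[OF fin pq, of "\<lambda>x. x"] by auto
    then show "q \<in> A" using pq assms in_prime_factors_imp_prime prime_not_dvd_prime[of q r] by blast
  next
    assume "q \<in> A" then show "q dvd \<Prod>A" using dvd_prodI[OF fin, of q "\<lambda>x. x"] by simp
  qed
  then show "multiplicity q (\<Prod>A) = (if q \<in> A then 1 else 0)"
    using squarefree_multiplicity_eq[OF divisor_squarefree[OF dvd] pq] by simp
qed

lemma squarefree_dvd_n:
  assumes "squarefree d" "\<And>p. prime p \<Longrightarrow> p dvd d \<Longrightarrow> p dvd n" shows "d dvd n"
proof -
  have "d \<noteq> 0" using assms(1) by auto
  then have "prime_factors d \<subseteq> prime_factors n" using assms(2) n(1) by (auto simp: prime_factors_dvd)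
  then have "\<Prod>(prime_factors d) dvd n" by (rule prod_subset_prime_factors)
  then show ?thesis using prod_prime_factors_squarefree[OF assms(1)] by simp
qed

lemma sel_kernel_subset_image: "sel_kernel e1 e2 e3 n \<subseteq> sel_vec n ` sel_reps e1 e2 e3 n"
proof
  fix v assume v: "v \<in> sel_kernel e1 e2 e3 n"
  obtain x z where xz: "v = (x, z)" by (cases v)
  have supp: "x q = 0 \<and> z q = 0" if "q \<notin> prime_factors n" for q using v that unfolding xz sel_kernel_def by auto
  define d1 g where dg: "d1 = \<Prod>{q \<in> prime_factors n. x q = 1}" "g = \<Prod>{q \<in> prime_factors n. z q = 1}"
  have X: "d1 dvd n" "0 < d1" "\<And>q. q \<in> prime_factors n \<Longrightarrow> multiplicity q d1 = (if x q = 1 then 1 else 0)"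
    using prod_subset_prime_factors[of "{q \<in> prime_factors n. x q = 1}"] unfolding dg by auto
  have Z: "g dvd n" "0 < g" "\<And>q. q \<in> prime_factors n \<Longrightarrow> multiplicity q g = (if z q = 1 then 1 else 0)"
    using prod_subset_prime_factors[of "{q \<in> prime_factors n. z q = 1}"] unfolding dg by auto
  have "odd g" using Z(1) divisor_odd by blast
  then have "(1 * g) mod 4 = 1 \<or> (-1 * g) mod 4 = 1" by presburger
  then obtain \<sigma> :: int where \<sigma>: "\<sigma> = 1 \<or> \<sigma> = -1" "(\<sigma> * g) mod 4 = 1" by blast
  define d3 where "d3 = \<sigma> * g"
  have d3: "d3 dvd n" "d3 mod 4 = 1" "\<And>q. multiplicity q d3 = multiplicity q g" using \<sigma> Z(1) unfolding d3_def by auto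
  \<comment> \<open>The only square-free choice that makes the product a square; its primes divide
    d1 d3, so it divides n.\<close>
  define d2 where "d2 = sqf (d1 * d3)"
  have nz: "d1 * d3 \<noteq> 0" using X Z \<sigma> by (auto simp: d3_def)
  obtain r where r: "d1 * d3 = d2 * r^2" "r \<noteq> 0" using sqf_decompose[OF nz] unfolding d2_def .
  have sf2: "squarefree d2" unfolding d2_def using squarefree_sqf[OF nz] .
  have "p dvd n" if "prime p" "p dvd d2" for p
  proof -
    have "p dvd d1 * d3" using r(1) that(2) by simp
    then show ?thesis using that(1) X(1) d3(1) dvd_trans by (auto simp: prime_dvd_mult_iff)
  qed
  then have d2: "d2 dvd n" using squarefree_dvd_n sf2 by blast
  have "d1 * d2 * d3 = d2 * (d1 * d3)" by (simp add: ac_simps)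
  then have sq: "d1 * d2 * d3 = (d2 * r)^2" unfolding r(1) by (simp add: power2_eq_square ac_simps)
  have vec: "sel_vec n (d1, d2, d3) = v"
  proof -
    have b: "of_nat (if b = 1 then 1 else 0) = b" for b :: bit using bit_cases[of b] by auto
    have "(if q \<in> prime_factors n then of_nat (multiplicity q d1) else 0) = x q" for q
      using X(3)[of q] supp[of q] b[of "x q"] by simp
    moreover have "(if q \<in> prime_factors n then of_nat (multiplicity q d3) else 0) = z q" for q
      using Z(3)[of q] d3(3)[of q] supp[of q] b[of "z q"] by simp
    ultimately show ?thesis unfolding sel_vec_def xz by simp
  qed
  then have "\<forall>p\<in>prime_factors n. loc_solv_p e1 e2 e3 n (d1, d2, d3) p"
    using sel_vec_in_kernel_iff[OF X(1) d2 d3(1) X(2) d3(2) sq] v by simp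
  then have "(d1, d2, d3) \<in> Sel2 e1 e2 e3 n" using divisors_in_Sel2[OF X(1) d2 d3(1) X(2) d3(2) sq] by blast
  then have "(d1, d2, d3) \<in> sel_reps e1 e2 e3 n" using X d2 d3 by (simp add: sel_reps_iff)
  then show "v \<in> sel_vec n ` sel_reps e1 e2 e3 n" using vec by (metis image_eqI)
qed

lemma bij_sel_vec: "bij_betw (sel_vec n) (sel_reps e1 e2 e3 n) (sel_kernel e1 e2 e3 n)"
proof -
  have "sel_vec n L \<in> sel_kernel e1 e2 e3 n" if "L \<in> sel_reps e1 e2 e3 n" for L
  proof -
    obtain d1 d2 d3 where L: "L = (d1, d2, d3)" by (metis prod_cases3)
    have d: "(d1, d2, d3) \<in> Sel2 e1 e2 e3 n" "d1 dvd n" "d2 dvd n" "d3 dvd n" "0 < d1" "d3 mod 4 = 1"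
      using that L by (auto simp: sel_reps_iff)
    obtain s where s: "d1 * d2 * d3 = s^2" and P: "\<forall>p. prime p \<longrightarrow> loc_solv_p e1 e2 e3 n (d1, d2, d3) p"
      using d(1) unfolding Sel2_iff by blast
    show ?thesis unfolding L sel_vec_in_kernel_iff[OF d(2-6) s] using P in_prime_factors_imp_prime by blast
  qed
  then show ?thesis unfolding bij_betw_def using inj_on_sel_vec sel_kernel_subset_image by blast
qed

text \<open>For existence, an odd translate is already a representative. For uniqueness,
  representatives are odd, so the torsion class linking one to L has the parities of L itself and is
  thereby determined.\<close>

lemma exists_rep:
  assumes "L \<in> Sel2 e1 e2 e3 n"
  shows "\<exists>!R. R \<in> sel_reps e1 e2 e3 n \<and> sel_equiv e1 e2 e3 n L R"
proof -
  obtain d1 d2 d3 where L: "L = (d1, d2, d3)" by (metis prod_cases3)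
  have S: "(d1, d2, d3) \<in> Sel2 e1 e2 e3 n" using assms L by simp
  have sf: "squarefree d1" "squarefree d2" "squarefree d3" using S unfolding Sel2_iff by auto
  have nz: "d1 \<noteq> 0" "d2 \<noteq> 0" "d3 \<noteq> 0" using sf by auto
  obtain T c1 c2 c3 where T: "T \<in> tors_img e1 e2 e3 n" "trip_mul (d1, d2, d3) T = (c1, c2, c3)" "odd c1" "odd c2" "odd c3"
    using Tn.exists_odd_translate[OF S] .
  have "(c1, c2, c3) \<in> Sel2 e1 e2 e3 n" using Sel2_tors_closed[OF e_nz _ e_sum S T(1)] T(2) n(1) by simp
  then have rep: "(c1, c2, c3) \<in> sel_reps e1 e2 e3 n" using odd_Sel2_in_sel_reps T by blast
  obtain t1 t2 t3 where t: "T = (t1, t2, t3)" by (metis prod_cases3)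
  have sft: "squarefree t1" "squarefree t2" "squarefree t3" using Tn.tors_squarefree T(1) t by blast+
  have c: "c1 = sqf (d1 * t1)" "c2 = sqf (d2 * t2)" "c3 = sqf (d3 * t3)" using T(2) t by (auto simp: trip_mul_def)
  have "t1 \<noteq> 0" "t2 \<noteq> 0" "t3 \<noteq> 0" using sft by auto
  then have "trip_mul (d1, d2, d3) (c1, c2, c3) = T"
    using sqf_mult_cancel[OF sf(1), of t1] sqf_mult_cancel[OF sf(2), of t2] sqf_mult_cancel[OF sf(3), of t3] sft
    by (auto simp: trip_mul_def t c sqf_of_squarefree)
  then have eqv: "sel_equiv e1 e2 e3 n L (c1, c2, c3)" unfolding sel_equiv_def L using T(1) by simp
  have "R = R'" if R: "R \<in> sel_reps e1 e2 e3 n" "sel_equiv e1 e2 e3 n L R" and R': "R' \<in> sel_reps e1 e2 e3 n" "sel_equiv e1 e2 e3 n L R'" for R R'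
  proof -
    obtain a1 a2 a3 b1 b2 b3 where ab: "R = (a1, a2, a3)" "R' = (b1, b2, b3)" by (metis prod_cases3)
    have dv: "a1 dvd n" "a2 dvd n" "a3 dvd n" "b1 dvd n" "b2 dvd n" "b3 dvd n" using R(1) R'(1) ab by (auto simp: sel_reps_iff)
    have ta: "(sqf (d1 * a1), sqf (d2 * a2), sqf (d3 * a3)) \<in> tors_img e1 e2 e3 n"
      "(sqf (d1 * b1), sqf (d2 * b2), sqf (d3 * b3)) \<in> tors_img e1 e2 e3 n"
      using R(2) R'(2) unfolding sel_equiv_def L ab trip_mul_def by auto
    have ev: "even (sqf (d * a)) \<longleftrightarrow> odd_val d" if "d \<noteq> 0" "a dvd n" for d a
    proof -
      have "odd a" using divisor_odd that by blast
      then have "a \<noteq> 0" by auto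
      then show ?thesis using that odd_val_odd[OF \<open>odd a\<close>] by (simp add: even_sqf_iff odd_val_mult)
    qed
    have eq: "sqf (d1 * a1) = sqf (d1 * b1)" "sqf (d2 * a2) = sqf (d2 * b2)" "sqf (d3 * a3) = sqf (d3 * b3)"
      using Tn.tors_eq_if_parity_eq[OF ta] ev dv nz by auto
    have can: "a = b" if "squarefree d" "sqf (d * a) = sqf (d * b)" "a dvd n" "b dvd n" for d a b
    proof -
      have "squarefree a" "squarefree b" using divisor_squarefree that by auto
      moreover from this have "a \<noteq> 0" "b \<noteq> 0" by auto
      ultimately show ?thesis using sqf_mult_cancel[OF that(1), of a] sqf_mult_cancel[OF that(1), of b] that(2) sqf_of_squarefree by metis
    qed
    show ?thesis unfolding ab using can[OF sf(1) eq(1)] can[OF sf(2) eq(2)] can[OF sf(3) eq(3)] dv by simp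
  qed
  then show ?thesis using rep eqv by blast
qed

lemma multiplicity_sqf_mult:
  assumes "c = sqf (a * b)" "a \<noteq> 0" "b \<noteq> 0" "prime q"
  shows "of_nat (multiplicity q c) = (of_nat (multiplicity q a) + of_nat (multiplicity q b) :: bit)"
proof -
  have nz: "a * b \<noteq> 0" using assms by simp
  obtain r where r: "a * b = c * r^2" "r \<noteq> 0" using sqf_decompose[OF nz] assms(1) by metis
  have "c \<noteq> 0" using r nz by auto
  then have "multiplicity q a + multiplicity q b = multiplicity q c + 2 * multiplicity q r"
    using multiplicity_mult_prime[OF assms(4,2,3)] r multiplicity_mult_prime[OF assms(4), of c "r^2"]
      multiplicity_mult_prime[OF assms(4), of r r] by (simp add: power2_eq_square)
  then have "(of_nat (multiplicity q a + multiplicity q b) :: bit) = of_nat (multiplicity q c + 2 * multiplicity q r)" by simp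
  also have "\<dots> = of_nat (multiplicity q c)" unfolding of_nat_add of_nat_mult by simp
  finally show ?thesis unfolding of_nat_add by simp
qed

text \<open>The product of the three representatives is odd, and being a torsion class it is
  trivial. So L'' is the product of L and L' in square classes, and valuations modulo 2 add.\<close>

lemma sel_vec_hom:
  assumes "L \<in> sel_reps e1 e2 e3 n" "L' \<in> sel_reps e1 e2 e3 n" "L'' \<in> sel_reps e1 e2 e3 n"
    "sel_equiv e1 e2 e3 n (trip_mul L L') L''"
  shows "sel_vec n L'' = vec_add (sel_vec n L) (sel_vec n L')"
proof -
  obtain a1 a2 a3 b1 b2 b3 c1 c2 c3 where abc: "L = (a1, a2, a3)" "L' = (b1, b2, b3)" "L'' = (c1, c2, c3)" by (metis prod_cases3)
  have dv: "a1 dvd n" "a2 dvd n" "a3 dvd n" "b1 dvd n" "b2 dvd n" "b3 dvd n" "c1 dvd n" "c2 dvd n" "c3 dvd n"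
    using assms abc by (auto simp: sel_reps_iff)
  have t: "(sqf (sqf (a1 * b1) * c1), sqf (sqf (a2 * b2) * c2), sqf (sqf (a3 * b3) * c3)) \<in> tors_img e1 e2 e3 n"
    using assms(4) unfolding sel_equiv_def abc trip_mul_def by simp
  have od: "odd (sqf (sqf (a * b) * c))" if "a dvd n" "b dvd n" "c dvd n" for a b c
  proof -
    have o: "odd a" "odd b" "odd c" using divisor_odd that by auto
    then have nz: "a * b \<noteq> 0" "a * b * c \<noteq> 0" by auto
    have "sqf (sqf (a * b) * c) = sqf (a * b * c)" using sqf_mult_sqf_left nz by auto
    then show ?thesis using o nz by (simp add: even_sqf_iff odd_val_odd)
  qed
  have one: "sqf (sqf (a1 * b1) * c1) = 1" "sqf (sqf (a3 * b3) * c3) = 1"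
    using Tn.tors_odd_imp_one[OF t] od dv by auto
  have fin: "sqf (a * b) = c" if "sqf (sqf (a * b) * c) = 1" "a dvd n" "b dvd n" "c dvd n" for a b c
  proof -
    have "a * b \<noteq> 0" using divisor_odd that by auto
    then show ?thesis using sqf_eq_1_iff[of "sqf (a * b)" c] squarefree_sqf divisor_squarefree that by blast
  qed
  have eq: "c1 = sqf (a1 * b1)" "c3 = sqf (a3 * b3)" using fin[OF one(1)] fin[OF one(2)] dv by auto
  have nz: "a1 \<noteq> 0" "b1 \<noteq> 0" "a3 \<noteq> 0" "b3 \<noteq> 0" using divisor_odd dv by auto
  have "(if q \<in> prime_factors n then of_nat (multiplicity q c1) else 0) =
      (if q \<in> prime_factors n then of_nat (multiplicity q a1) else 0) + (if q \<in> prime_factors n then of_nat (multiplicity q b1) else (0::bit))"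
    "(if q \<in> prime_factors n then of_nat (multiplicity q c3) else 0) =
      (if q \<in> prime_factors n then of_nat (multiplicity q a3) else 0) + (if q \<in> prime_factors n then of_nat (multiplicity q b3) else (0::bit))" for q
    using multiplicity_sqf_mult[OF eq(1) nz(1,2)] multiplicity_sqf_mult[OF eq(2) nz(3,4)] in_prime_factors_imp_prime[of q n]
    by (cases "q \<in> prime_factors n"; simp)+
  then show ?thesis unfolding abc sel_vec_def vec_add_def prod.case fst_conv snd_conv by presburger
qed

end

theorem theorem4p4:
  fixes e1 e2 e3 n :: int
  assumes "e1 \<noteq> 0" and "e2 \<noteq> 0" and "e3 \<noteq> 0" and "e1 + e2 + e3 = 0"
    and "2 dvd e1" and "\<not> 4 dvd e1" and "2 dvd e2" and "\<not> 4 dvd e2" and "4 dvd e3"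
    and "n > 0" and "odd n" and "squarefree n" and "coprime n (e1 * e2 * e3)"
    and "\<forall>p\<in>prime_factors n. \<forall>q::int. prime q \<and> odd q \<and> q dvd e1 * e2 * e3 \<longrightarrow> QuadRes q p"
    and "\<not> has_rat_point_order4 e1 e2 1" and "\<not> has_rat_point_order4 e1 e2 n"
    and "(e2 > 0 \<and> e3 < 0) \<or> (\<forall>p\<in>prime_factors n. [p = 1] (mod 4))"
    and "\<forall>p\<in>prime_factors n. \<forall>q::int. prime q \<and> odd q \<and> q dvd e2 * e3 \<longrightarrow>
           Legendre ((-1) ^ nat ((p - 1) div 2) * p) q = 1"
    and "card (Sel2 e1 e2 e3 1) = 4"
  shows "(\<forall>L\<in>Sel2 e1 e2 e3 n. \<exists>!R. R \<in> sel_reps e1 e2 e3 n \<and> sel_equiv e1 e2 e3 n L R)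
     \<and> bij_betw (sel_vec n) (sel_reps e1 e2 e3 n) (sel_kernel e1 e2 e3 n)
     \<and> (\<forall>L\<in>sel_reps e1 e2 e3 n. \<forall>L'\<in>sel_reps e1 e2 e3 n. \<forall>L''\<in>sel_reps e1 e2 e3 n.
          sel_equiv e1 e2 e3 n (trip_mul L L') L'' \<longrightarrow>
          sel_vec n L'' =
            vec_add (sel_vec n L) (sel_vec n L'))"
proof -
  interpret twist e1 e2 e3 n using assms by unfold_locales
  show ?thesis using exists_rep bij_sel_vec sel_vec_hom by blast
qed

end
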